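(* Let $n\in\mathbb{N}$ with $n \geq 7$. The number of nilpotent semigroups of order $n$ and coclass $2$ \begin{enumerate} \item[(i)] counting up to (anti-)isomorphism equals $\frac{1}{8}(21n^2+66n-104) - \lceil n/3 \rceil$ if $n$ is even, and $\frac{1}{8}(21n^2+80n-93) - \lceil n/3 \rceil$ if $n$ is odd; \item[(ii)] counting up to isomorphism equals $\frac{1}{8}(27n^2+150n-240) - \lceil n/3\rceil$ if $n$ is even, and $\frac{1}{8}(27n^2+168n-203) - \lceil n/3 \rceil$ if $n$ is odd; \item[(iii)] counting commutative semigroups up to isomorphism equals $\frac{1}{8}(15n^2-26n-40) - \lceil n/3 \rceil$ if $n$ is even, and $\frac{1}{8}(15n^2-16n-63) - \lceil n/3 \rceil$ if $n$ is odd. \end{enumerate}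
   Context: A semigroup $S$ is nilpotent if there exists $c\in\mathbb{N}_0$ with $|S^{c+1}|=1$, where $S^k$ denotes the set of all products of $k$ elements of $S$; the least such $c$ is the class of $S$. The coclass of a finite nilpotent semigroup $S$ of class $c$ is $|S|-1-c$. Two semigroups are anti-isomorphic if one is isomorphic to the dual (the semigroup with reversed multiplication) of the other. "Up to (anti-)isomorphism" means "up to isomorphism or anti-isomorphism". Item (iii) counts only the commutative semigroups among the nilpotent semigroups of order $n$ and coclass $2$. *)

theory Defs
  imports Complex_Main
begin

text \<open>
  A record of its own, since the class and locale semigroup of Main fix the carrier to be the whole
  type and the monoid record of HOL-Algebra carries a unit.
\<close>

record 'a magma =
  carr :: "'a set"
  mul :: "'a \<Rightarrow> 'a \<Rightarrow> 'a"

definition is_semigroup :: "'a magma \<Rightarrow> bool" where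
  "is_semigroup S \<longleftrightarrow>
     carr S \<noteq> {} \<and>
     (\<forall>x\<in>carr S. \<forall>y\<in>carr S. mul S x y \<in> carr S) \<and>
     (\<forall>x\<in>carr S. \<forall>y\<in>carr S. \<forall>z\<in>carr S. mul S (mul S x y) z = mul S x (mul S y z))"

definition is_commutative :: "'a magma \<Rightarrow> bool" where
  "is_commutative S \<longleftrightarrow> (\<forall>x\<in>carr S. \<forall>y\<in>carr S. mul S x y = mul S y x)"

definition dual :: "'a magma \<Rightarrow> 'a magma" where
  "dual S = \<lparr>carr = carr S, mul = (\<lambda>x y. mul S y x)\<rparr>"

definition isomorphic :: "'a magma \<Rightarrow> 'b magma \<Rightarrow> bool" where
  "isomorphic S T \<longleftrightarrow>
     (\<exists>\<phi>. bij_betw \<phi> (carr S) (carr T) \<and>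
          (\<forall>x\<in>carr S. \<forall>y\<in>carr S. \<phi> (mul S x y) = mul T (\<phi> x) (\<phi> y)))"

definition anti_isomorphic :: "'a magma \<Rightarrow> 'b magma \<Rightarrow> bool" where
  "anti_isomorphic S T \<longleftrightarrow> isomorphic S (dual T)"

text \<open>
  The set of all products of \<open>k\<close> elements. Products have at least one factor, so the set is empty
  for \<open>k = 0\<close>; only positive \<open>k\<close> are used below.
\<close>

definition products :: "'a magma \<Rightarrow> nat \<Rightarrow> 'a set" where
  "products S k =
     {foldl (mul S) x xs | x xs. x \<in> carr S \<and> set xs \<subseteq> carr S \<and> Suc (length xs) = k}"

definition nilpotent :: "'a magma \<Rightarrow> bool" where
  "nilpotent S \<longleftrightarrow> is_semigroup S \<and> (\<exists>c. card (products S (c + 1)) = 1)"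

definition nilpotency_class :: "'a magma \<Rightarrow> nat" where
  "nilpotency_class S = (LEAST c. card (products S (c + 1)) = 1)"

definition coclass :: "'a magma \<Rightarrow> int" where
  "coclass S = int (card (carr S)) - 1 - int (nilpotency_class S)"

text \<open>
  Every semigroup of order \<open>n\<close> has an isomorphic copy with carrier in \<open>nat\<close>, so isomorphism classes
  may be counted among these. The operation is unconstrained outside the carrier; magmas that differ
  only there are isomorphic via the identity and hence are not distinguished by the counts below.
\<close>

definition nilpotent_semigroups :: "nat \<Rightarrow> int \<Rightarrow> nat magma set" where
  "nilpotent_semigroups n r =
     {S. finite (carr S) \<and> card (carr S) = n \<and> nilpotent S \<and> coclass S = r}"

definition number_up_to :: "('a \<Rightarrow> 'a \<Rightarrow> bool) \<Rightarrow> 'a set \<Rightarrow> nat" where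
  "number_up_to R X = card (X // {(S, T). S \<in> X \<and> T \<in> X \<and> R S T})"

end

theory Submission
  imports Defs "HOL-Library.Product_Lexorder"
begin

text \<open>
  Let $S$ have class $c = n - 3$ and put $d_k = |S^k \setminus S^{k+1}|$. These numbers are positive for
  $k \le c$, sum to $c + 2$, and a monogenic $S$ has coclass $0$; moreover $d_2 = 1$ forces $d_k = 1$
  for all $k \ge 2$. Hence either $d_1 = 3$ and the other $d_k$ are $1$ (type A), or
  $d_1 = d_2 = 2$ and the other $d_k$ are $1$ (type B). In both types the one-element layers
  consist of powers of a single generator $u$: cutting a nonzero product of generators in several ways
  shows that every long product equals a power of its first letter.

  So $S$ consists of $u, \dots, u^c$, $u^{c+1} = 0$ and two more elements: generators $v, w$ in type A,
  and a generator $v$ with an element $z \in S^2 \setminus S^3$ in type B. The multiplication is determined by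
  very few products of these. Each element acts on long products like a power of $u$, which gives it
  a weight, and products of total weight below $c$ are forced by associativity, whereas short products
  of larger weight may be $u^c$ or $0$ independently. This yields explicit parameter lists.
  An isomorphism fixes all long products, so it can only permute the generators of weight $1$ or
  swap $v$ and $w$; representatives modulo these permutations are counted. Up to
  anti-isomorphism, the number of classes is half the sum of the number of isomorphism classes and
  the number of self-dual ones.
\<close>

section \<open>Isomorphism and counting up to isomorphism\<close>

text \<open>The elements u^c and 0 become equal after one more factor, so an associativity law
  usually fixes a short product only up to \<open>trunc c (j + 1) = trunc c (k + 1)\<close>, that
  is, j = k or both exponents are at least c. An exponent tied to k in this way has one value if k <
  c and the two values c, c + 1 otherwise. Most counts come from products of such ones and twos. An
  exception is vv in type B when uv = vu = z: there (vv)u = vz is free, only (vv)u^2 is constrained,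
  and vv gets three values near the top. The parity of n enters through the threshold at which the
  square of a generator reaches weight c, recorded by \<open>h = c div 2\<close>. The term with n/3
  comes from the corresponding threshold for v^3 when vv is the only product equal to z. The bound n
  >= 7 means c >= 4. It makes the fourth layer non-empty, and the choice of u in type B rests on
  that layer: the second layer has two elements, so prefixes of length two of a product are not
  determined, but prefixes of length three are.\<close>

lemma products_0 [simp]: "products S 0 = {}"
  by (simp add: products_def)

lemma products_1: "products S (Suc 0) = carr S"
  by (auto simp: products_def)

lemma products_Suc_Suc:
  "products S (Suc (Suc k)) = {mul S x y | x y. x \<in> products S (Suc k) \<and> y \<in> carr S}"
proof (intro set_eqI iffI)
  fix w assume "w \<in> products S (Suc (Suc k))"
  then obtain x xs where *: "w = foldl (mul S) x xs" "x \<in> carr S" "set xs \<subseteq> carr S" "length xs = Suc k"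
    by (auto simp: products_def)
  then obtain ys y where "xs = ys @ [y]" by (metis length_Suc_conv_rev)
  with * show "w \<in> {mul S x y | x y. x \<in> products S (Suc k) \<and> y \<in> carr S}"
    by (auto simp: products_def)
next
  fix w assume "w \<in> {mul S x y | x y. x \<in> products S (Suc k) \<and> y \<in> carr S}"
  then obtain x xs y where "w = mul S (foldl (mul S) x xs) y" "x \<in> carr S" "set xs \<subseteq> carr S"
      "length xs = k" "y \<in> carr S"
    by (auto simp: products_def)
  then have "w = foldl (mul S) x (xs @ [y])" "set (xs @ [y]) \<subseteq> carr S" "length (xs @ [y]) = Suc k"
    by auto
  with \<open>x \<in> carr S\<close> show "w \<in> products S (Suc (Suc k))"
    unfolding products_def by blast
qed

lemma products_Suc:
  "k \<ge> 1 \<Longrightarrow> products S (Suc k) = {mul S x y | x y. x \<in> products S k \<and> y \<in> carr S}"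
  using products_Suc_Suc[of S "k - 1"] by simp

lemma mul_in_carr: "is_semigroup S \<Longrightarrow> x \<in> carr S \<Longrightarrow> y \<in> carr S \<Longrightarrow> mul S x y \<in> carr S"
  by (simp add: is_semigroup_def)

lemma mul_assoc:
  "is_semigroup S \<Longrightarrow> x \<in> carr S \<Longrightarrow> y \<in> carr S \<Longrightarrow> z \<in> carr S \<Longrightarrow>
     mul S (mul S x y) z = mul S x (mul S y z)"
  by (simp add: is_semigroup_def)

lemma products_subset_carr:
  assumes "is_semigroup S" shows "products S k \<subseteq> carr S"
proof (induction k)
  case (Suc k)
  then show ?case
    by (cases k) (use assms in \<open>auto simp: products_1 products_Suc_Suc intro: mul_in_carr\<close>)
qed simp

text \<open>The witness is kept explicit because the classification follows where single generators
  are sent.\<close>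

definition iso_map :: "('a \<Rightarrow> 'b) \<Rightarrow> 'a magma \<Rightarrow> 'b magma \<Rightarrow> bool" where
  "iso_map \<phi> S T \<longleftrightarrow> bij_betw \<phi> (carr S) (carr T) \<and>
     (\<forall>x\<in>carr S. \<forall>y\<in>carr S. \<phi> (mul S x y) = mul T (\<phi> x) (\<phi> y))"

lemma isomorphic_iff: "isomorphic S T \<longleftrightarrow> (\<exists>\<phi>. iso_map \<phi> S T)"
  by (simp add: isomorphic_def iso_map_def)

lemma iso_map_in: "iso_map \<phi> S T \<Longrightarrow> x \<in> carr S \<Longrightarrow> \<phi> x \<in> carr T"
  by (auto simp: iso_map_def bij_betw_def)

lemma iso_map_mul:
  "iso_map \<phi> S T \<Longrightarrow> x \<in> carr S \<Longrightarrow> y \<in> carr S \<Longrightarrow> \<phi> (mul S x y) = mul T (\<phi> x) (\<phi> y)"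
  by (auto simp: iso_map_def)

lemma iso_map_eq_iff:
  "iso_map \<phi> S T \<Longrightarrow> x \<in> carr S \<Longrightarrow> y \<in> carr S \<Longrightarrow> \<phi> x = \<phi> y \<longleftrightarrow> x = y"
  by (auto simp: iso_map_def bij_betw_def inj_on_def)

lemma iso_map_surj: "iso_map \<phi> S T \<Longrightarrow> \<phi> ` carr S = carr T"
  by (auto simp: iso_map_def bij_betw_def)

lemma iso_map_id:
  assumes "carr S = carr T" "\<And>x y. x \<in> carr S \<Longrightarrow> y \<in> carr S \<Longrightarrow> mul S x y = mul T x y"
  shows "iso_map id S T"
  using assms by (auto simp: iso_map_def)

lemma isomorphic_refl: "isomorphic S S"
  using iso_map_id[of S S] by (auto simp: isomorphic_iff)

lemma iso_map_inv:
  assumes "iso_map \<phi> S T" "is_semigroup S"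
  shows "iso_map (inv_into (carr S) \<phi>) T S"
proof -
  have bij: "bij_betw \<phi> (carr S) (carr T)"
    using assms by (simp add: iso_map_def)
  let ?\<psi> = "inv_into (carr S) \<phi>"
  have "?\<psi> (mul T x y) = mul S (?\<psi> x) (?\<psi> y)" if "x \<in> carr T" "y \<in> carr T" for x y
  proof -
    have *: "?\<psi> x \<in> carr S" "?\<psi> y \<in> carr S" "\<phi> (?\<psi> x) = x" "\<phi> (?\<psi> y) = y"
      using that bij bij_betw_inv_into_right inv_into_into[of _ \<phi> "carr S"]
      by (fastforce simp: bij_betw_def)+
    then have "mul T x y = \<phi> (mul S (?\<psi> x) (?\<psi> y))"
      using assms by (simp add: iso_map_mul)
    then show ?thesis
      using bij * assms(2) by (simp add: bij_betw_inv_into_left mul_in_carr)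
  qed
  then show ?thesis
    using bij by (simp add: iso_map_def bij_betw_inv_into)
qed

lemma isomorphic_sym: "isomorphic S T \<Longrightarrow> is_semigroup S \<Longrightarrow> isomorphic T S"
  using iso_map_inv by (auto simp: isomorphic_iff)

lemma iso_map_comp: "iso_map \<phi> S T \<Longrightarrow> iso_map \<psi> T U \<Longrightarrow> iso_map (\<psi> \<circ> \<phi>) S U"
  unfolding iso_map_def
  by (intro conjI ballI) (auto intro: bij_betw_trans dest: bij_betwE)

lemma isomorphic_trans: "isomorphic S T \<Longrightarrow> isomorphic T U \<Longrightarrow> isomorphic S U"
  using iso_map_comp unfolding isomorphic_iff by blast

lemma iso_map_semigroup:
  assumes "iso_map \<phi> S T" "is_semigroup S" shows "is_semigroup T"
proof -
  have carr: "carr T = \<phi> ` carr S" using assms by (simp add: iso_map_surj)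
  have mul: "mul T (\<phi> x) (\<phi> y) = \<phi> (mul S x y)" if "x \<in> carr S" "y \<in> carr S" for x y
    using assms that by (simp add: iso_map_mul)
  have "carr S \<noteq> {}" using assms by (simp add: is_semigroup_def)
  then show ?thesis
    unfolding is_semigroup_def carr using assms
    by (auto simp: mul mul_in_carr mul_assoc)
qed

text \<open>The chain S, S^2, S^3, ... is carried along by isomorphisms. This later pins down the
  powers of u one by one and separates types A and B.\<close>

lemma iso_map_products:
  assumes "iso_map \<phi> S T" "is_semigroup S" shows "products T k = \<phi> ` products S k"
proof (induction k)
  case (Suc k)
  show ?case
  proof (cases "k = 0")
    case True
    then show ?thesis using iso_map_surj[OF assms(1)] by (simp add: products_1)
  next
    case False
    then have T: "products T (Suc k) = {mul T x y | x y. x \<in> products T k \<and> y \<in> carr T}"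
      and S: "products S (Suc k) = {mul S x y | x y. x \<in> products S k \<and> y \<in> carr S}"
      by (simp_all add: products_Suc)
    have "mul T (\<phi> x) (\<phi> y) = \<phi> (mul S x y)" if "x \<in> products S k" "y \<in> carr S" for x y
      using assms that products_subset_carr[OF assms(2)] by (metis iso_map_mul subsetD)
    then have "{mul T x y | x y. x \<in> \<phi> ` products S k \<and> y \<in> \<phi> ` carr S} =
        \<phi> ` {mul S x y | x y. x \<in> products S k \<and> y \<in> carr S}"
      by (auto simp: image_iff) (metis+)
    then show ?thesis
      unfolding T S Suc.IH iso_map_surj[OF assms(1), symmetric] .
  qed
qed simp

lemma iso_map_card_products:
  assumes "iso_map \<phi> S T" "is_semigroup S"
  shows "card (products T k) = card (products S k)"
proof -
  have "inj_on \<phi> (products S k)"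
    using assms(1) products_subset_carr[OF assms(2)]
    unfolding iso_map_def bij_betw_def by (meson inj_on_subset)
  then show ?thesis
    unfolding iso_map_products[OF assms] by (rule card_image)
qed

section \<open>Duality\<close>

lemma carr_dual [simp]: "carr (dual S) = carr S" and mul_dual [simp]: "mul (dual S) x y = mul S y x"
  by (simp_all add: dual_def)

lemma dual_dual [simp]: "dual (dual (S :: 'a magma)) = S"
  by (simp add: dual_def)

lemma isomorphic_dual: "isomorphic S T \<Longrightarrow> isomorphic (dual S) (dual T)"
  unfolding isomorphic_def by auto

lemma is_semigroup_dual: "is_semigroup S \<Longrightarrow> is_semigroup (dual S)"
  unfolding is_semigroup_def by auto

text \<open>The recursion for products appends a factor on the right. By associativity a factor can
  be prepended instead, which makes S^k the same set for S and for its dual.\<close>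

lemma products_Suc_left:
  assumes "is_semigroup S" "k \<ge> 1"
  shows "products S (Suc k) = {mul S x y | x y. x \<in> carr S \<and> y \<in> products S k}"
  using assms(2)
proof (induction k rule: dec_induct)
  case base
  then show ?case by (simp add: products_1 products_Suc)
next
  case (step k)
  have "products S (Suc (Suc k)) =
      {mul S (mul S x y) z | x y z. x \<in> carr S \<and> y \<in> products S k \<and> z \<in> carr S}"
    unfolding products_Suc_Suc step.IH by blast
  also have "\<dots> = {mul S x (mul S y z) | x y z. x \<in> carr S \<and> y \<in> products S k \<and> z \<in> carr S}"
    using products_subset_carr[OF assms(1), of k] mul_assoc[OF assms(1)]
    by (metis (no_types, opaque_lifting) subsetD)
  also have "\<dots> = {mul S x y | x y. x \<in> carr S \<and> y \<in> products S (Suc k)}"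
    unfolding products_Suc[OF step.hyps(1)] by blast
  finally show ?case .
qed

lemma products_dual:
  assumes "is_semigroup S" shows "products (dual S) k = products S k"
proof (induction k)
  case (Suc k)
  show ?case
  proof (cases "k = 0")
    case False
    then show ?thesis
      using Suc.IH assms products_Suc_left[OF assms, of k] products_Suc[of k "dual S"] by auto
  qed (simp add: products_1)
qed simp

lemma dual_nilpotent_semigroups:
  "S \<in> nilpotent_semigroups n r \<Longrightarrow> dual S \<in> nilpotent_semigroups n r"
  by (auto simp: nilpotent_semigroups_def nilpotent_def coclass_def nilpotency_class_def
      products_dual is_semigroup_dual)

section \<open>Counting classes through representatives\<close>

lemma number_up_to_reps:
  assumes equiv: "equiv X {(S, T). S \<in> X \<and> T \<in> X \<and> R S T}"
    and "\<And>i. i \<in> I \<Longrightarrow> F i \<in> X" "\<And>S. S \<in> X \<Longrightarrow> \<exists>i\<in>I. R S (F i)"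
    and "\<And>i j. i \<in> I \<Longrightarrow> j \<in> I \<Longrightarrow> R (F i) (F j) \<Longrightarrow> i = j"
  shows "number_up_to R X = card I"
proof -
  let ?E = "{(S, T). S \<in> X \<and> T \<in> X \<and> R S T}"
  have "bij_betw (\<lambda>i. ?E `` {F i}) I (X // ?E)"
  proof (rule bij_betw_imageI)
    show "inj_on (\<lambda>i. ?E `` {F i}) I"
    proof (rule inj_onI)
      fix i j assume "i \<in> I" "j \<in> I" "?E `` {F i} = ?E `` {F j}"
      then have "(F i, F j) \<in> ?E"
        using eq_equiv_class[OF _ equiv] assms(2) by blast
      then show "i = j" using assms(4) \<open>i \<in> I\<close> \<open>j \<in> I\<close> by auto
    qed
    show "(\<lambda>i. ?E `` {F i}) ` I = X // ?E"
    proof (intro equalityI subsetI)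
      fix K assume "K \<in> X // ?E"
      then obtain S where S: "S \<in> X" "K = ?E `` {S}" by (auto elim: quotientE)
      then obtain i where "i \<in> I" "R S (F i)" using assms(3) by blast
      then have "(S, F i) \<in> ?E" using S(1) assms(2) by blast
      then have "K = ?E `` {F i}" using S(2) equiv_class_eq[OF equiv] by simp
      then show "K \<in> (\<lambda>i. ?E `` {F i}) ` I" using \<open>i \<in> I\<close> by blast
    next
      fix K assume "K \<in> (\<lambda>i. ?E `` {F i}) ` I"
      then obtain i where "i \<in> I" "K = ?E `` {F i}" by blast
      then show "K \<in> X // ?E" by (simp only: quotientI assms(2))
    qed
  qed
  then show ?thesis by (simp add: number_up_to_def bij_betw_same_card)
qed

text \<open>Burnside's lemma for a group of order two: an orbit of size two contributes 2 + 0 to the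
  right-hand side and a fixed point contributes 1 + 1.\<close>

lemma card_involution_orbits:
  assumes "finite I" "\<And>i. i \<in> I \<Longrightarrow> d i \<in> I" "\<And>i. i \<in> I \<Longrightarrow> d (d i) = i"
  shows "2 * card ((\<lambda>i. {i, d i}) ` I) = card I + card {i\<in>I. d i = i}"
proof -
  let ?O = "(\<lambda>i. {i, d i}) ` I" and ?F = "{i\<in>I. d i = i}"
  have disj: "pairwise disjnt ?O"
    using assms unfolding pairwise_def disjnt_def by (auto; metis)
  have fin: "finite o'" if "o' \<in> ?O" for o' using that by auto
  have "card I = card (\<Union>?O)" using assms(2) by (intro arg_cong[of _ _ card]) auto
  also have "\<dots> = (\<Sum>o'\<in>?O. card o')" by (rule card_Union_disjoint[OF disj fin])
  finally have I: "card I = (\<Sum>o'\<in>?O. card o')" .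
  have "card ?F = card (\<Union>o'\<in>?O. o' \<inter> ?F)" by (intro arg_cong[of _ _ card]) auto
  also have "\<dots> = (\<Sum>o'\<in>?O. card (o' \<inter> ?F))"
    using assms(1) disj by (intro card_UN_disjoint) (auto simp: pairwise_def disjnt_def)
  finally have "card I + card ?F = (\<Sum>o'\<in>?O. card o' + card (o' \<inter> ?F))"
    using I by (simp add: sum.distrib)
  also have "\<dots> = (\<Sum>o'\<in>?O. 2)"
  proof (rule sum.cong)
    fix o' assume "o' \<in> ?O"
    then obtain i where i: "i \<in> I" "o' = {i, d i}" by auto
    show "card o' + card (o' \<inter> ?F) = 2"
    proof (cases "d i = i")
      case True
      then have "o' \<inter> ?F = {i}" "o' = {i}" using i by auto
      then show ?thesis by simp
    next
      case False
      then have "o' \<inter> ?F = {}" "card o' = 2" using i assms(3)[of i] by auto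
      then show ?thesis by simp
    qed
  qed simp
  finally show ?thesis by simp
qed

lemma equiv_isomorphic:
  assumes "X \<subseteq> nilpotent_semigroups n r"
  shows "equiv X {(S, T). S \<in> X \<and> T \<in> X \<and> isomorphic S T}"
proof -
  have "is_semigroup S" if "S \<in> X" for S
    using that assms by (auto simp: nilpotent_semigroups_def nilpotent_def)
  then show ?thesis
    by (intro equivI refl_onI symI transI)
      (auto intro: isomorphic_refl isomorphic_sym isomorphic_trans)
qed

lemma equiv_isomorphic_or_anti:
  fixes n r
  defines "X \<equiv> nilpotent_semigroups n r"
  shows "equiv X {(S, T). S \<in> X \<and> T \<in> X \<and> (isomorphic S T \<or> anti_isomorphic S T)}"
proof -
  have sg: "is_semigroup S" if "S \<in> X" for S
    using that by (auto simp: X_def nilpotent_semigroups_def nilpotent_def)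
  have sym: "isomorphic T (dual S)" if "S \<in> X" "isomorphic S (dual T)" for S T
    using isomorphic_dual[OF isomorphic_sym[OF that(2) sg[OF that(1)]]] by simp
  have trans1: "isomorphic S (dual U)" if "isomorphic S T" "isomorphic T (dual U)" for S T U :: "nat magma"
    using isomorphic_trans[OF that] .
  have trans2: "isomorphic S (dual U)" if "isomorphic S (dual T)" "isomorphic T U" for S T U :: "nat magma"
    using isomorphic_trans[OF that(1) isomorphic_dual[OF that(2)]] .
  have trans3: "isomorphic S U" if "isomorphic S (dual T)" "isomorphic T (dual U)" for S T U :: "nat magma"
    using isomorphic_trans[OF that(1) isomorphic_dual[OF that(2)]] by simp
  show ?thesis
    unfolding anti_isomorphic_def
    by (intro equivI refl_onI symI transI)
      (auto intro: isomorphic_refl isomorphic_sym sg sym isomorphic_trans trans2 trans3)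
qed

text \<open>The dual of \<open>F i\<close> is isomorphic to exactly one \<open>F (d i)\<close>. So
  \<open>d\<close> is an involution on the indices, its orbits are the classes up to
  (anti-)isomorphism, and its fixed points are the self-dual representatives.\<close>

lemma number_up_to_anti:
  fixes n r
  defines "X \<equiv> nilpotent_semigroups n r"
  assumes "finite I" "\<And>i. i \<in> I \<Longrightarrow> F i \<in> X" "\<And>S. S \<in> X \<Longrightarrow> \<exists>i\<in>I. isomorphic S (F i)"
    and inj: "\<And>i j. i \<in> I \<Longrightarrow> j \<in> I \<Longrightarrow> isomorphic (F i) (F j) \<Longrightarrow> i = j"
  shows "2 * number_up_to (\<lambda>S T. isomorphic S T \<or> anti_isomorphic S T) X =
    card I + card {i\<in>I. isomorphic (F i) (dual (F i))}"
proof -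
  let ?R = "\<lambda>S T. isomorphic S T \<or> anti_isomorphic S T"
  let ?E = "{(S, T). S \<in> X \<and> T \<in> X \<and> ?R S T}"
  have equiv: "equiv X ?E" unfolding X_def by (rule equiv_isomorphic_or_anti)
  have sg: "is_semigroup S" if "S \<in> X" for S
    using that by (auto simp: X_def nilpotent_semigroups_def nilpotent_def)
  have "\<exists>j\<in>I. isomorphic (dual (F i)) (F j)" if "i \<in> I" for i
    using that assms dual_nilpotent_semigroups by blast
  then obtain d where d: "d i \<in> I" "isomorphic (dual (F i)) (F (d i))" if "i \<in> I" for i
    by metis
  have d': "isomorphic (F i) (dual (F (d i)))" if "i \<in> I" for i
    using isomorphic_dual[OF d(2)[OF that]] by simp
  have dd: "d (d i) = i" if "i \<in> I" for i
    using isomorphic_trans[OF d'[OF that] d(2)[OF d(1)[OF that]]] inj that d(1) by metis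
  have rel: "?R (F i) (F j) \<longleftrightarrow> j = i \<or> j = d i" if "i \<in> I" "j \<in> I" for i j
  proof
    assume "?R (F i) (F j)"
    then consider "isomorphic (F i) (F j)" | "isomorphic (F i) (dual (F j))"
      by (auto simp: anti_isomorphic_def)
    then show "j = i \<or> j = d i"
    proof cases
      case 2
      then have "isomorphic (F i) (F (d j))" using d that isomorphic_trans by blast
      then have "i = d j" using inj that d by blast
      then show ?thesis using dd that by simp
    qed (use inj that in blast)
  next
    assume "j = i \<or> j = d i"
    then show "?R (F i) (F j)"
      using isomorphic_refl d' that by (auto simp: anti_isomorphic_def)
  qed
  have fixed: "d i = i \<longleftrightarrow> isomorphic (F i) (dual (F i))" if "i \<in> I" for i
    using d' d inj that isomorphic_trans by metis
  \<comment> \<open>Taking the union over the members of an orbit avoids the choice of a member; by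
    \<open>cls\<close> below all members have the same class.\<close>
  have "bij_betw (\<lambda>o'. \<Union>i\<in>o'. ?E `` {F i}) ((\<lambda>i. {i, d i}) ` I) (X // ?E)"
  proof (rule bij_betw_imageI)
    have cls: "(\<Union>i\<in>{i, d i}. ?E `` {F i}) = ?E `` {F i}" if "i \<in> I" for i
    proof -
      have "(F i, F (d i)) \<in> ?E" using rel d(1) that assms(3) by auto
      then show ?thesis using equiv_class_eq[OF equiv] by auto
    qed
    show "inj_on (\<lambda>o'. \<Union>i\<in>o'. ?E `` {F i}) ((\<lambda>i. {i, d i}) ` I)"
    proof (intro inj_onI, elim imageE, hypsubst)
      fix i j assume ij: "i \<in> I" "j \<in> I" "(\<Union>i\<in>{i, d i}. ?E `` {F i}) = (\<Union>i\<in>{j, d j}. ?E `` {F i})"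
      then have "?E `` {F i} = ?E `` {F j}" using cls by simp
      then have "(F i, F j) \<in> ?E" using eq_equiv_class[OF _ equiv] assms(3) ij by blast
      then have "j = i \<or> j = d i" using rel ij by auto
      then show "{i, d i} = {j, d j}" using dd ij by auto
    qed
    show "(\<lambda>o'. \<Union>i\<in>o'. ?E `` {F i}) ` (\<lambda>i. {i, d i}) ` I = X // ?E"
    proof (intro equalityI subsetI)
      fix K assume "K \<in> (\<lambda>o'. \<Union>i\<in>o'. ?E `` {F i}) ` (\<lambda>i. {i, d i}) ` I"
      then obtain i where "i \<in> I" "K = ?E `` {F i}" using cls by auto
      then show "K \<in> X // ?E" by (simp only: quotientI assms(3))
    next
      fix K assume "K \<in> X // ?E"
      then obtain S where S: "S \<in> X" "K = ?E `` {S}" by (auto elim: quotientE)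
      then obtain i where i: "i \<in> I" "isomorphic S (F i)" using assms(4) by blast
      then have "(S, F i) \<in> ?E" using S(1) assms(3) by blast
      then have "K = ?E `` {F i}" using S(2) equiv_class_eq[OF equiv] by simp
      then show "K \<in> (\<lambda>o'. \<Union>i\<in>o'. ?E `` {F i}) ` (\<lambda>i. {i, d i}) ` I"
        unfolding image_image using cls[OF i(1)] i(1) by (intro image_eqI[of _ _ i]) (simp_all only:)
    qed
  qed
  then have "number_up_to ?R X = card ((\<lambda>i. {i, d i}) ` I)"
    by (simp add: number_up_to_def bij_betw_same_card)
  moreover have "{i\<in>I. d i = i} = {i\<in>I. isomorphic (F i) (dual (F i))}" using fixed by blast
  ultimately show ?thesis
    using card_involution_orbits[OF \<open>finite I\<close>, of d] d(1) dd by simp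
qed

section \<open>Multiplication tables on the carrier {1..c + 3}\<close>

text \<open>
  Semigroups are transported to the carrier $\{1, \dots, c + 3\}$: a number $i \le c + 1$ stands for $u^i$, so that
  $c + 1$ is the zero and $u^i u^j$ is \<open>trunc c (i + j)\<close>; $c + 2$ stands for $v$, and $c + 3$ for
  $w$ in \<open>frameA\<close> and for $z$ in \<open>frameB\<close>.
\<close>

definition trunc :: "nat \<Rightarrow> nat \<Rightarrow> nat" where
  "trunc c k = min k (c + 1)"

definition table :: "nat \<Rightarrow> (nat \<Rightarrow> nat \<Rightarrow> nat) \<Rightarrow> nat magma" where
  "table c f = \<lparr>carr = {1..c + 3}, mul = f\<rparr>"

lemma carr_table [simp]: "carr (table c f) = {1..c + 3}" and mul_table [simp]: "mul (table c f) = f"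
  by (simp_all add: table_def)

lemma is_semigroup_tableI:
  assumes "\<And>x y. x \<in> {1..c + 3} \<Longrightarrow> y \<in> {1..c + 3} \<Longrightarrow> f x y \<in> {1..c + 3}"
    and "\<And>x y z. x \<in> {1..c + 3} \<Longrightarrow> y \<in> {1..c + 3} \<Longrightarrow> z \<in> {1..c + 3} \<Longrightarrow> f (f x y) z = f x (f y z)"
  shows "is_semigroup (table c f)"
  unfolding is_semigroup_def carr_table mul_table
  by (intro conjI ballI) (simp, rule assms(1), assumption+, rule assms(2), assumption+)

definition power_table :: "nat \<Rightarrow> (nat \<Rightarrow> nat \<Rightarrow> nat) \<Rightarrow> bool" where
  "power_table c f \<longleftrightarrow> is_semigroup (table c f) \<and>
     (\<forall>i\<in>{1..c + 1}. \<forall>j\<in>{1..c + 1}. f i j = trunc c (i + j))"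

text \<open>The lower bound 2 keeps 1, c + 2 and c + 3 from being products, so that u, v, w are the
  generators.\<close>

definition frameA :: "nat \<Rightarrow> (nat \<Rightarrow> nat \<Rightarrow> nat) \<Rightarrow> bool" where
  "frameA c f \<longleftrightarrow> power_table c f \<and> (\<forall>x\<in>{1..c + 3}. \<forall>y\<in>{1..c + 3}. f x y \<in> {2..c + 1})"

text \<open>The conditions bound S^2 and S^3 as in type B. The last one makes z a product of
  generators and keeps it from being a third generator.\<close>

definition frameB :: "nat \<Rightarrow> (nat \<Rightarrow> nat \<Rightarrow> nat) \<Rightarrow> bool" where
  "frameB c f \<longleftrightarrow> power_table c f \<and>
     (\<forall>x\<in>{1..c + 3}. \<forall>y\<in>{1..c + 3}. f x y \<in> insert (c + 3) {2..c + 1}) \<and>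
     (\<forall>x\<in>insert (c + 3) {2..c + 1}. \<forall>y\<in>{1..c + 3}. f x y \<in> {3..c + 1} \<and> f y x \<in> {3..c + 1}) \<and>
     (\<exists>x\<in>{1, c + 2}. \<exists>y\<in>{1, c + 2}. f x y = c + 3)"

text \<open>The premise means j = k or j, k >= c. In the second case the exponents may stand for u^c
  and 0, which no further factor can tell apart. The validity conditions of codes are built from
  this congruence.\<close>

lemma trunc_add_cong: "trunc c (j + 1) = trunc c (k + 1) \<Longrightarrow> i \<ge> 1 \<Longrightarrow> trunc c (j + i) = trunc c (k + i)"
  by (auto simp: trunc_def min_def split: if_splits)

lemma power_table_mul:
  "power_table c f \<Longrightarrow> 1 \<le> i \<Longrightarrow> i \<le> c + 1 \<Longrightarrow> 1 \<le> j \<Longrightarrow> j \<le> c + 1 \<Longrightarrow> f i j = trunc c (i + j)"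
  by (simp add: power_table_def)

lemma power_table_assoc:
  "power_table c f \<Longrightarrow> x \<in> {1..c + 3} \<Longrightarrow> y \<in> {1..c + 3} \<Longrightarrow> z \<in> {1..c + 3} \<Longrightarrow>
     f (f x y) z = f x (f y z)"
  by (simp add: power_table_def is_semigroup_def)

text \<open>Multiplication by u shifts exponents by one and already reaches all of the target
  interval; the remaining two elements only have to stay inside it.\<close>

lemma table_products_step:
  assumes "power_table c f" "1 \<le> k" "k \<le> c"
    and "products (table c f) k = {k..c + 1}"
    and "\<And>x y. x \<in> {k..c + 1} \<Longrightarrow> y \<in> {c + 2, c + 3} \<Longrightarrow> f x y \<in> {Suc k..c + 1}"
  shows "products (table c f) (Suc k) = {Suc k..c + 1}"
proof -
  have "products (table c f) (Suc k) = {f x y | x y. x \<in> {k..c + 1} \<and> y \<in> {1..c + 3}}"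
    using assms(2,4) by (simp add: products_Suc)
  also have "\<dots> = {Suc k..c + 1}"
  proof (intro equalityI subsetI)
    fix w assume "w \<in> {f x y | x y. x \<in> {k..c + 1} \<and> y \<in> {1..c + 3}}"
    then obtain x y where xy: "x \<in> {k..c + 1}" "y \<in> {1..c + 3}" "w = f x y" by blast
    show "w \<in> {Suc k..c + 1}"
    proof (cases "y \<le> c + 1")
      case True
      then show ?thesis
        using xy assms(2,3) power_table_mul[OF assms(1), of x y] by (auto simp: trunc_def)
    next
      case False
      then have "y \<in> {c + 2, c + 3}" using xy by auto
      then show ?thesis using assms(5) xy by blast
    qed
  next
    fix w assume w: "w \<in> {Suc k..c + 1}"
    then have "w = f (w - 1) 1"
      using power_table_mul[OF assms(1), of "w - 1" 1] assms(2) by (auto simp: trunc_def)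
    moreover have "w - 1 \<in> {k..c + 1}" "(1::nat) \<in> {1..c + 3}" using w by auto
    ultimately show "w \<in> {f x y | x y. x \<in> {k..c + 1} \<and> y \<in> {1..c + 3}}" by blast
  qed
  finally show ?thesis .
qed

text \<open>S^(c+1) is the first power with one element, so the class is c and the coclass (c + 3) -
  1 - c = 2. The set S^2 is treated separately because it differs between the two types.\<close>

lemma table_in_nilpotent_semigroups:
  assumes "power_table c f" "c \<ge> 4" "card (products (table c f) 2) \<noteq> 1"
    and "\<And>k. 3 \<le> k \<Longrightarrow> k \<le> c + 1 \<Longrightarrow> products (table c f) k = {k..c + 1}"
  shows "table c f \<in> nilpotent_semigroups (c + 3) 2"
proof -
  have top: "card (products (table c f) (c + 1)) = 1" using assms by simp
  have lower: "c \<le> j" if "card (products (table c f) (j + 1)) = 1" for j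
  proof (rule ccontr)
    assume "\<not> c \<le> j"
    then consider "j = 0" | "j = 1" | "3 \<le> j + 1" "j < c" by linarith
    then show False
      by cases (use that assms in \<open>auto simp: products_1 numeral_2_eq_2\<close>)
  qed
  have "nilpotency_class (table c f) = c"
    unfolding nilpotency_class_def using top lower by (intro Least_equality) auto
  then show ?thesis
    using top assms(1)
    by (auto simp: nilpotent_semigroups_def nilpotent_def coclass_def power_table_def
        simp del: One_nat_def)
qed

text \<open>The layer containing u^k is a difference of two sets that \<phi> maps onto themselves;
  as it has only one element, that element is fixed.\<close>

lemma iso_map_fixes_power:
  assumes \<phi>: "iso_map \<phi> (table c f) (table c g)" and f: "power_table c f" and k: "1 \<le> k" "k \<le> c + 1"
    and "\<And>j. j \<in> {k, Suc k} \<Longrightarrow> j \<le> c + 1 \<Longrightarrow> products (table c f) j = {j..c + 1}"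
    and "\<And>j. j \<in> {k, Suc k} \<Longrightarrow> j \<le> c + 1 \<Longrightarrow> products (table c g) j = {j..c + 1}"
  shows "\<phi> k = k"
proof -
  have sg: "is_semigroup (table c f)" using f by (simp add: power_table_def)
  \<comment> \<open>For k = c + 1 the second value j = c + 2 gives an empty interval.\<close>
  have im: "\<phi> ` {j..c + 1} = {j..c + 1}" if "j \<in> {k, Suc k}" for j
    using iso_map_products[OF \<phi> sg, of j] assms(5,6) that by (cases "j \<le> c + 1") auto
  have inj: "inj_on \<phi> {1..c + 3}" using \<phi> by (simp add: iso_map_def bij_betw_def)
  have "\<phi> ` ({k..c + 1} - {Suc k..c + 1}) = \<phi> ` {k..c + 1} - \<phi> ` {Suc k..c + 1}"
    by (rule inj_on_image_set_diff[OF inj]) (use k in auto)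
  also have "\<dots> = {k..c + 1} - {Suc k..c + 1}" using im by simp
  finally have "\<phi> ` ({k..c + 1} - {Suc k..c + 1}) = {k..c + 1} - {Suc k..c + 1}" .
  moreover have "{k..c + 1} - {Suc k..c + 1} = {k}" using k by auto
  ultimately show ?thesis by simp
qed

section \<open>The layers of a nilpotent semigroup of coclass 2\<close>

text \<open>
  \<open>pw S u k\<close> is $u^k$ for positive $k$; the value at $0$ is junk.
\<close>

fun pw :: "'a magma \<Rightarrow> 'a \<Rightarrow> nat \<Rightarrow> 'a" where
  "pw S u 0 = u"
| "pw S u (Suc k) = (if k = 0 then u else mul S (pw S u k) u)"

lemma pw_1: "pw S u 1 = u"
  by simp

lemma pw_Suc: "k \<ge> 1 \<Longrightarrow> pw S u (Suc k) = mul S (pw S u k) u"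
  by simp

declare pw.simps [simp del]

section \<open>Layers and factorisations\<close>

locale sgrp =
  fixes S :: "'a magma"
  assumes sg: "is_semigroup S"
begin

abbreviation m (infixl "\<cdot>" 70) where "x \<cdot> y \<equiv> mul S x y"
abbreviation P where "P \<equiv> products S"
definition D :: "nat \<Rightarrow> 'a set" where "D k = P k - P (Suc k)"

lemma P_carr: "x \<in> P k \<Longrightarrow> x \<in> carr S"
  using products_subset_carr[OF sg] by blast

lemma D_carr: "x \<in> D k \<Longrightarrow> x \<in> carr S"
  using P_carr by (auto simp: D_def)

lemma D_P: "x \<in> D k \<Longrightarrow> x \<in> P k"
  by (auto simp: D_def)

lemma closed: "x \<in> carr S \<Longrightarrow> y \<in> carr S \<Longrightarrow> x \<cdot> y \<in> carr S"
  using mul_in_carr[OF sg] .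

lemma assoc: "x \<in> carr S \<Longrightarrow> y \<in> carr S \<Longrightarrow> z \<in> carr S \<Longrightarrow> x \<cdot> y \<cdot> z = x \<cdot> (y \<cdot> z)"
  using mul_assoc[OF sg] .

lemma P_add:
  assumes "j \<ge> 1" "k \<ge> 1"
  shows "P (j + k) = {x \<cdot> y | x y. x \<in> P j \<and> y \<in> P k}"
  using assms(2)
proof (induction k rule: dec_induct)
  case base
  then show ?case using assms(1) by (simp add: products_1 products_Suc)
next
  case (step k)
  have eq: "x \<cdot> y \<cdot> z = x \<cdot> (y \<cdot> z)" if "x \<in> P j" "y \<in> P k" "z \<in> carr S" for x y z
    using that assoc P_carr by blast
  have "P (j + Suc k) = {x \<cdot> y \<cdot> z | x y z. x \<in> P j \<and> y \<in> P k \<and> z \<in> carr S}"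
    using products_Suc[of "j + k" S] assms(1) unfolding step.IH by fastforce
  also have "\<dots> = {x \<cdot> (y \<cdot> z) | x y z. x \<in> P j \<and> y \<in> P k \<and> z \<in> carr S}"
    by (intro Collect_cong iff_exI) (auto simp: eq)
  also have "\<dots> = {x \<cdot> y | x y. x \<in> P j \<and> y \<in> P (Suc k)}"
    unfolding products_Suc[OF step.hyps(1)] by blast
  finally show ?case .
qed

lemma mul_P: "x \<in> P j \<Longrightarrow> y \<in> P k \<Longrightarrow> j \<ge> 1 \<Longrightarrow> k \<ge> 1 \<Longrightarrow> x \<cdot> y \<in> P (j + k)"
  using P_add[of j k] by blast

lemma P_Suc_subset: "k \<ge> 1 \<Longrightarrow> P (Suc k) \<subseteq> P k"
proof (induction k rule: dec_induct)
  case base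
  then show ?case using P_carr by (auto simp: products_1)
next
  case (step k)
  show ?case
  proof
    fix w assume "w \<in> P (Suc (Suc k))"
    then obtain x y where "x \<in> P (Suc k)" "y \<in> carr S" "w = x \<cdot> y"
      using products_Suc[of "Suc k" S] by auto
    moreover from this have "x \<in> P k" using step.IH by blast
    ultimately show "w \<in> P (Suc k)"
      unfolding products_Suc[OF step.hyps(1)] by blast
  qed
qed

lemma P_antimono:
  assumes "1 \<le> j" "j \<le> k" shows "P k \<subseteq> P j"
  using assms(2)
proof (induction k rule: dec_induct)
  case (step k)
  then show ?case using P_Suc_subset[of k] assms by simp
qed simp

text \<open>A factor lying one power deeper would push the product one power deeper, out of its
  layer.\<close>

lemma D_add_factors:
  assumes "x \<in> P j" "y \<in> P k" "x \<cdot> y \<in> D (j + k)" "j \<ge> 1" "k \<ge> 1"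
  shows "x \<in> D j" "y \<in> D k"
  using assms mul_P[of x "Suc j" y k] mul_P[of x j y "Suc k"] by (auto simp: D_def)

lemma D_add:
  assumes "w \<in> D (j + k)" "j \<ge> 1" "k \<ge> 1"
  obtains x y where "x \<in> D j" "y \<in> D k" "w = x \<cdot> y"
proof -
  obtain x y where "x \<in> P j" "y \<in> P k" "w = x \<cdot> y"
    using assms P_add[of j k] by (auto simp: D_def)
  then show thesis using that D_add_factors assms by metis
qed

lemma P_1: "P 1 = carr S"
  by (simp add: products_1)

lemma pw_carr: "u \<in> carr S \<Longrightarrow> pw S u k \<in> carr S"
  by (induction k) (auto simp: pw.simps closed)

lemma pw_add:
  assumes "u \<in> carr S" "i \<ge> 1" "j \<ge> 1" shows "pw S u i \<cdot> pw S u j = pw S u (i + j)"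
  using assms(3)
proof (induction j rule: dec_induct)
  case base
  then show ?case using assms pw_Suc[of i S u] by (simp add: pw_1[simplified])
next
  case (step j)
  then show ?case
    using assms assoc[of "pw S u i" "pw S u j" u] pw_Suc[of j S u] pw_Suc[of "i + j" S u]
    by (simp add: pw_carr)
qed

lemma pw_P:
  assumes "u \<in> carr S" "k \<ge> 1" shows "pw S u k \<in> P k"
  using assms(2)
proof (induction k rule: dec_induct)
  case base
  then show ?case using assms by (simp add: pw_1[simplified] products_1)
next
  case (step k)
  then show ?case using assms by (auto simp: pw_Suc products_Suc)
qed

text \<open>
  If $t = xab$ lies outside $S^4$, then $xa = ab$ as both lie in the one-element second layer, hence
  $t = x(xa)$ and again $xx = xa$.
\<close>

lemma powers_from_second_layer:
  assumes "D 2 = {s}" "D 3 \<noteq> {}"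
  obtains u where "u \<in> D 1" "\<And>k. k \<ge> 2 \<Longrightarrow> D k \<subseteq> {pw S u k}"
proof -
  obtain t where t: "t \<in> D 3" using assms by blast
  obtain x y where xy: "x \<in> D 1" "y \<in> D 2" "t = x \<cdot> y" using t D_add[of t 1 2] by (auto simp: numeral_3_eq_3)
  obtain a b where ab: "a \<in> D 1" "b \<in> D 1" "y = a \<cdot> b" using xy D_add[of y 1 1] by (auto simp: numeral_2_eq_2)
  note carr = D_carr[OF xy(1)] D_carr[OF ab(1)] D_carr[OF ab(2)]
  note P1 = D_P[OF xy(1)] D_P[OF ab(1)] D_P[OF ab(2)]
  have t_eq: "t = x \<cdot> a \<cdot> b" using xy ab carr assoc by simp
  have "x \<cdot> a \<in> D 2"
    using D_add_factors(1)[of "x \<cdot> a" 2 b 1] t t_eq P1 mul_P[of x 1 a 1] by (simp add: numeral_2_eq_2 numeral_3_eq_3)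
  then have "x \<cdot> a = y" using assms xy by auto
  then have "t = x \<cdot> x \<cdot> a" using xy carr assoc by simp
  then have "x \<cdot> x \<in> D 2"
    using D_add_factors(1)[of "x \<cdot> x" 2 a 1] t P1 mul_P[of x 1 x 1] by (simp add: numeral_2_eq_2 numeral_3_eq_3)
  then have D2: "D 2 = {x \<cdot> x}" using assms by auto
  have "D k \<subseteq> {pw S x k}" if "k \<ge> 2" for k
    using that
  proof (induction k rule: dec_induct)
    case base
    then show ?case using D2 by (simp add: pw.simps numeral_2_eq_2)
  next
    case (step k)
    show ?case
    proof
      fix w assume w: "w \<in> D (Suc k)"
      obtain y z where yz: "y \<in> D 1" "z \<in> D k" "w = y \<cdot> z"
        using D_add[of w 1 k] w step by auto
      have "pw S x k = pw S x 1 \<cdot> pw S x (k - 1)"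
        using pw_add[of x 1 "k - 1"] step carr by simp
      then have z: "z = x \<cdot> pw S x (k - 1)" using step yz by (auto simp: pw_1[simplified])
      have yc: "y \<in> carr S" using yz D_carr by blast
      \<comment> \<open>Splitting one x off the power makes yx a prefix of an element of layer k +
        1. So yx lies in the one-element second layer and equals xx.\<close>
      have w': "w = y \<cdot> x \<cdot> pw S x (k - 1)"
        using yz z yc carr pw_carr assoc by simp
      have "y \<cdot> x \<in> D 2"
        using D_add_factors(1)[of "y \<cdot> x" 2 "pw S x (k - 1)" "k - 1"] w w' step
          pw_P[of x "k - 1"] mul_P[of y 1 x 1] yz(1) P1 carr D_P[of y 1]
        by (simp add: numeral_2_eq_2)
      then have "w = pw S x 2 \<cdot> pw S x (k - 1)" using w' D2 by (simp add: pw.simps numeral_2_eq_2)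
      then show "w \<in> {pw S x (Suc k)}"
        using pw_add[of x 2 "k - 1"] carr step by simp
    qed
  qed
  then show thesis using that xy by blast
qed

text \<open>Every prefix of length three of a factorisation t = xabd into generators must be s.
  Hence xab = s = abd and t = x(xab), so the prefix xxa is s as well; then t = x(xxa), and xxx = s.
  For the deeper layers the prefix y x^3 lies in layer 4 and therefore equals x^4.\<close>

lemma powers_from_third_layer:
  assumes "D 3 = {s}" "D 4 = {t}"
  obtains u where "u \<in> D 1" "u \<cdot> u \<in> D 2" "\<And>k. k \<ge> 3 \<Longrightarrow> D k \<subseteq> {pw S u k}"
proof -
  have t: "t \<in> D 4" and s: "s \<in> D 3" using assms by auto
  obtain x w where xw: "x \<in> D 1" "w \<in> D 3" "t = x \<cdot> w" using t D_add[of t 1 3] by auto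
  obtain a v where av: "a \<in> D 1" "v \<in> D 2" "w = a \<cdot> v" using xw D_add[of w 1 2] by (auto simp: numeral_3_eq_3)
  obtain b d where bd: "b \<in> D 1" "d \<in> D 1" "v = b \<cdot> d" using av D_add[of v 1 1] by (auto simp: numeral_2_eq_2)
  note carr = D_carr[OF xw(1)] D_carr[OF av(1)] D_carr[OF bd(1)] D_carr[OF bd(2)]
  note P1 = D_P[OF xw(1)] D_P[OF av(1)] D_P[OF bd(1)] D_P[OF bd(2)]
  have P2: "p \<cdot> q \<in> P 2" if "p \<in> P 1" "q \<in> P 1" for p q
    using mul_P[OF that] by (simp add: numeral_2_eq_2)
  have P3: "p \<cdot> q \<cdot> r \<in> P 3" if "p \<in> P 1" "q \<in> P 1" "r \<in> P 1" for p q r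
    using mul_P[OF P2[OF that(1,2)] that(3)] by simp
  have front: "p \<cdot> q \<cdot> r = s" if "p \<cdot> q \<cdot> r \<cdot> y = t" "p \<in> P 1" "q \<in> P 1" "r \<in> P 1" "y \<in> P 1" for p q r y
    using D_add_factors(1)[of "p \<cdot> q \<cdot> r" 3 y 1] P3[OF that(2-4)] that t assms by simp
  have "t = x \<cdot> a \<cdot> b \<cdot> d" using xw av bd carr assoc closed by simp
  then have xab: "x \<cdot> a \<cdot> b = s" using front P1 by metis
  have "w = s" using xw assms by auto
  then have "t = x \<cdot> (x \<cdot> a \<cdot> b)" using xab xw by simp
  then have "t = x \<cdot> x \<cdot> a \<cdot> b" using carr assoc closed by simp
  then have xxa: "x \<cdot> x \<cdot> a = s" using front P1 by metis
  then have "t = x \<cdot> (x \<cdot> x \<cdot> a)" using xw \<open>w = s\<close> by simp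
  then have "t = x \<cdot> x \<cdot> x \<cdot> a" using carr assoc closed by simp
  then have xxx: "x \<cdot> x \<cdot> x = s" using front P1 by metis
  have "x \<cdot> x \<in> D 2"
    using D_add_factors(1)[of "x \<cdot> x" 2 x 1] xxx P2 P1 s by simp
  have pw3: "pw S x 3 = s" using xxx by (simp add: pw.simps numeral_3_eq_3)
  have pw4: "pw S x 4 = t"
    using pw_add[of x 1 3] carr pw3 xw \<open>w = s\<close> by (simp add: pw_1[simplified])
  have "D k \<subseteq> {pw S x k}" if "k \<ge> 3" for k
    using that
  proof (induction k rule: dec_induct)
    case base
    then show ?case using assms pw3 by simp
  next
    case (step k)
    show ?case
    proof
      fix w assume w: "w \<in> D (Suc k)"
      show "w \<in> {pw S x (Suc k)}"
      \<comment> \<open>The fourth layer is known outright; the general step splits off x^3 and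
        needs a remaining exponent k - 3 >= 1.\<close>
      proof (cases "k = 3")
        case True
        then show ?thesis using w assms pw4 by simp
      next
        case False
        obtain y z where yz: "y \<in> D 1" "z \<in> D k" "w = y \<cdot> z"
          using D_add[of w 1 k] w step by auto
        have k: "k - 3 \<ge> 1" using False step by simp
        have z: "z = pw S x 3 \<cdot> pw S x (k - 3)"
          using pw_add[of x 3 "k - 3"] k carr yz step by auto
        have yc: "y \<in> carr S" using yz D_carr by blast
        have w': "w = y \<cdot> pw S x 3 \<cdot> pw S x (k - 3)"
          using yz z yc carr pw_carr assoc by simp
        have "y \<cdot> pw S x 3 \<in> D 4"
          using D_add_factors(1)[of "y \<cdot> pw S x 3" 4 "pw S x (k - 3)" "k - 3"] w w' k
            pw_P[of x "k - 3"] mul_P[of y 1 "pw S x 3" 3] yz(1) pw_P[of x 3] carr D_P[of y 1]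
          by simp
        then have "w = pw S x 4 \<cdot> pw S x (k - 3)" using w' assms pw4 by simp
        then show ?thesis using pw_add[of x 4 "k - 3"] carr k by simp
      qed
    qed
  qed
  then show thesis using that xw \<open>x \<cdot> x \<in> D 2\<close> by blast
qed

end

section \<open>Layer sizes for class c and order c + 3\<close>

locale coclass2 = sgrp +
  fixes c :: nat
  assumes c4: "c \<ge> 4" and fin: "finite (carr S)" and order: "card (carr S) = c + 3"
    and cls: "card (products S (c + 1)) = 1" "\<And>j. j < c \<Longrightarrow> card (products S (j + 1)) \<noteq> 1"
begin

lemma fin_P: "finite (P k)"
  by (rule finite_subset[OF products_subset_carr[OF sg] fin])

lemma fin_D: "finite (D k)"
  using fin_P by (simp add: D_def)

text \<open>Once S^k = S^(k+1), the chain of powers is constant, so S^k would already have one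
  element, before the class is reached.\<close>

lemma D_nonempty:
  assumes "1 \<le> k" "k \<le> c" shows "D k \<noteq> {}"
proof
  assume "D k = {}"
  then have eq: "P (Suc k) = P k" using P_Suc_subset[OF assms(1)] by (auto simp: D_def)
  have const: "P j = P k" if "k \<le> j" for j
    using that
  proof (induction j rule: dec_induct)
    case (step j)
    then show ?case using eq assms by (simp add: products_Suc)
  qed simp
  have "P (c + 1) = P k" using const[of "c + 1"] assms by simp
  then have "card (P k) = 1" using cls(1) by simp
  moreover have "k - 1 + 1 = k" "k - 1 < c" using assms by auto
  ultimately show False using cls(2)[of "k - 1"] by metis
qed

lemma card_P: "k \<ge> 1 \<Longrightarrow> card (P k) = card (D k) + card (P (Suc k))"
  unfolding D_def using card_Diff_subset[OF fin_P P_Suc_subset, of k] card_mono[OF fin_P P_Suc_subset, of k]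
  by simp

lemma card_D_ge_1: "1 \<le> k \<Longrightarrow> k \<le> c \<Longrightarrow> card (D k) \<ge> 1"
  using D_nonempty[of k] fin_D[of k] by (simp add: Suc_le_eq card_gt_0_iff)

text \<open>S^k contains zero and at least one element from each of the layers k, ..., c.\<close>

lemma card_P_ge:
  assumes "k \<le> c + 1" "1 \<le> k" shows "card (P k) + k \<ge> c + 2"
  using assms
proof (induction k rule: inc_induct)
  case base
  then show ?case using cls by simp
next
  case (step k)
  then show ?case using card_P[of k] card_D_ge_1[of k] by simp
qed

lemma card_P_le:
  assumes "\<And>j. k \<le> j \<Longrightarrow> j \<le> c \<Longrightarrow> card (D j) \<le> 1" "k \<le> c + 1" "1 \<le> k"
  shows "card (P k) + k \<le> c + 2"
proof -
  have "card (P j) + j \<le> c + 2" if "k \<le> j" "j \<le> c + 1" for j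
    using that(2,1)
  proof (induction j rule: inc_induct)
    case base
    then show ?case using cls by simp
  next
    case (step j)
    then show ?case using card_P[of j] assms(1)[of j] assms(3) by simp
  qed
  then show ?thesis using assms by simp
qed

text \<open>Equality in \<open>card_P_ge\<close> leaves no room for a second element in any layer
  from k on.\<close>

lemma card_D_eq_1:
  assumes "card (P k) + k = c + 2" "1 \<le> k" "k \<le> j" "j \<le> c"
  shows "card (D j) = 1"
proof -
  have "card (P j) + j = c + 2" using assms(3,4)
  proof (induction j rule: dec_induct)
    case (step j)
    then show ?case using card_P[of j] card_P_ge[of "Suc j"] card_D_ge_1[of j] assms by simp
  qed (use assms in simp)
  then show ?thesis using card_P[of j] card_P_ge[of "Suc j"] card_D_ge_1[of j] assms by simp
qed

lemma card_le_1I: "A \<subseteq> {a} \<Longrightarrow> card A \<le> 1"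
  using card_mono[of "{a}" A] by simp

text \<open>With a single generator every layer has at most one element, so S would have at most c +
  1 elements instead of c + 3.\<close>

lemma card_D_1: "card (D 1) \<noteq> 1"
proof
  assume "card (D 1) = 1"
  then obtain u where u: "D 1 = {u}" by (meson card_1_singletonE)
  have sub: "D k \<subseteq> {pw S u k}" if "k \<ge> 1" for k
    using that
  proof (induction k rule: dec_induct)
    case base
    then show ?case using u by (simp add: pw.simps)
  next
    case (step k)
    show ?case
    proof
      fix w assume "w \<in> D (Suc k)"
      then obtain x y where "x \<in> D k" "y \<in> D 1" "w = x \<cdot> y" using D_add[of w k 1] step by auto
      then show "w \<in> {pw S u (Suc k)}" using step u by (auto simp: pw_Suc)
    qed
  qed
  have "card (D k) \<le> 1" if "1 \<le> k" for k
    by (rule card_le_1I[OF sub[OF that]])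
  then show False using card_P_le[of 1] order P_1 by simp
qed

text \<open>Zero and one element per layer make up c + 1 elements, so two more have to be placed. At
  least one is a generator; the other is a generator or lies in the second layer, because a
  one-element second layer forces all later layers to have one element.\<close>

lemma layer_cases:
  obtains (A) u where "card (D 1) = 3" "u \<in> D 1"
      "\<And>k. 2 \<le> k \<Longrightarrow> k \<le> c \<Longrightarrow> D k = {pw S u k}"
  | (B) u where "card (D 1) = 2" "card (D 2) = 2" "u \<in> D 1" "u \<cdot> u \<in> D 2"
      "\<And>k. 3 \<le> k \<Longrightarrow> k \<le> c \<Longrightarrow> D k = {pw S u k}"
proof -
  have second: "\<exists>u\<in>D 1. \<forall>k. 2 \<le> k \<and> k \<le> c \<longrightarrow> D k = {pw S u k}" if D2: "card (D 2) = 1"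
  proof -
    obtain s where s: "D 2 = {s}" using D2 by (meson card_1_singletonE)
    have "D 3 \<noteq> {}" using D_nonempty c4 by simp
    from powers_from_second_layer[OF s this]
    obtain u where u: "u \<in> D 1" "\<And>k. k \<ge> 2 \<Longrightarrow> D k \<subseteq> {pw S u k}" by metis
    have "D k = {pw S u k}" if "2 \<le> k" "k \<le> c" for k
      using u(2)[of k] D_nonempty[of k] that by auto
    then show ?thesis using u(1) by blast
  qed
  have sum1: "c + 3 = card (D 1) + card (P 2)"
    using card_P[of 1] P_1 order by (simp add: numeral_2_eq_2)
  have sum2: "card (P 2) = card (D 2) + card (P 3)"
    using card_P[of 2] by (simp add: numeral_3_eq_3)
  have "card (P 2) \<ge> c" "card (P 3) \<ge> c - 1" using card_P_ge[of 2] card_P_ge[of 3] c4 by simp_all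
  moreover have "card (D 1) \<ge> 1" "card (D 2) \<ge> 1" using card_D_ge_1 c4 by simp_all
  ultimately consider "card (D 1) = 3" "card (P 2) = c"
    | "card (D 1) = 2" "card (D 2) = 1" "card (P 2) = c + 1"
    | "card (D 1) = 2" "card (D 2) = 2" "card (P 3) = c - 1"
    using sum1 sum2 card_D_1 c4 by linarith
  then show thesis
  proof cases
    case 1
    then have "card (D 2) = 1" using card_D_eq_1[of 2 2] c4 by simp
    then obtain u where "u \<in> D 1" "\<forall>k. 2 \<le> k \<and> k \<le> c \<longrightarrow> D k = {pw S u k}" using second by blast
    then show thesis using A[of u] 1 by blast
  next
    case 2
    \<comment> \<open>All layers from the second on would have one element, so S^2 would have at
      most c elements, against the assumed c + 1.\<close>
    then obtain u where "\<forall>k. 2 \<le> k \<and> k \<le> c \<longrightarrow> D k = {pw S u k}" using second by blast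
    then have "card (P 2) + 2 \<le> c + 2" by (intro card_P_le) (use c4 in auto)
    then show thesis using 2 by simp
  next
    case 3
    \<comment> \<open>The choice of u uses the layers 3 and 4; the latter is within the class
      because c >= 4.\<close>
    have "card (D 3) = 1" "card (D 4) = 1" using card_D_eq_1[of 3] 3 c4 by simp_all
    then obtain s t where st: "D 3 = {s}" "D 4 = {t}" by (meson card_1_singletonE)
    obtain u where u: "u \<in> D 1" "u \<cdot> u \<in> D 2" "\<And>k. k \<ge> 3 \<Longrightarrow> D k \<subseteq> {pw S u k}"
      using powers_from_third_layer[OF st] by metis
    have "D k = {pw S u k}" if "3 \<le> k" "k \<le> c" for k
      using u(3)[OF that(1)] D_nonempty[of k] that by auto
    then show thesis using B[of u] u(1,2) 3 by blast
  qed
qed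

lemma P_eq_powers:
  assumes u: "u \<in> carr S" and "1 \<le> j" "j \<le> c + 1"
    and D: "\<And>k. j \<le> k \<Longrightarrow> k \<le> c \<Longrightarrow> D k = {pw S u k}"
  shows "P j = pw S u ` {j..c + 1}"
proof -
  have "P i = pw S u ` {i..c + 1}" if "i \<le> c + 1" "j \<le> i" for i
    using that
  proof (induction i rule: inc_induct)
    case base
    obtain o' where "P (c + 1) = {o'}" using cls(1) by (meson card_1_singletonE)
    then show ?case using pw_P[of u "c + 1"] u by auto
  next
    case (step i)
    then have "P i = D i \<union> P (Suc i)" using P_Suc_subset[of i] assms by (auto simp: D_def)
    also have "\<dots> = pw S u ` insert i {Suc i..c + 1}" using step D by simp
    also have "insert i {Suc i..c + 1} = {i..c + 1}" using step by auto
    finally show ?case .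
  qed
  then show ?thesis using assms by simp
qed

lemma pw_trunc:
  assumes "u \<in> carr S" "k \<ge> 1" shows "pw S u (trunc c k) = pw S u k"
proof (cases "k \<le> c + 1")
  case False
  obtain o' where "P (c + 1) = {o'}" using cls(1) by (meson card_1_singletonE)
  moreover have "pw S u (c + 1) \<in> P (c + 1)" "pw S u k \<in> P (c + 1)"
    using pw_P[of u "c + 1"] pw_P[of u k] P_antimono[of "c + 1" k] assms False by auto
  ultimately show ?thesis using False by (simp add: trunc_def)
qed (simp add: trunc_def)

definition label :: "'a \<Rightarrow> 'a \<Rightarrow> 'a \<Rightarrow> nat \<Rightarrow> 'a" where
  "label u v w i = (if i \<le> c + 1 then pw S u i else if i = c + 2 then v else w)"

definition pullback :: "'a \<Rightarrow> 'a \<Rightarrow> 'a \<Rightarrow> nat \<Rightarrow> nat \<Rightarrow> nat" where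
  "pullback u v w x y = inv_into {1..c + 3} (label u v w) (label u v w x \<cdot> label u v w y)"

lemma pullback:
  assumes uvw: "u \<in> carr S" "v \<in> carr S" "w \<in> carr S"
    and cov: "carr S \<subseteq> label u v w ` {1..c + 3}"
  shows "inj_on (label u v w) {1..c + 3}" (is ?inj)
    and "isomorphic S (table c (pullback u v w))" (is ?iso)
    and "power_table c (pullback u v w)" (is ?pow)
    and "\<And>x y. x \<in> {1..c + 3} \<Longrightarrow> y \<in> {1..c + 3} \<Longrightarrow> pullback u v w x y \<in> {1..c + 3} \<and>
      label u v w (pullback u v w x y) = label u v w x \<cdot> label u v w y" (is "PROP ?lab")
proof -
  let ?l = "label u v w" and ?N = "{1..c + 3}" and ?f = "pullback u v w"
  have sub: "?l ` ?N \<subseteq> carr S" using uvw pw_carr by (auto simp: label_def)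
  then have surj: "?l ` ?N = carr S" using cov by blast
  \<comment> \<open>The c + 3 labels cover the c + 3 elements of S, so no label is repeated.\<close>
  then show inj: ?inj using order by (simp add: eq_card_imp_inj_on)
  have bij: "bij_betw ?l ?N (carr S)" using inj surj by (simp add: bij_betw_def)
  have lab: "?f x y \<in> ?N \<and> ?l (?f x y) = ?l x \<cdot> ?l y" if "x \<in> ?N" "y \<in> ?N" for x y
  proof -
    have "?l x \<cdot> ?l y \<in> ?l ` ?N" unfolding surj using closed surj that by blast
    then show ?thesis unfolding pullback_def using inv_into_into f_inv_into_f by metis
  qed
  then show "PROP ?lab" .
  have iso: "iso_map (inv_into ?N ?l) S (table c ?f)"
    unfolding iso_map_def carr_table mul_table
  proof (intro conjI ballI)
    show "bij_betw (inv_into ?N ?l) (carr S) ?N" using bij by (rule bij_betw_inv_into)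
    fix x y assume "x \<in> carr S" "y \<in> carr S"
    then have "?l (inv_into ?N ?l x) = x" "?l (inv_into ?N ?l y) = y"
      using surj by (metis f_inv_into_f)+
    then show "inv_into ?N ?l (x \<cdot> y) = ?f (inv_into ?N ?l x) (inv_into ?N ?l y)"
      by (simp add: pullback_def)
  qed
  then show ?iso by (auto simp: isomorphic_iff)
  have "?f i j = trunc c (i + j)" if "i \<in> {1..c + 1}" "j \<in> {1..c + 1}" for i j
  proof (rule inj_onD[OF inj])
    show "?f i j \<in> ?N" using lab that by simp
    show "trunc c (i + j) \<in> ?N" using that by (auto simp: trunc_def)
    have "?l (?f i j) = pw S u i \<cdot> pw S u j" using lab[of i j] that by (simp add: label_def)
    also have "\<dots> = pw S u (trunc c (i + j))" using pw_add pw_trunc uvw that by simp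
    also have "\<dots> = ?l (trunc c (i + j))" by (simp add: label_def trunc_def)
    finally show "?l (?f i j) = ?l (trunc c (i + j))" .
  qed
  then show ?pow using iso_map_semigroup[OF iso sg] by (simp add: power_table_def)
qed

lemma powers_image:
  "1 \<le> j \<Longrightarrow> label u v w ` {j..c + 1} = pw S u ` {j..c + 1}"
  by (intro image_cong) (auto simp: label_def)

theorem frame_cases:
  "\<exists>f. isomorphic S (table c f) \<and> (frameA c f \<or> frameB c f)"
proof (cases rule: layer_cases)
  case (A u)
  have u: "u \<in> carr S" using A D_carr by blast
  have "card (D 1 - {u}) = 2" using A fin_D by simp
  then obtain v w where vw: "D 1 - {u} = {v, w}" by (meson card_2_iff)
  moreover have "D 1 = insert u (D 1 - {u})" using A by auto
  ultimately have D1: "D 1 = {u, v, w}" by auto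
  have P2: "P 2 = label u v w ` {2..c + 1}"
    using P_eq_powers[of u 2] A u c4 powers_image by simp
  have "carr S = D 1 \<union> P 2" using P_1 P_Suc_subset[of 1] by (auto simp: D_def numeral_2_eq_2)
  moreover have "label u v w ` {1, c + 2, c + 3} = {u, v, w}" by (auto simp: label_def pw.simps)
  ultimately have cov: "carr S = label u v w ` ({1, c + 2, c + 3} \<union> {2..c + 1})"
    unfolding D1 P2 by (simp only: image_Un)
  have cov: "carr S \<subseteq> label u v w ` {1..c + 3}" unfolding cov by (intro image_mono) auto
  have vw: "v \<in> carr S" "w \<in> carr S" using D1 D_carr by auto
  let ?f = "pullback u v w" and ?l = "label u v w"
  note pb = pullback[OF u vw cov]
  have mem: "?l x \<in> P 1" if "x \<in> {1..c + 3}" for x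
    using that u vw pw_carr unfolding P_1 by (simp add: label_def)
  have "?f x y \<in> {2..c + 1}" if "x \<in> {1..c + 3}" "y \<in> {1..c + 3}" for x y
  proof -
    have "?l (?f x y) \<in> P 2"
      using pb(4)[OF that] mul_P[OF mem mem, OF that] by (simp add: numeral_2_eq_2)
    then show ?thesis
      using pb(4)[OF that] inj_on_image_mem_iff[OF pb(1), of "?f x y" "{2..c + 1}"]
      unfolding P2 by auto
  qed
  then have "frameA c ?f" unfolding frameA_def using pb(3) by blast
  then show ?thesis using pb(2) by blast
next
  case (B u)
  have u: "u \<in> carr S" using B D_carr by blast
  obtain v where v: "D 1 = {u, v}" using B by (metis card_2_iff doubleton_eq_iff insertE singletonD)
  \<comment> \<open>By the choice of u, one element of the second layer is uu; the other one, here
    \<open>w\<close>, is the z of type B.\<close>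
  obtain w where w: "D 2 = {u \<cdot> u, w}" using B by (metis card_2_iff doubleton_eq_iff insertE singletonD)
  have vw: "v \<in> carr S" "w \<in> carr S" using v w D_carr by auto
  have P3: "P 3 = label u v w ` {3..c + 1}"
    using P_eq_powers[of u 3] B u c4 powers_image by simp
  have "P 2 = D 2 \<union> P 3" using P_Suc_subset[of 2] by (auto simp: D_def numeral_3_eq_3)
  moreover have "label u v w ` {2, c + 3} = {u \<cdot> u, w}"
    using c4 by (auto simp: label_def pw.simps numeral_2_eq_2)
  ultimately have P2': "P 2 = label u v w ` ({2, c + 3} \<union> {3..c + 1})"
    unfolding w P3 by (simp only: image_Un)
  have "{2, c + 3} \<union> {3..c + 1} = insert (c + 3) {2..c + 1}" using c4 by auto
  then have P2: "P 2 = label u v w ` insert (c + 3) {2..c + 1}" using P2' by simp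
  have "carr S = D 1 \<union> P 2" using P_1 P_Suc_subset[of 1] by (auto simp: D_def numeral_2_eq_2)
  moreover have D1: "D 1 = label u v w ` {1, c + 2}" unfolding v by (auto simp: label_def pw.simps)
  ultimately have "carr S = label u v w ` ({1, c + 2} \<union> insert (c + 3) {2..c + 1})"
    unfolding P2 by (simp only: image_Un)
  also have "\<dots> \<subseteq> label u v w ` {1..c + 3}" by (intro image_mono) auto
  finally have cov: "carr S \<subseteq> label u v w ` {1..c + 3}" .
  let ?f = "pullback u v w" and ?l = "label u v w"
  note pb = pullback[OF u vw cov]
  have mem: "?l x \<in> P 1" if "x \<in> {1..c + 3}" for x
    using that u vw pw_carr unfolding P_1 by (simp add: label_def)
  have f2: "?f x y \<in> insert (c + 3) {2..c + 1}" if "x \<in> {1..c + 3}" "y \<in> {1..c + 3}" for x y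
  proof -
    have "?l (?f x y) \<in> P 2"
      using pb(4)[OF that] mul_P[OF mem mem, OF that] by (simp add: numeral_2_eq_2)
    then show ?thesis
      using pb(4)[OF that] inj_on_image_mem_iff[OF pb(1), of "?f x y" "insert (c + 3) {2..c + 1}"]
      unfolding P2 by auto
  qed
  have f3: "?f x y \<in> {3..c + 1} \<and> ?f y x \<in> {3..c + 1}"
    if "x \<in> insert (c + 3) {2..c + 1}" "y \<in> {1..c + 3}" for x y
  proof -
    have x: "x \<in> {1..c + 3}" "?l x \<in> P 2" using that P2 by auto
    have l3: "?l (?f x y) \<in> P 3" "?l (?f y x) \<in> P 3"
      using pb(4)[OF x(1) that(2)] pb(4)[OF that(2) x(1)] mul_P[OF x(2) mem[OF that(2)]]
        mul_P[OF mem[OF that(2)] x(2)] by (simp_all add: numeral_3_eq_3)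
    have z3: "z \<in> {3..c + 1}" if "z \<in> {1..c + 3}" "?l z \<in> P 3" for z
      using inj_on_image_mem_iff[OF pb(1) that(1), of "{3..c + 1}"] that(2) unfolding P3 by auto
    show ?thesis
      using z3[OF _ l3(1)] z3[OF _ l3(2)] pb(4)[OF x(1) that(2)] pb(4)[OF that(2) x(1)] by blast
  qed
  have "w \<in> D (1 + 1)" using w by (simp add: numeral_2_eq_2)
  then obtain a b where ab: "a \<in> D 1" "b \<in> D 1" "w = a \<cdot> b" using D_add[of w 1 1] by auto
  obtain x y where xy: "x \<in> {1, c + 2}" "y \<in> {1, c + 2}" "a = ?l x" "b = ?l y"
    using ab(1,2) unfolding D1 by (elim imageE) metis
  have xy': "x \<in> {1..c + 3}" "y \<in> {1..c + 3}" using xy by auto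
  have "?l (?f x y) = ?l x \<cdot> ?l y" using pb(4)[OF xy'] by blast
  also have "\<dots> = w" using ab(3) xy(3,4) by metis
  also have "w = ?l (c + 3)" by (simp add: label_def)
  finally have "?f x y = c + 3"
    by (rule inj_onD[OF pb(1)]) (use pb(4)[OF xy'] in auto)
  then have "frameB c ?f"
    unfolding frameB_def using pb(3) f2 f3 xy(1,2) by blast
  then show ?thesis using pb(2) by blast
qed

end

theorem nilpotent_semigroups_frame:
  assumes "S \<in> nilpotent_semigroups (c + 3) 2" "c \<ge> 4"
  shows "\<exists>f. isomorphic S (table c f) \<and> (frameA c f \<or> frameB c f)"
proof -
  have S: "is_semigroup S" "finite (carr S)" "card (carr S) = c + 3"
    "\<exists>j. card (products S (j + 1)) = 1" "nilpotency_class S = c"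
    using assms by (auto simp: nilpotent_semigroups_def nilpotent_def coclass_def)
  have "card (products S (c + 1)) = 1"
    using LeastI_ex[OF S(4)] S(5) by (simp add: nilpotency_class_def)
  moreover have "card (products S (j + 1)) \<noteq> 1" if "j < c" for j
    using not_less_Least[of j "\<lambda>j. card (products S (j + 1)) = 1"] that S(5)
    by (simp add: nilpotency_class_def)
  ultimately interpret coclass2 S c
    by unfold_locales (use S assms in auto)
  show ?thesis by (rule frame_cases)
qed

section \<open>Three generators\<close>

type_synonym quad = "nat \<times> nat \<times> nat \<times> nat"

text \<open>
  The code of a semigroup with generators $u, v, w$ is $((a, b, m, p), (a', b', m', q))$, the exponents of
  $uv, vu, vv, vw$ and of $uw, wu, ww, wv$. Interchanging $v$ and $w$ interchanges the two halves.
  The generator $v$ acts on $S^2$ like $u^{a-1}$.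
\<close>

definition codeA :: "nat \<Rightarrow> (nat \<Rightarrow> nat \<Rightarrow> nat) \<Rightarrow> quad \<times> quad" where
  "codeA c f =
     ((f 1 (c + 2), f (c + 2) 1, f (c + 2) (c + 2), f (c + 2) (c + 3)),
      (f 1 (c + 3), f (c + 3) 1, f (c + 3) (c + 3), f (c + 3) (c + 2)))"

text \<open>Each congruence is an associativity law. (uv)u = u(vu) relates a and b; u(vv) = (uv)v
  relates m to a, because (uv)v = u^a v has exponent 2a - 1 up to truncation; the laws for w and for
  the mixed products are analogous.\<close>

fun validA :: "nat \<Rightarrow> quad \<times> quad \<Rightarrow> bool" where
  "validA c ((a, b, m, p), (a', b', m', q)) \<longleftrightarrow>
     {a, b, m, p, a', b', m', q} \<subseteq> {2..c + 1} \<and>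
     trunc c (a + 1) = trunc c (b + 1) \<and> trunc c (a' + 1) = trunc c (b' + 1) \<and>
     trunc c (m + 1) = trunc c (2 * a - 1) \<and> trunc c (m' + 1) = trunc c (2 * a' - 1) \<and>
     trunc c (p + 1) = trunc c (a + a' - 1) \<and> trunc c (q + 1) = trunc c (a + a' - 1)"

fun weightA :: "nat \<Rightarrow> quad \<times> quad \<Rightarrow> nat \<Rightarrow> nat" where
  "weightA c ((a, b, m, p), (a', b', m', q)) x =
     (if x \<le> c + 1 then x else if x = c + 2 then a - 1 else a' - 1)"

fun opA :: "nat \<Rightarrow> quad \<times> quad \<Rightarrow> nat \<Rightarrow> nat \<Rightarrow> nat" where
  "opA c ((a, b, m, p), (a', b', m', q)) x y =
     (if x = 1 \<and> y = c + 2 then a else if x = c + 2 \<and> y = 1 then b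
      else if x = c + 2 \<and> y = c + 2 then m else if x = c + 2 \<and> y = c + 3 then p
      else if x = 1 \<and> y = c + 3 then a' else if x = c + 3 \<and> y = 1 then b'
      else if x = c + 3 \<and> y = c + 3 then m' else if x = c + 3 \<and> y = c + 2 then q
      else trunc c (weightA c ((a, b, m, p), (a', b', m', q)) x + weightA c ((a, b, m, p), (a', b', m', q)) y))"

lemma opA_gens:
  "opA c ((a, b, m, p), (a', b', m', q)) 1 (c + 2) = a"
  "opA c ((a, b, m, p), (a', b', m', q)) (c + 2) 1 = b"
  "opA c ((a, b, m, p), (a', b', m', q)) (c + 2) (c + 2) = m"
  "opA c ((a, b, m, p), (a', b', m', q)) (c + 2) (c + 3) = p"
  "opA c ((a, b, m, p), (a', b', m', q)) 1 (c + 3) = a'"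
  "opA c ((a, b, m, p), (a', b', m', q)) (c + 3) 1 = b'"
  "opA c ((a, b, m, p), (a', b', m', q)) (c + 3) (c + 3) = m'"
  "opA c ((a, b, m, p), (a', b', m', q)) (c + 3) (c + 2) = q"
  "opA c ((a, b, m, p), (a', b', m', q)) 1 1 = trunc c 2"
  by (simp_all add: numeral_2_eq_2)

declare opA.simps [simp del]

text \<open>Weights are additive up to the confusion of u^c with 0. For the eight products listed in
  the code, this is the content of \<open>validA\<close>.\<close>

lemma opA_weight:
  assumes "validA c \<kappa>" "c \<ge> 4" "x \<in> {1..c + 3}" "y \<in> {1..c + 3}"
  shows "opA c \<kappa> x y \<in> {2..c + 1}"
    and "trunc c (opA c \<kappa> x y + 1) = trunc c (weightA c \<kappa> x + weightA c \<kappa> y + 1)"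
proof -
  obtain a b m p a' b' m' q where \<kappa>: "\<kappa> = ((a, b, m, p), (a', b', m', q))"
    by (metis surj_pair)
  have val: "2 \<le> a" "2 \<le> b" "2 \<le> m" "2 \<le> p" "2 \<le> a'" "2 \<le> b'" "2 \<le> m'" "2 \<le> q"
    "a \<le> c + 1" "b \<le> c + 1" "m \<le> c + 1" "p \<le> c + 1" "a' \<le> c + 1" "b' \<le> c + 1" "m' \<le> c + 1" "q \<le> c + 1"
    "trunc c (a + 1) = trunc c (b + 1)" "trunc c (a' + 1) = trunc c (b' + 1)"
    "trunc c (m + 1) = trunc c (2 * a - 1)" "trunc c (m' + 1) = trunc c (2 * a' - 1)"
    "trunc c (p + 1) = trunc c (a + a' - 1)" "trunc c (q + 1) = trunc c (a + a' - 1)"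
    using assms(1) unfolding \<kappa> by simp_all
  have w: "weightA c \<kappa> x \<ge> 1" "weightA c \<kappa> y \<ge> 1" using assms val unfolding \<kappa> by auto
  have "opA c \<kappa> x y \<in> {2..c + 1} \<and>
     trunc c (opA c \<kappa> x y + 1) = trunc c (weightA c \<kappa> x + weightA c \<kappa> y + 1)"
  proof (cases "opA c \<kappa> x y = trunc c (weightA c \<kappa> x + weightA c \<kappa> y)")
    case True
    then show ?thesis using w assms(2) by (auto simp: trunc_def)
  next
    case False
    then consider "x = 1" "y = c + 2" | "x = c + 2" "y = 1" | "x = c + 2" "y = c + 2"
      | "x = c + 2" "y = c + 3" | "x = 1" "y = c + 3" | "x = c + 3" "y = 1"
      | "x = c + 3" "y = c + 3" | "x = c + 3" "y = c + 2"
      unfolding \<kappa> opA.simps by (simp split: if_splits)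
    then show ?thesis
    proof cases
      case 1 then show ?thesis using val(1,9) unfolding \<kappa> by (simp add: opA.simps)
    next
      case 2 then show ?thesis using val(1,2,10,17) unfolding \<kappa> by (simp add: opA.simps)
    next
      case 3
      have "weightA c \<kappa> x + weightA c \<kappa> y + 1 = 2 * a - 1" "opA c \<kappa> x y = m"
        using 3 val(1,5) unfolding \<kappa> by (simp_all add: opA.simps)
      then show ?thesis using val(1,3,11,19) by simp
    next
      case 4
      have "weightA c \<kappa> x + weightA c \<kappa> y + 1 = a + a' - 1" "opA c \<kappa> x y = p"
        using 4 val(1,5) unfolding \<kappa> by (simp_all add: opA.simps)
      then show ?thesis using val(1,5,4,12,21) by simp
    next
      case 5 then show ?thesis using val(5,13) unfolding \<kappa> by (simp add: opA.simps)
    next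
      case 6 then show ?thesis using val(5,6,14,18) unfolding \<kappa> by (simp add: opA.simps)
    next
      case 7
      have "weightA c \<kappa> x + weightA c \<kappa> y + 1 = 2 * a' - 1" "opA c \<kappa> x y = m'"
        using 7 val(1,5) unfolding \<kappa> by (simp_all add: opA.simps)
      then show ?thesis using val(5,7,15,20) by simp
    next
      case 8
      have "weightA c \<kappa> x + weightA c \<kappa> y + 1 = a + a' - 1" "opA c \<kappa> x y = q"
        using 8 val(1,5) unfolding \<kappa> by (simp_all add: opA.simps)
      then show ?thesis using val(1,5,8,16,22) by simp
    qed
  qed
  then show "opA c \<kappa> x y \<in> {2..c + 1}"
    and "trunc c (opA c \<kappa> x y + 1) = trunc c (weightA c \<kappa> x + weightA c \<kappa> y + 1)" by auto
qed

lemma opA_power: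
  assumes "2 \<le> k" "k \<le> c + 1"
  shows "opA c \<kappa> k x = trunc c (k + weightA c \<kappa> x)" "opA c \<kappa> x k = trunc c (weightA c \<kappa> x + k)"
  using assms by (cases \<kappa>; auto simp: opA.simps)+

lemma weightA_ge_1: "validA c \<kappa> \<Longrightarrow> x \<ge> 1 \<Longrightarrow> weightA c \<kappa> x \<ge> 1"
  by (cases \<kappa>) auto

text \<open>In a triple product the inner product is a power of u whose exponent is the sum of
  weights up to u^c versus 0. The third factor has weight at least 1 and removes this ambiguity, so
  both bracketings give the truncated total weight.\<close>

lemma frameA_opA:
  assumes "validA c \<kappa>" "c \<ge> 4"
  shows "frameA c (opA c \<kappa>)"
proof -
  let ?f = "opA c \<kappa>" and ?w = "weightA c \<kappa>"
  have ran: "?f x y \<in> {2..c + 1}" if "x \<in> {1..c + 3}" "y \<in> {1..c + 3}" for x y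
    using opA_weight(1)[OF assms that] .
  have "?f (?f x y) z = ?f x (?f y z)"
    if "x \<in> {1..c + 3}" "y \<in> {1..c + 3}" "z \<in> {1..c + 3}" for x y z
  proof -
    have "?f (?f x y) z = trunc c (?f x y + ?w z)"
      using opA_power(1)[of "?f x y" c \<kappa> z] ran[of x y] that by simp
    also have "\<dots> = trunc c (?w x + ?w y + ?w z)"
      by (rule trunc_add_cong[OF opA_weight(2)[OF assms that(1,2)] weightA_ge_1[OF assms(1)]])
        (use that in simp)
    also have "\<dots> = trunc c (?w y + ?w z + ?w x)" by (simp add: ac_simps)
    also have "\<dots> = trunc c (?f y z + ?w x)"
      by (rule trunc_add_cong[OF opA_weight(2)[OF assms that(2,3)] weightA_ge_1[OF assms(1)], symmetric])
        (use that in simp)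
    also have "\<dots> = ?f x (?f y z)"
      using opA_power(2)[of "?f y z" c \<kappa> x] ran[of y z] that by (simp add: add.commute)
    finally show ?thesis .
  qed
  moreover have "?f x y \<in> {1..c + 3}" if "x \<in> {1..c + 3}" "y \<in> {1..c + 3}" for x y
    using ran[OF that] by auto
  ultimately have "is_semigroup (table c ?f)" using is_semigroup_tableI[of c ?f] by presburger
  moreover have "?f i j = trunc c (i + j)" if "i \<in> {1..c + 1}" "j \<in> {1..c + 1}" for i j
    using that by (cases \<kappa>) (auto simp: opA.simps)
  ultimately show ?thesis using ran by (auto simp: frameA_def power_table_def)
qed

lemma codeA_opA: "codeA c (opA c \<kappa>) = \<kappa>"
  by (cases \<kappa>) (auto simp only: codeA_def opA_gens)

text \<open>Splitting one u off u^k reduces products with u^k to products with u, so the code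
  determines the whole table. The validity conditions are the associativity laws for triples of
  generators that start with u.\<close>

lemma frameA_valid:
  assumes f: "frameA c f" and c: "c \<ge> 4"
  shows "validA c (codeA c f)"
    and "\<And>x y. x \<in> {1..c + 3} \<Longrightarrow> y \<in> {1..c + 3} \<Longrightarrow> f x y = opA c (codeA c f) x y"
proof -
  have pt: "power_table c f" and ran: "\<And>x y. x \<in> {1..c + 3} \<Longrightarrow> y \<in> {1..c + 3} \<Longrightarrow> f x y \<in> {2..c + 1}"
    using f by (auto simp: frameA_def)
  note mul = power_table_mul[OF pt] and as = power_table_assoc[OF pt]
  have left: "f k y = trunc c (k - 1 + f 1 y)" if "2 \<le> k" "k \<le> c + 1" "y \<in> {1..c + 3}" for k y
  proof -
    have k: "k - 1 \<in> {1..c + 3}" using that by auto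
    have "f k y = f (f (k - 1) 1) y" using mul[of "k - 1" 1] that by (simp add: trunc_def)
    also have "\<dots> = f (k - 1) (f 1 y)" using as[OF k _ that(3), of 1] by simp
    also have "\<dots> = trunc c (k - 1 + f 1 y)" using mul[of "k - 1" "f 1 y"] ran[of 1 y] that by auto
    finally show ?thesis .
  qed
  have right: "f y k = trunc c (f y 1 + (k - 1))" if "2 \<le> k" "k \<le> c + 1" "y \<in> {1..c + 3}" for k y
  proof -
    have k: "k - 1 \<in> {1..c + 3}" using that by auto
    have "f y k = f y (f 1 (k - 1))" using mul[of 1 "k - 1"] that by (simp add: trunc_def)
    also have "\<dots> = f (f y 1) (k - 1)" using as[OF that(3) _ k, of 1] by simp
    also have "\<dots> = trunc c (f y 1 + (k - 1))" using mul[of "f y 1" "k - 1"] ran[of y 1] that by auto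
    finally show ?thesis .
  qed
  have comm: "trunc c (f 1 y + 1) = trunc c (f y 1 + 1)" if "y \<in> {1..c + 3}" for y
    using as[of 1 y 1] mul[of "f 1 y" 1] mul[of 1 "f y 1"] ran[of 1 y] ran[of y 1] that by simp
  have sq: "trunc c (f x y + 1) = trunc c (f 1 x + f 1 y - 1)" if "x \<in> {1..c + 3}" "y \<in> {1..c + 3}" for x y
    using as[of 1 x y] mul[of 1 "f x y"] left[of "f 1 x" y] ran[of x y] ran[of 1 x] that by simp
  show val: "validA c (codeA c f)"
    using ran comm sq[of "c + 2" "c + 2"] sq[of "c + 3" "c + 3"] sq[of "c + 2" "c + 3"] sq[of "c + 3" "c + 2"]
    unfolding codeA_def by (simp add: mult_2 add.commute)
  fix x y assume xy: "x \<in> {1..c + 3}" "y \<in> {1..c + 3}"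
  have gen: "z = 1 \<or> 2 \<le> z \<and> z \<le> c + 1 \<or> z = c + 2 \<or> z = c + 3" if "z \<in> {1..c + 3}" for z using that by auto
  have w: "weightA c (codeA c f) z = f 1 z - 1" if "z \<in> {c + 2, c + 3}" for z
    using that by (auto simp: codeA_def)
  have wp: "weightA c (codeA c f) z = z" if "z \<le> c + 1" for z
    using that by (auto simp: codeA_def)
  consider "x \<le> c + 1" "y \<le> c + 1" | "2 \<le> x" "x \<le> c + 1" "y \<in> {c + 2, c + 3}"
    | "2 \<le> y" "y \<le> c + 1" "x \<in> {c + 2, c + 3}" | "x \<in> {1, c + 2, c + 3}" "y \<in> {1, c + 2, c + 3}"
    using gen[OF xy(1)] gen[OF xy(2)] by fastforce
  then show "f x y = opA c (codeA c f) x y"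
  proof cases
    case 1
    then show ?thesis using mul xy by (simp add: codeA_def opA.simps)
  next
    case 2
    moreover have "x + weightA c (codeA c f) y = x - 1 + f 1 y"
      using 2 w[of y] ran[OF _ xy(2), of 1] by auto
    ultimately show ?thesis
      using opA_power(1)[OF 2(1,2)] left[OF 2(1,2) xy(2)] by simp
  next
    case 3
    have "trunc c (f x 1 + (y - 1)) = trunc c (f 1 x + (y - 1))"
      by (rule trunc_add_cong[OF comm[OF xy(1), symmetric]]) (use 3 in simp)
    moreover have "weightA c (codeA c f) x + y = f 1 x + (y - 1)"
      using 3 w[of x] ran[OF _ xy(1), of 1] by auto
    ultimately show ?thesis
      using opA_power(2)[OF 3(1,2)] right[OF 3(1,2) xy(1)] by simp
  next
    case 4
    moreover have "f 1 1 = 2" "trunc c 2 = 2" using mul[of 1 1] c by (simp_all add: trunc_def)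
    ultimately show ?thesis
      unfolding codeA_def by (elim insertE emptyE; hypsubst) (simp_all only: opA_gens)
  qed
qed

lemma isomorphic_opA_codeA:
  assumes "frameA c f" "c \<ge> 4" shows "isomorphic (table c f) (table c (opA c (codeA c f)))"
  unfolding isomorphic_iff
  by (intro exI[of _ id] iso_map_id) (simp_all add: frameA_valid(2)[OF assms] del: One_nat_def)

lemma frameA_products:
  assumes "frameA c f" "c \<ge> 4" "2 \<le> k" "k \<le> c + 1"
  shows "products (table c f) k = {k..c + 1}"
  using assms(3,4)
proof (induction k rule: dec_induct)
  case base
  have pt: "power_table c f" and ran: "\<And>x y. x \<in> {1..c + 3} \<Longrightarrow> y \<in> {1..c + 3} \<Longrightarrow> f x y \<in> {2..c + 1}"
    using assms(1) by (auto simp: frameA_def)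
  have "products (table c f) 2 = {f x y | x y. x \<in> {1..c + 3} \<and> y \<in> {1..c + 3}}"
    by (simp add: numeral_2_eq_2 products_Suc products_1)
  also have "\<dots> = {2..c + 1}"
  proof (intro equalityI subsetI)
    fix w assume w: "w \<in> {2..c + 1}"
    then have "w = f (w - 1) 1"
      using power_table_mul[OF pt, of "w - 1" 1] by (auto simp: trunc_def)
    moreover have "w - 1 \<in> {1..c + 3}" "(1::nat) \<in> {1..c + 3}" using w by auto
    ultimately show "w \<in> {f x y | x y. x \<in> {1..c + 3} \<and> y \<in> {1..c + 3}}" by blast
  qed (use ran in blast)
  finally show ?case .
next
  case (step k)
  have pt: "power_table c f" using assms(1) by (simp add: frameA_def)
  show ?case
  proof (rule table_products_step[OF pt])
    fix x y assume xy: "x \<in> {k..c + 1}" "y \<in> {c + 2, c + 3}"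
    then have "f x y = trunc c (x + weightA c (codeA c f) y)"
      using opA_power(1)[of x c "codeA c f" y] step frameA_valid(2)[OF assms(1,2), of x y] by auto
    then show "f x y \<in> {Suc k..c + 1}"
      using xy step weightA_ge_1[OF frameA_valid(1)[OF assms(1,2)], of y] by (auto simp: trunc_def)
  qed (use step in auto)
qed

lemma frameA_in_nilpotent_semigroups:
  assumes "frameA c f" "c \<ge> 4" shows "table c f \<in> nilpotent_semigroups (c + 3) 2"
  using assms frameA_products[OF assms]
  by (intro table_in_nilpotent_semigroups) (auto simp: frameA_def)

section \<open>Isomorphisms between semigroups with three generators\<close>

locale isoA =
  fixes c f g \<phi>
  assumes c: "c \<ge> 4" and f: "frameA c f" and g: "frameA c g"
    and iso: "iso_map \<phi> (table c f) (table c g)"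
begin

lemma power: "2 \<le> k \<Longrightarrow> k \<le> c + 1 \<Longrightarrow> \<phi> k = k"
  using frameA_products[OF f c] frameA_products[OF g c] f
  by (intro iso_map_fixes_power[OF iso]) (auto simp: frameA_def)

lemma inj: "x \<in> {1..c + 3} \<Longrightarrow> y \<in> {1..c + 3} \<Longrightarrow> \<phi> x = \<phi> y \<Longrightarrow> x = y"
  using iso_map_eq_iff[OF iso] by simp

lemma gens: "x \<in> {1, c + 2, c + 3} \<Longrightarrow> \<phi> x \<in> {1, c + 2, c + 3}"
  using iso_map_in[OF iso, of x] inj[of x "\<phi> x"] power[of "\<phi> x"] c by fastforce

lemma gen_mul: "x \<in> {1, c + 2, c + 3} \<Longrightarrow> y \<in> {1, c + 2, c + 3} \<Longrightarrow> g (\<phi> x) (\<phi> y) = f x y"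
  using iso_map_mul[OF iso, of x y] power[of "f x y"] f by (auto simp: frameA_def)

text \<open>A generator x has weight 1 iff x u^(c-1) = u^c; a larger weight gives 0. As \<phi> fixes
  all powers from u^2 on, it preserves this property.\<close>

lemma weight_1: "x \<in> {1, c + 2, c + 3} \<Longrightarrow> weightA c (codeA c f) x = 1 \<longleftrightarrow> weightA c (codeA c g) (\<phi> x) = 1"
proof -
  assume x: "x \<in> {1, c + 2, c + 3}"
  have c1: "c - 1 \<in> {1..c + 3}" "2 \<le> c - 1" "c - 1 \<le> c + 1" using c by auto
  have x': "x \<in> {1..c + 3}" using x by auto
  have *: "h y (c - 1) = c \<longleftrightarrow> weightA c (codeA c h) y = 1" if "frameA c h" "y \<in> {1..c + 3}" for h y
  proof -
    have "h y (c - 1) = trunc c (weightA c (codeA c h) y + (c - 1))"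
      using opA_power(2)[OF c1(2,3)] frameA_valid(2)[OF that(1) c that(2) c1(1)] by simp
    moreover have "weightA c (codeA c h) y \<ge> 1"
      using weightA_ge_1[OF frameA_valid(1)[OF that(1) c], of y] that(2) by simp
    ultimately show ?thesis using c by (auto simp: trunc_def)
  qed
  have "g (\<phi> x) (c - 1) = \<phi> (f x (c - 1))"
    using iso_map_mul[OF iso, of x "c - 1"] power[OF c1(2,3)] c1(1) x' by simp
  moreover have "f x (c - 1) \<in> {2..c + 1}" using f x' c1(1) unfolding frameA_def by blast
  ultimately have "g (\<phi> x) (c - 1) = f x (c - 1)" using power[of "f x (c - 1)"] by simp
  moreover have "\<phi> x \<in> {1..c + 3}" using iso_map_in[OF iso] x' by simp
  ultimately show ?thesis using *[OF f x'] *[OF g, of "\<phi> x"] by simp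
qed

lemma vals:
  "g (\<phi> 1) (\<phi> (c + 2)) = f 1 (c + 2)" "g (\<phi> (c + 2)) (\<phi> 1) = f (c + 2) 1"
  "g (\<phi> 1) (\<phi> (c + 3)) = f 1 (c + 3)" "g (\<phi> (c + 3)) (\<phi> 1) = f (c + 3) 1"
  "g (\<phi> (c + 2)) (\<phi> (c + 3)) = f (c + 2) (c + 3)" "g (\<phi> (c + 3)) (\<phi> (c + 2)) = f (c + 3) (c + 2)"
  "g (\<phi> (c + 2)) (\<phi> (c + 2)) = f (c + 2) (c + 2)" "g (\<phi> (c + 3)) (\<phi> (c + 3)) = f (c + 3) (c + 3)"
  using gen_mul by auto

lemma distinct_gens: "\<phi> 1 \<noteq> \<phi> (c + 2)" "\<phi> 1 \<noteq> \<phi> (c + 3)" "\<phi> (c + 2) \<noteq> \<phi> (c + 3)"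
  using inj[of 1 "c + 2"] inj[of 1 "c + 3"] inj[of "c + 2" "c + 3"] by auto

text \<open>In the target only u has weight 1, so \<phi> fixes u and can at most interchange v and
  w.\<close>

lemma code_unique_generator:
  assumes "fst (fst (codeA c g)) \<ge> 3" "fst (snd (codeA c g)) \<ge> 3"
  shows "codeA c f = codeA c g \<or> codeA c f = prod.swap (codeA c g)"
proof -
  have "\<phi> 1 = 1"
    using gens[of 1] weight_1[of 1] assms by (auto simp: codeA_def)
  then have "\<phi> (c + 2) = c + 2 \<and> \<phi> (c + 3) = c + 3 \<or> \<phi> (c + 2) = c + 3 \<and> \<phi> (c + 3) = c + 2"
    using gens[of "c + 2"] gens[of "c + 3"] distinct_gens by auto
  then show ?thesis
    using vals \<open>\<phi> 1 = 1\<close> unfolding codeA_def by auto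
qed

text \<open>In the source u and v have weight 1, in the target w has not. So \<phi> permutes u and v
  and fixes w; the interchange trades uw, wu for vw, wv.\<close>

lemma code_two_generators:
  assumes "fst (fst (codeA c f)) = 2" "codeA c g = ((2, 2, 2, p), (a', b', m', q))" "a' \<ge> 3"
  shows "codeA c f = ((2, 2, 2, p), (a', b', m', q)) \<or> codeA c f = ((2, 2, 2, a'), (p, q, m', b'))"
proof -
  have gv: "g 1 (c + 2) = 2" "g (c + 2) 1 = 2" "g (c + 2) (c + 2) = 2" "g (c + 2) (c + 3) = p"
    "g 1 (c + 3) = a'" "g (c + 3) 1 = b'" "g (c + 3) (c + 3) = m'" "g (c + 3) (c + 2) = q"
    using assms(2) by (simp_all add: codeA_def)
  have g11: "g 1 1 = 2" using power_table_mul[of c g 1 1] g c by (simp add: frameA_def trunc_def)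
  have f11: "f 1 1 = 2" using power_table_mul[of c f 1 1] f c by (simp add: frameA_def trunc_def)
  have w: "weightA c (codeA c g) (c + 3) \<noteq> 1" "weightA c (codeA c f) 1 = 1" "weightA c (codeA c f) (c + 2) = 1"
    using assms by (simp_all add: codeA_def)
  then have "\<phi> 1 \<noteq> c + 3" "\<phi> (c + 2) \<noteq> c + 3"
    using weight_1[of 1] weight_1[of "c + 2"] by auto
  then have "\<phi> 1 = 1 \<and> \<phi> (c + 2) = c + 2 \<and> \<phi> (c + 3) = c + 3 \<or> \<phi> 1 = c + 2 \<and> \<phi> (c + 2) = 1 \<and> \<phi> (c + 3) = c + 3"
    using gens[of 1] gens[of "c + 2"] gens[of "c + 3"] distinct_gens by auto
  then show ?thesis
  proof (elim disjE conjE)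
    assume "\<phi> 1 = 1" "\<phi> (c + 2) = c + 2" "\<phi> (c + 3) = c + 3"
    note \<phi> = this
    show ?thesis using vals[unfolded \<phi> gv] unfolding codeA_def by simp
  next
    assume "\<phi> 1 = c + 2" "\<phi> (c + 2) = 1" "\<phi> (c + 3) = c + 3"
    note \<phi> = this
    show ?thesis using vals[unfolded \<phi> gv g11] unfolding codeA_def by simp
  qed
qed

end

lemma isomorphic_swap_vw:
  assumes "validA c (P, Q)" "c \<ge> 4"
  shows "isomorphic (table c (opA c (P, Q))) (table c (opA c (Q, P)))"
  unfolding isomorphic_iff
proof (intro exI)
  let ?\<tau> = "id(c + 2 := c + 3, c + 3 := c + 2)"
  show "iso_map ?\<tau> (table c (opA c (P, Q))) (table c (opA c (Q, P)))"
    unfolding iso_map_def carr_table mul_table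
  proof (intro conjI ballI)
    show "bij_betw ?\<tau> {1..c + 3} {1..c + 3}"
      by (rule bij_betw_byWitness[where f' = ?\<tau>]) auto
    fix x y assume xy: "x \<in> {1..c + 3}" "y \<in> {1..c + 3}"
    have "?\<tau> (opA c (P, Q) x y) = opA c (P, Q) x y"
      using opA_weight(1)[OF assms xy] by auto
    also have "\<dots> = opA c (Q, P) (?\<tau> x) (?\<tau> y)"
      using xy by (cases P; cases Q) (auto simp: opA.simps)
    finally show "?\<tau> (opA c (P, Q) x y) = opA c (Q, P) (?\<tau> x) (?\<tau> y)" .
  qed
qed

lemma isomorphic_swap_uv:
  assumes "validA c ((2, 2, 2, p), (a', b', m', q))" "c \<ge> 4" "a' \<ge> 3"
  shows "validA c ((2, 2, 2, a'), (p, q, m', b'))" "p \<ge> 3"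
    and "isomorphic (table c (opA c ((2, 2, 2, p), (a', b', m', q)))) (table c (opA c ((2, 2, 2, a'), (p, q, m', b'))))"
proof -
  have tr: "trunc c (p + 1) = trunc c (a' + 1)" using assms by simp
  then show p: "p \<ge> 3" using assms by (auto simp: trunc_def min_def split: if_splits)
  show val: "validA c ((2, 2, 2, a'), (p, q, m', b'))"
  proof -
    \<comment> \<open>The condition on ww was stated with a' and is now needed with p. The
      congruence \<open>tr\<close> exchanges the two summands of the doubled exponent one after the
      other.\<close>
    have "2 * a' - 1 = a' + (a' - 1)" "2 * p - 1 = p + (p - 1)" using p assms by simp_all
    then have "trunc c (2 * a' - 1) = trunc c (a' + (a' - 1))" by simp
    also have "\<dots> = trunc c (p + (a' - 1))"
      by (rule trunc_add_cong[OF tr, symmetric]) (use assms in simp)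
    also have "\<dots> = trunc c (a' + (p - 1))" using p assms by (simp add: algebra_simps)
    also have "\<dots> = trunc c (p + (p - 1))"
      by (rule trunc_add_cong[OF tr, symmetric]) (use p in simp)
    also have "\<dots> = trunc c (2 * p - 1)" using \<open>2 * p - 1 = p + (p - 1)\<close> by simp
    finally show ?thesis using assms by simp
  qed
  show "isomorphic (table c (opA c ((2, 2, 2, p), (a', b', m', q)))) (table c (opA c ((2, 2, 2, a'), (p, q, m', b'))))"
    (is "isomorphic (table c (opA c ?\<kappa>)) (table c (opA c ?\<kappa>'))")
    unfolding isomorphic_iff
  proof (intro exI)
    let ?\<tau> = "id(1 := c + 2, c + 2 := 1)"
    show "iso_map ?\<tau> (table c (opA c ?\<kappa>)) (table c (opA c ?\<kappa>'))"
      unfolding iso_map_def carr_table mul_table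
    proof (intro conjI ballI)
      show "bij_betw ?\<tau> {1..c + 3} {1..c + 3}"
        by (rule bij_betw_byWitness[where f' = ?\<tau>]) auto
      fix x y assume xy: "x \<in> {1..c + 3}" "y \<in> {1..c + 3}"
      have "?\<tau> (opA c ?\<kappa> x y) = opA c ?\<kappa> x y"
        using opA_weight(1)[OF assms(1,2) xy] by auto
      also have "\<dots> = opA c ?\<kappa>' (?\<tau> x) (?\<tau> y)"
      proof -
        \<comment> \<open>The weight of w changes from a' - 1 to p - 1; next to an exponent of at
          least 2 the difference vanishes.\<close>
        have w: "trunc c (a' - 1 + k) = trunc c (p - 1 + k)" if "k \<ge> 2" for k
          using trunc_add_cong[OF tr, of "k - 1"] that p assms(3) by (simp add: algebra_simps)
        show ?thesis
          using xy w[of x] w[of y] assms(2) by (auto simp: opA.simps trunc_def add.commute)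
      qed
      finally show "?\<tau> (opA c ?\<kappa> x y) = opA c ?\<kappa>' (?\<tau> x) (?\<tau> y)" .
    qed
  qed
qed

text \<open>
  If $a = 2$, then $u$ and $v$ both have weight $1$; interchanging them interchanges $(a', b')$ with $(p, q)$.
\<close>

fun minimalA :: "nat \<Rightarrow> quad \<times> quad \<Rightarrow> bool" where
  "minimalA c ((a, b, m, p), (a', b', m', q)) \<longleftrightarrow>
     (if a = 2 then a' = 2 \<or> (a', b') \<le> (p, q) else a' \<noteq> 2 \<and> (a, b, m, p) \<le> (a', b', m', q))"

definition repsA :: "nat \<Rightarrow> (quad \<times> quad) set" where
  "repsA c = {\<kappa>. validA c \<kappa> \<and> minimalA c \<kappa>}"

lemma validA_swap: "validA c (P, Q) \<Longrightarrow> validA c (Q, P)"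
  by (cases P; cases Q) (auto simp: add.commute)

lemma validA_2:
  assumes "validA c ((2, b, m, p), Q)" "c \<ge> 4" shows "b = 2" "m = 2"
  using assms by (cases Q; auto simp: trunc_def min_def split: if_splits)+

lemma validA_2_2:
  assumes "validA c ((2, P), (2, Q))" "c \<ge> 4" shows "P = (2, 2, 2)" "Q = (2, 2, 2)"
  using assms by (cases P; cases Q; auto simp: trunc_def min_def split: if_splits)+

text \<open>Sorting the halves lexicographically puts a weight-1 generator first, since 2 is the
  least exponent. If v then has weight 1 and w has not, the interchange of u and v settles the
  remaining choice.\<close>

lemma repsA_exists:
  assumes "frameA c f" "c \<ge> 4"
  shows "\<exists>\<kappa>\<in>repsA c. isomorphic (table c f) (table c (opA c \<kappa>))"
proof -
  have ordered: "\<exists>\<kappa>'\<in>repsA c. isomorphic (table c (opA c \<kappa>)) (table c (opA c \<kappa>'))"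
    if val: "validA c \<kappa>" and le: "fst \<kappa> \<le> snd \<kappa>" for \<kappa>
  proof -
    obtain a b m p a' b' m' q where \<kappa>: "\<kappa> = ((a, b, m, p), (a', b', m', q))" by (metis surj_pair)
    consider "a \<noteq> 2" | "a = 2" "a' = 2" | "a = 2" "a' \<noteq> 2" by blast
    then show ?thesis
    proof cases
      case 1
      then have "\<kappa> \<in> repsA c" using val le unfolding \<kappa> repsA_def by auto
      then show ?thesis using isomorphic_refl by blast
    next
      case 2
      then have "\<kappa> \<in> repsA c" using val unfolding \<kappa> repsA_def by auto
      then show ?thesis using isomorphic_refl by blast
    next
      case 3
      then have \<kappa>2: "\<kappa> = ((2, 2, 2, p), (a', b', m', q))" using val validA_2 assms(2) unfolding \<kappa> by blast
      have a': "a' \<ge> 3" using val 3 unfolding \<kappa> by auto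
      show ?thesis
      proof (cases "(a', b') \<le> (p, q)")
        case True
        then have "\<kappa> \<in> repsA c" using val unfolding \<kappa>2 repsA_def by auto
        then show ?thesis using isomorphic_refl by blast
      next
        case False
        then have "((2, 2, 2, a'), (p, q, m', b')) \<in> repsA c"
          using isomorphic_swap_uv(1)[OF val[unfolded \<kappa>2] assms(2) a'] unfolding repsA_def by auto
        then show ?thesis using isomorphic_swap_uv(3)[OF val[unfolded \<kappa>2] assms(2) a'] unfolding \<kappa>2 by blast
      qed
    qed
  qed
  let ?\<kappa> = "codeA c f"
  have val: "validA c ?\<kappa>" and iso: "isomorphic (table c f) (table c (opA c ?\<kappa>))"
    using frameA_valid[OF assms] isomorphic_opA_codeA[OF assms] by auto
  show ?thesis
  proof (cases "fst ?\<kappa> \<le> snd ?\<kappa>")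
    case True
    then show ?thesis using ordered[OF val] isomorphic_trans[OF iso] by blast
  next
    case False
    obtain P Q where PQ: "?\<kappa> = (P, Q)" by (metis surj_pair)
    have "validA c (Q, P)" using val validA_swap PQ by simp
    then obtain \<kappa>' where "\<kappa>' \<in> repsA c" "isomorphic (table c (opA c (Q, P))) (table c (opA c \<kappa>'))"
      using ordered[of "(Q, P)"] False linear[of P Q] unfolding PQ fst_conv snd_conv by blast
    then show ?thesis
      using iso isomorphic_swap_vw[OF val[unfolded PQ] assms(2)] isomorphic_trans unfolding PQ by blast
  qed
qed

text \<open>Stated for arbitrary frames because self-duality compares a representative with its
  flip, which need not be minimal. The cases \<open>reversed\<close> and \<open>reversed'\<close>
  cannot occur for minimal codes.\<close>

lemma frameA_iso_cases:
  assumes "frameA c f" "frameA c g" "c \<ge> 4" "isomorphic (table c f) (table c g)"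
    and fg: "codeA c f = ((a, b, m, p), (a', b', m', q))" "codeA c g = ((a1, b1, m1, p1), (a1', b1', m1', q1))"
  obtains (unique) "3 \<le> a1" "3 \<le> a1'" "3 \<le> a" "3 \<le> a'" "codeA c f = codeA c g \<or> codeA c f = prod.swap (codeA c g)"
  | (reversed) "a \<noteq> 2" "a' = 2" | (reversed') "a1 \<noteq> 2" "a1' = 2"
  | (two) "a = 2" "a1 = 2" "a1' \<ge> 3" "codeA c f = codeA c g \<or> codeA c f = ((2, 2, 2, a1'), (p1, q1, m1', b1'))"
  | (two') "a = 2" "a1 = 2" "a' \<ge> 3" "codeA c g = codeA c f \<or> codeA c g = ((2, 2, 2, a'), (p, q, m', b'))"
  | (three) "a = 2" "a1 = 2" "a' = 2" "a1' = 2" "codeA c f = codeA c g"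
proof -
  obtain \<phi> where \<phi>: "iso_map \<phi> (table c f) (table c g)" using assms(4) by (auto simp: isomorphic_iff)
  have "is_semigroup (table c f)" using assms(1) by (simp add: frameA_def power_table_def)
  then have "iso_map (inv_into {1..c + 3} \<phi>) (table c g) (table c f)"
    using iso_map_inv[OF \<phi>] by simp
  \<comment> \<open>The lemmas on codes ask for large weights in the target; the inverse map serves
    the cases where these are known in the source.\<close>
  then interpret inv: isoA c g f "inv_into {1..c + 3} \<phi>"
    by unfold_locales (use assms in auto)
  interpret isoA c f g \<phi>
    by unfold_locales (use assms \<phi> in auto)
  have val: "validA c ((a, b, m, p), (a', b', m', q))" "validA c ((a1, b1, m1, p1), (a1', b1', m1', q1))"
    using frameA_valid(1)[of c f] frameA_valid(1)[of c g] assms by auto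
  then have ge: "a \<ge> 2" "a' \<ge> 2" "a1 \<ge> 2" "a1' \<ge> 2" by auto
  show thesis
  proof (cases "a1 = 2 \<or> a1' = 2")
    case False
    then have "codeA c f = codeA c g \<or> codeA c f = prod.swap (codeA c g)"
      using code_unique_generator fg ge by auto
    then show thesis using unique False ge fg by auto
  next
    case g: True
    show thesis
    proof (cases "a = 2 \<or> a' = 2")
      case False
      then have "codeA c g = codeA c f \<or> codeA c g = prod.swap (codeA c f)"
        using inv.code_unique_generator fg ge by auto
      then show thesis using False g fg by auto
    next
      case f: True
      consider "a \<noteq> 2" "a' = 2" | "a1 \<noteq> 2" "a1' = 2" | "a = 2" "a1 = 2" "a1' \<noteq> 2"
        | "a = 2" "a1 = 2" "a' \<noteq> 2" | "a = 2" "a1 = 2" "a' = 2" "a1' = 2"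
        using f g by blast
      then show thesis
      proof cases
        case 3
        then have "b1 = 2" "m1 = 2" using val(2) validA_2 assms(3) by blast+
        then show thesis using two code_two_generators[of p1 a1' b1' m1' q1] 3 ge fg by auto
      next
        case 4
        then have "b = 2" "m = 2" using val(1) validA_2 assms(3) by blast+
        then show thesis using two' inv.code_two_generators[of p a' b' m' q] 4 ge fg by auto
      next
        case 5
        then have "(b, m, p) = (2, 2, 2)" "(b', m', q) = (2, 2, 2)" "(b1, m1, p1) = (2, 2, 2)" "(b1', m1', q1) = (2, 2, 2)"
          using val validA_2_2 assms(3) by blast+
        then show thesis using three 5 fg by auto
      qed (use reversed reversed' in auto)
    qed
  qed
qed

lemma repsA_unique:
  assumes "\<kappa> \<in> repsA c" "\<kappa>' \<in> repsA c" "c \<ge> 4" "isomorphic (table c (opA c \<kappa>)) (table c (opA c \<kappa>'))"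
  shows "\<kappa> = \<kappa>'"
proof -
  obtain a b m p a' b' m' q where \<kappa>: "\<kappa> = ((a, b, m, p), (a', b', m', q))" by (metis surj_pair)
  obtain a1 b1 m1 p1 a1' b1' m1' q1 where \<kappa>': "\<kappa>' = ((a1, b1, m1, p1), (a1', b1', m1', q1))" by (metis surj_pair)
  have val: "validA c \<kappa>" "validA c \<kappa>'" and minim: "minimalA c \<kappa>" "minimalA c \<kappa>'" using assms by (auto simp: repsA_def)
  have "frameA c (opA c \<kappa>)" "frameA c (opA c \<kappa>')" using val frameA_opA assms by auto
  then show ?thesis
  proof (cases rule: frameA_iso_cases[OF _ _ assms(3,4), unfolded codeA_opA, OF _ _ \<kappa> \<kappa>',
      consumes 2, case_names unique reversed reversed' two two' three])
    case unique
    then have "a \<noteq> 2" "a1 \<noteq> 2" by auto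
    then have "fst \<kappa> \<le> snd \<kappa>" "fst \<kappa>' \<le> snd \<kappa>'" using minim unfolding \<kappa> \<kappa>' by simp_all
    moreover have "fst \<kappa> = snd \<kappa>'" "snd \<kappa> = fst \<kappa>'" if "\<kappa> = prod.swap \<kappa>'"
      using that by (simp_all add: prod.swap_def)
    ultimately show ?thesis using unique(5) by (metis antisym prod_eq_iff)
  next
    case reversed
    then show ?thesis using minim(1) unfolding \<kappa> by (simp add: opA.simps)
  next
    case reversed'
    then show ?thesis using minim(2) unfolding \<kappa>' by simp
  next
    case two
    have val': "validA c ((2, b1, m1, p1), (a1', b1', m1', q1))" using val(2) two(2) unfolding \<kappa>' by simp
    have bm: "b1 = 2" "m1 = 2" using validA_2[OF val' assms(3)] .
    have le: "(a1', b1') \<le> (p1, q1)" using minim(2) two unfolding \<kappa>' by simp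
    show ?thesis using two(4)
    proof
      assume eq: "\<kappa> = ((2, 2, 2, a1'), (p1, q1, m1', b1'))"
      have "p1 \<ge> 3" using isomorphic_swap_uv(2)[OF val'[unfolded bm] assms(3) two(3)] .
      then have "(p1, q1) \<le> (a1', b1')" using minim(1) unfolding eq by simp
      with le have "(a1', b1') = (p1, q1)" by (rule antisym)
      then show ?thesis unfolding eq \<kappa>' bm two(2) by simp
    qed
  next
    case two'
    have val': "validA c ((2, b, m, p), (a', b', m', q))" using val(1) two'(1) unfolding \<kappa> by simp
    have bm: "b = 2" "m = 2" using validA_2[OF val' assms(3)] .
    have le: "(a', b') \<le> (p, q)" using minim(1) two' unfolding \<kappa> by simp
    show ?thesis using two'(4)
    proof
      assume eq: "\<kappa>' = ((2, 2, 2, a'), (p, q, m', b'))"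
      have "p \<ge> 3" using isomorphic_swap_uv(2)[OF val'[unfolded bm] assms(3) two'(3)] .
      then have "(p, q) \<le> (a', b')" using minim(2) unfolding eq by simp
      with le have "(a', b') = (p, q)" by (rule antisym)
      then show ?thesis unfolding eq \<kappa> bm two'(1) by simp
    qed simp
  next
    case three
    then show ?thesis by simp
  qed
qed

section \<open>Counting the semigroups with three generators\<close>

declare validA.simps [simp del]

text \<open>The exponents that agree with k after one more factor, u^c and 0 being
  interchangeable.\<close>

definition band :: "nat \<Rightarrow> nat \<Rightarrow> nat set" where
  "band c k = (if k < c then {k} else {c, c + 1})"

lemma finite_band [simp]: "finite (band c k)"
  by (simp add: band_def)

lemma card_band: "card (band c k) = (if k < c then 1 else 2)"
  by (simp add: band_def)

lemma mem_band_iff: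
  "k \<ge> 2 \<Longrightarrow> c \<ge> 2 \<Longrightarrow> b \<in> band c k \<longleftrightarrow> b \<in> {2..c + 1} \<and> trunc c (b + 1) = trunc c (k + 1)"
  by (auto simp: band_def trunc_def)

lemma validA_iff:
  assumes "c \<ge> 4"
  shows "validA c ((a, b, m, p), (a', b', m', q)) \<longleftrightarrow>
    a \<in> {2..c + 1} \<and> a' \<in> {2..c + 1} \<and> b \<in> band c a \<and> m \<in> band c (2 * a - 2) \<and>
    b' \<in> band c a' \<and> m' \<in> band c (2 * a' - 2) \<and> p \<in> band c (a + a' - 2) \<and> q \<in> band c (a + a' - 2)"
proof (cases "a \<in> {2..c + 1} \<and> a' \<in> {2..c + 1}")
  case True
  then have "a \<ge> 2" "a' \<ge> 2" "2 * a - 2 \<ge> 2" "2 * a' - 2 \<ge> 2" "a + a' - 2 \<ge> 2" "c \<ge> 2"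
    "2 * a - 2 + 1 = 2 * a - 1" "2 * a' - 2 + 1 = 2 * a' - 1" "a + a' - 2 + 1 = a + a' - 1" using assms by auto
  note m = this
  show ?thesis
    unfolding validA.simps mem_band_iff[OF m(1,6)] mem_band_iff[OF m(2,6)] mem_band_iff[OF m(3,6)]
      mem_band_iff[OF m(4,6)] mem_band_iff[OF m(5,6)] m(7-9)
    by (auto simp: eq_commute[of "trunc c (b + 1)"] eq_commute[of "trunc c (b' + 1)"])
qed (auto simp: validA.simps)

text \<open>The parts above and below the diagonal are exchanged by the swap and meet in the
  diagonal. It serves to count pairs of halves up to the interchange of v and w.\<close>

lemma card_symmetric_le:
  fixes R :: "('a::linorder \<times> 'a) set"
  assumes "finite R" "\<And>x y. (x, y) \<in> R \<Longrightarrow> (y, x) \<in> R"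
  shows "2 * card {z\<in>R. fst z \<le> snd z} = card R + card {z\<in>R. fst z = snd z}"
proof -
  let ?L = "{z\<in>R. fst z \<le> snd z}" and ?G = "{z\<in>R. snd z \<le> fst z}"
  have "bij_betw prod.swap ?L ?G"
    by (rule bij_betw_byWitness[where f' = prod.swap]) (use assms(2) in auto)
  then have "card ?G = card ?L" by (simp add: bij_betw_same_card)
  moreover have "R = ?L \<union> ?G" "{z\<in>R. fst z = snd z} = ?L \<inter> ?G" by auto
  moreover have "card ?L + card ?G = card (?L \<union> ?G) + card (?L \<inter> ?G)"
    by (rule card_Un_Int) (use assms(1) in auto)
  ultimately show ?thesis by simp
qed

text \<open>The subtraction \<open>i - 2\<close> is truncated, so the terms for i = 0 and i = 1
  vanish.\<close>

lemma sum_int_diff_2: "h \<ge> 2 \<Longrightarrow> (\<Sum>i\<le>h. 2 * int (i - 2)) = (int h - 1) * (int h - 2)"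
  by (induction h rule: dec_induct) (auto simp: numeral_2_eq_2 algebra_simps of_nat_diff)

text \<open>
  The sum runs over pairs of exponents $a = c + 1 - i$ and $a' = c + 1 - j$; then $u^{a-1}u^{a'-1}$ has exponent at least $c$
  iff $i + j \le c$.
\<close>

lemma double_sum:
  fixes g :: "nat \<Rightarrow> int" and k :: int
  assumes c: "c \<ge> 4" and h: "h = c div 2" and g: "\<And>i. h < i \<Longrightarrow> g i = 1"
  shows "(\<Sum>i\<le>c - 2. \<Sum>j\<le>c - 2. g i * g j * (if i + j \<le> c then k else 1)) =
    k * (\<Sum>i\<le>h. g i)^2 + 2 * (\<Sum>i\<le>h. g i * (k * (int c - 2 - int h) - (k - 1) * int (i - 2)))
      + (int c - 2 - int h)^2"
proof -
  let ?A = "{..h}" and ?B = "{h<..c - 2}" and ?F = "\<lambda>i j. g i * g j * (if i + j \<le> c then k else 1)"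
  have hc: "2 * h \<le> c" "c < 2 * h + 2" "h \<le> c - 2" using c h by auto
  have AB: "{..c - 2} = ?A \<union> ?B" "?A \<inter> ?B = {}" using hc by auto
  have cB: "int (card ?B) = int c - 2 - int h" using hc c by (simp add: of_nat_diff)
  \<comment> \<open>For i <= h the indices j with i + j > c are those between c - i and c - 2. There
    are i - 2 of them, or none if i < 2, and each has the factor 1 instead of k.\<close>
  have inner: "(\<Sum>j\<in>?B. ?F i j) = g i * (k * (int c - 2 - int h) - (k - 1) * int (i - 2))" if "i \<le> h" for i
  proof -
    have "(\<Sum>j\<in>?B. ?F i j) = (\<Sum>j\<in>?B. g i * k - (if c < i + j then g i * (k - 1) else 0))"
      by (rule sum.cong) (use g in \<open>auto simp: algebra_simps\<close>)
    also have "\<dots> = (\<Sum>j\<in>?B. g i * k) - (\<Sum>j\<in>?B. if c < i + j then g i * (k - 1) else 0)"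
      by (rule sum_subtractf)
    also have "(\<Sum>j\<in>?B. if c < i + j then g i * (k - 1) else 0) = (\<Sum>j\<in>{j\<in>?B. c < i + j}. g i * (k - 1))"
      by (rule sum.inter_filter[symmetric]) simp
    also have "{j\<in>?B. c < i + j} = {c - i<..c - 2}" using that hc by auto
    also have "(\<Sum>j\<in>{c - i<..c - 2}. g i * (k - 1)) = int (i - 2) * (g i * (k - 1))"
    proof -
      have "c - 2 - (c - i) = i - 2" using that hc by auto
      then show ?thesis by simp
    qed
    also have "(\<Sum>j\<in>?B. g i * k) = (int c - 2 - int h) * (g i * k)" using cB by simp
    finally show ?thesis by (simp add: algebra_simps)
  qed
  have comm: "?F i j = ?F j i" for i j by (simp add: add.commute mult.commute)
  have "(\<Sum>i\<in>?A \<union> ?B. \<Sum>j\<in>?A \<union> ?B. ?F i j) =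
      (\<Sum>i\<in>?A. \<Sum>j\<in>?A. ?F i j) + (\<Sum>i\<in>?A. \<Sum>j\<in>?B. ?F i j) +
      ((\<Sum>i\<in>?B. \<Sum>j\<in>?A. ?F i j) + (\<Sum>i\<in>?B. \<Sum>j\<in>?B. ?F i j))"
    using AB(2) by (simp add: sum.union_disjoint sum.distrib)
  also have "(\<Sum>i\<in>?B. \<Sum>j\<in>?A. ?F i j) = (\<Sum>i\<in>?A. \<Sum>j\<in>?B. ?F i j)"
    by (subst sum.swap) (intro sum.cong refl comm)
  also have "(\<Sum>i\<in>?A. \<Sum>j\<in>?B. ?F i j) =
      (\<Sum>i\<le>h. g i * (k * (int c - 2 - int h) - (k - 1) * int (i - 2)))"
    by (intro sum.cong refl inner) simp
  \<comment> \<open>Here i + j <= 2h <= c, so the factor is always k; on \<open>?B\<close> times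
    \<open>?B\<close> one has i + j >= 2h + 2 > c and the factor 1.\<close>
  also have "(\<Sum>i\<in>?A. \<Sum>j\<in>?A. ?F i j) = (\<Sum>i\<in>?A. \<Sum>j\<in>?A. g i * g j * k)"
    by (intro sum.cong refl) (use hc in auto)
  also have "\<dots> = k * (\<Sum>i\<le>h. g i)^2"
    by (simp add: power2_eq_square sum_product sum_distrib_left sum_distrib_right algebra_simps)
  also have "(\<Sum>i\<in>?B. \<Sum>j\<in>?B. ?F i j) = (\<Sum>i\<in>?B. \<Sum>j\<in>?B. 1)"
    by (intro sum.cong refl) (use hc g in auto)
  also have "\<dots> = (int c - 2 - int h)^2" using cB by (simp add: power2_eq_square)
  finally show ?thesis unfolding AB(1)[symmetric] by simp
qed

lemma sum_reflect:
  "c \<ge> 4 \<Longrightarrow> (\<Sum>a\<in>{3..c + 1}. F (c + 1 - a)) = (\<Sum>i\<le>c - 2. F i)" for F :: "nat \<Rightarrow> 'a::comm_monoid_add"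
  by (rule sum.reindex_bij_witness[where i = "\<lambda>i. c + 1 - i" and j = "\<lambda>a. c + 1 - a"]) auto

lemma sum_split_half:
  fixes g :: "nat \<Rightarrow> int"
  assumes "c \<ge> 4" "h = c div 2" "\<And>i. h < i \<Longrightarrow> g i = 1"
  shows "(\<Sum>i\<le>c - 2. g i) = (\<Sum>i\<le>h. g i) + (int c - 2 - int h)"
proof -
  have "{..c - 2} = {..h} \<union> {h<..c - 2}" using assms by auto
  then have "(\<Sum>i\<le>c - 2. g i) = (\<Sum>i\<le>h. g i) + (\<Sum>i\<in>{h<..c - 2}. g i)"
    by (simp add: sum.union_disjoint ivl_disj_int)
  also have "(\<Sum>i\<in>{h<..c - 2}. g i) = (\<Sum>i\<in>{h<..c - 2}. 1)" by (intro sum.cong) (use assms in auto)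
  also have "\<dots> = int c - 2 - int h" using assms by (simp add: of_nat_diff)
  finally show ?thesis .
qed

section \<open>Codes in which u is the only generator of weight 1\<close>

definition pairsU :: "nat \<Rightarrow> (quad \<times> quad) set" where
  "pairsU c = {\<kappa>. validA c \<kappa> \<and> 3 \<le> fst (fst \<kappa>) \<and> 3 \<le> fst (snd \<kappa>)}"

fun commA :: "quad \<times> quad \<Rightarrow> bool" where
  "commA ((a, b, m, p), (a', b', m', q)) \<longleftrightarrow> a = b \<and> a' = b' \<and> p = q"

abbreviation \<open>S3 c \<equiv> {3..c + 1}\<close>

lemma pairsU_eq:
  assumes "c \<ge> 4"
  shows "pairsU c = (\<lambda>((a, a'), b, m, b', m', p, q). ((a, b, m, p), (a', b', m', q))) `
    (SIGMA (a, a') : S3 c \<times> S3 c. band c a \<times> band c (2 * a - 2) \<times> band c a' \<times> band c (2 * a' - 2) \<times>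
       band c (a + a' - 2) \<times> band c (a + a' - 2))"
  using assms by (auto simp: pairsU_def validA_iff image_iff)

lemma pairsU_comm_eq:
  assumes "c \<ge> 4"
  shows "{\<kappa>\<in>pairsU c. commA \<kappa>} = (\<lambda>((a, a'), m, m', p). ((a, a, m, p), (a', a', m', p))) `
    (SIGMA (a, a') : S3 c \<times> S3 c. band c (2 * a - 2) \<times> band c (2 * a' - 2) \<times> band c (a + a' - 2))"
proof -
  have "a \<in> band c a" if "a \<in> {2..c + 1}" for a using that by (auto simp: band_def)
  then show ?thesis using assms by (auto simp: pairsU_def validA_iff image_iff)
qed

lemma pairsU_diag_eq:
  assumes "c \<ge> 4"
  shows "{\<kappa>\<in>pairsU c. fst \<kappa> = snd \<kappa>} = (\<lambda>(a, b, m, p). ((a, b, m, p), (a, b, m, p))) `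
    (SIGMA a : S3 c. band c a \<times> band c (2 * a - 2) \<times> band c (2 * a - 2))"
  using assms by (auto simp: pairsU_def validA_iff image_iff mult_2)

lemma pairsU_comm_diag_eq:
  assumes "c \<ge> 4"
  shows "{\<kappa>\<in>pairsU c. commA \<kappa> \<and> fst \<kappa> = snd \<kappa>} = (\<lambda>(a, m, p). ((a, a, m, p), (a, a, m, p))) `
    (SIGMA a : S3 c. band c (2 * a - 2) \<times> band c (2 * a - 2))"
proof -
  have "a \<in> band c a" if "a \<in> {2..c + 1}" for a using that by (auto simp: band_def)
  then show ?thesis using assms by (auto simp: pairsU_def validA_iff image_iff mult_2)
qed

lemma finite_pairsU: "c \<ge> 4 \<Longrightarrow> finite (pairsU c)"
  unfolding pairsU_eq by (intro finite_imageI finite_SigmaI) auto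

lemma card_pairsU:
  assumes c: "c \<ge> 4" and h: "h = c div 2"
  shows "int (card (pairsU c)) = 4 * (2 * int h + 6)^2 + 2 * (4 * (int c - 2 - int h) * (2 * int h + 6) -
      3 * (int h - 1) * (int h - 2)) + (int c - 2 - int h)^2"
proof -
  \<comment> \<open>The number of choices for (b, m): b has two if a >= c, that is i <= 1, and m has
    two if 2a - 2 >= c, that is i <= h. The pair (p, q) supplies the factor 4 or 1.\<close>
  define g :: "nat \<Rightarrow> int" where "g i = (if i \<le> 1 then 4 else if i \<le> h then 2 else 1)" for i
  have h2: "h \<ge> 2" using c h by simp
  have gb: "int (card (band c a)) * int (card (band c (2 * a - 2))) = g (c + 1 - a)" if "a \<in> S3 c" for a
    using that c h by (auto simp: card_band g_def)
  have "int (card (pairsU c)) = (\<Sum>(a, a')\<in>S3 c \<times> S3 c. int (card (band c a \<times> band c (2 * a - 2) \<times>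
      band c a' \<times> band c (2 * a' - 2) \<times> band c (a + a' - 2) \<times> band c (a + a' - 2))))"
    unfolding pairsU_eq[OF c] by (subst card_image) (auto simp: inj_on_def card_SigmaI split_def)
  also have "\<dots> = (\<Sum>a\<in>S3 c. \<Sum>a'\<in>S3 c. g (c + 1 - a) * g (c + 1 - a') *
      (if (c + 1 - a) + (c + 1 - a') \<le> c then 4 else 1))"
    unfolding sum.cartesian_product
  proof (intro sum.cong refl, clarify)
    fix a a' assume "a \<in> S3 c" "a' \<in> S3 c"
    have "int (card (band c (a + a' - 2)))^2 = (if (c + 1 - a) + (c + 1 - a') \<le> c then 4 else 1)"
      using \<open>a \<in> S3 c\<close> \<open>a' \<in> S3 c\<close> by (auto simp: card_band)
    then show "int (card (band c a \<times> band c (2 * a - 2) \<times>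
      band c a' \<times> band c (2 * a' - 2) \<times> band c (a + a' - 2) \<times> band c (a + a' - 2))) =
      g (c + 1 - a) * g (c + 1 - a') * (if (c + 1 - a) + (c + 1 - a') \<le> c then 4 else 1)"
      unfolding gb[OF \<open>a \<in> S3 c\<close>, symmetric] gb[OF \<open>a' \<in> S3 c\<close>, symmetric]
      by (simp add: card_cartesian_product power2_eq_square algebra_simps)
  qed
  also have "\<dots> = (\<Sum>i\<le>c - 2. \<Sum>j\<le>c - 2. g i * g j * (if i + j \<le> c then 4 else 1))"
    by (subst sum_reflect[OF c, symmetric], subst sum_reflect[OF c, symmetric]) (rule refl)
  also have "\<dots> = 4 * (\<Sum>i\<le>h. g i)^2 + 2 * (\<Sum>i\<le>h. g i * (4 * (int c - 2 - int h) - (4 - 1) * int (i - 2)))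
      + (int c - 2 - int h)^2"
    by (rule double_sum[OF c h]) (use h2 in \<open>simp add: g_def\<close>)
  also have "(\<Sum>i\<le>h. g i * (4 * (int c - 2 - int h) - (4 - 1) * int (i - 2))) =
      4 * (int c - 2 - int h) * (\<Sum>i\<le>h. g i) - 3 * (\<Sum>i\<le>h. g i * int (i - 2))"
    by (simp add: algebra_simps sum_subtractf sum.distrib sum_distrib_left sum_distrib_right)
  also have "(\<Sum>i\<le>h. g i * int (i - 2)) = (\<Sum>i\<le>h. 2 * int (i - 2))"
    by (intro sum.cong refl) (auto simp: g_def)
  also have "\<dots> = (int h - 1) * (int h - 2)" by (rule sum_int_diff_2[OF h2])
  also have "(\<Sum>i\<le>h. g i) = 2 * int h + 6"
  proof -
    have "(\<Sum>i\<le>h. g i) = (\<Sum>i\<le>h. if i \<le> 1 then 4 else 2)" by (intro sum.cong refl) (auto simp: g_def)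
    also have "\<dots> = 2 * int h + 6"
      using h2 by (induction h rule: dec_induct) (auto simp: numeral_2_eq_2)
    finally show ?thesis .
  qed
  finally show ?thesis by (simp add: algebra_simps)
qed

lemma card_pairsU_comm:
  assumes c: "c \<ge> 4" and h: "h = c div 2"
  shows "int (card {\<kappa>\<in>pairsU c. commA \<kappa>}) = 8 * (int h + 1)^2 + 8 * (int h + 1) * (int c - 2 - int h) -
      2 * (int h - 1) * (int h - 2) + (int c - 2 - int h)^2"
proof -
  \<comment> \<open>Commutativity fixes b = a and p = q. What is left is m, counted by
    \<open>g\<close>, and the single value p, which supplies the factor 2 or 1.\<close>
  define g :: "nat \<Rightarrow> int" where "g i = (if i \<le> h then 2 else 1)" for i
  have h2: "h \<ge> 2" using c h by simp
  have gb: "int (card (band c (2 * a - 2))) = g (c + 1 - a)" if "a \<in> S3 c" for a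
    using that c h by (auto simp: card_band g_def)
  have "int (card {\<kappa>\<in>pairsU c. commA \<kappa>}) = (\<Sum>(a, a')\<in>S3 c \<times> S3 c. int (card (band c (2 * a - 2) \<times>
      band c (2 * a' - 2) \<times> band c (a + a' - 2))))"
    unfolding pairsU_comm_eq[OF c] by (subst card_image) (auto simp: inj_on_def card_SigmaI split_def)
  also have "\<dots> = (\<Sum>a\<in>S3 c. \<Sum>a'\<in>S3 c. g (c + 1 - a) * g (c + 1 - a') *
      (if (c + 1 - a) + (c + 1 - a') \<le> c then 2 else 1))"
    unfolding sum.cartesian_product
  proof (intro sum.cong refl, clarify)
    fix a a' assume "a \<in> S3 c" "a' \<in> S3 c"
    have "int (card (band c (a + a' - 2))) = (if (c + 1 - a) + (c + 1 - a') \<le> c then 2 else 1)"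
      using \<open>a \<in> S3 c\<close> \<open>a' \<in> S3 c\<close> by (auto simp: card_band)
    then show "int (card (band c (2 * a - 2) \<times> band c (2 * a' - 2) \<times> band c (a + a' - 2))) =
      g (c + 1 - a) * g (c + 1 - a') * (if (c + 1 - a) + (c + 1 - a') \<le> c then 2 else 1)"
      unfolding gb[OF \<open>a \<in> S3 c\<close>, symmetric] gb[OF \<open>a' \<in> S3 c\<close>, symmetric]
      by (simp add: card_cartesian_product algebra_simps)
  qed
  also have "\<dots> = (\<Sum>i\<le>c - 2. \<Sum>j\<le>c - 2. g i * g j * (if i + j \<le> c then 2 else 1))"
    by (subst sum_reflect[OF c, symmetric], subst sum_reflect[OF c, symmetric]) (rule refl)
  also have "\<dots> = 2 * (\<Sum>i\<le>h. g i)^2 + 2 * (\<Sum>i\<le>h. g i * (2 * (int c - 2 - int h) - (2 - 1) * int (i - 2)))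
      + (int c - 2 - int h)^2"
    by (rule double_sum[OF c h]) (use h2 in \<open>simp add: g_def\<close>)
  also have "(\<Sum>i\<le>h. g i * (2 * (int c - 2 - int h) - (2 - 1) * int (i - 2))) =
      2 * (int c - 2 - int h) * (\<Sum>i\<le>h. g i) - (\<Sum>i\<le>h. g i * int (i - 2))"
    by (simp add: algebra_simps sum_subtractf sum.distrib sum_distrib_left sum_distrib_right)
  also have "(\<Sum>i\<le>h. g i * int (i - 2)) = (\<Sum>i\<le>h. 2 * int (i - 2))"
    by (intro sum.cong refl) (auto simp: g_def)
  also have "\<dots> = (int h - 1) * (int h - 2)" by (rule sum_int_diff_2[OF h2])
  also have "(\<Sum>i\<le>h. g i) = 2 * (int h + 1)"
  proof -
    have "(\<Sum>i\<le>h. g i) = (\<Sum>i\<le>h. 2)" by (intro sum.cong refl) (auto simp: g_def)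
    then show ?thesis by simp
  qed
  finally show ?thesis by (simp add: algebra_simps power2_eq_square)
qed

lemma card_pairsU_diag:
  assumes c: "c \<ge> 4" and h: "h = c div 2"
  shows "int (card {\<kappa>\<in>pairsU c. fst \<kappa> = snd \<kappa>}) = 16 + 4 * (int h - 1) + (int c - 2 - int h)"
proof -
  \<comment> \<open>On the diagonal b, m and p are chosen once for both halves, m and p from the
    same band.\<close>
  define g :: "nat \<Rightarrow> int" where "g i = (if i \<le> 1 then 8 else if i \<le> h then 4 else 1)" for i
  have h2: "h \<ge> 2" using c h by simp
  have "int (card {\<kappa>\<in>pairsU c. fst \<kappa> = snd \<kappa>}) =
      (\<Sum>a\<in>S3 c. int (card (band c a \<times> band c (2 * a - 2) \<times> band c (2 * a - 2))))"
    unfolding pairsU_diag_eq[OF c] by (subst card_image) (auto simp: inj_on_def card_SigmaI)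
  also have "\<dots> = (\<Sum>a\<in>S3 c. g (c + 1 - a))"
    by (intro sum.cong refl) (use c h in \<open>auto simp: card_cartesian_product card_band g_def\<close>)
  also have "\<dots> = (\<Sum>i\<le>c - 2. g i)" by (rule sum_reflect[OF c])
  also have "\<dots> = (\<Sum>i\<le>h. g i) + (int c - 2 - int h)" by (rule sum_split_half[OF c h]) (use h2 in \<open>simp add: g_def\<close>)
  also have "(\<Sum>i\<le>h. g i) = (\<Sum>i\<le>h. if i \<le> 1 then 8 else 4)" by (intro sum.cong refl) (auto simp: g_def)
  also have "\<dots> = 16 + 4 * (int h - 1)"
    using h2 by (induction h rule: dec_induct) (auto simp: numeral_2_eq_2)
  finally show ?thesis .
qed

lemma card_pairsU_comm_diag:
  assumes c: "c \<ge> 4" and h: "h = c div 2"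
  shows "int (card {\<kappa>\<in>pairsU c. commA \<kappa> \<and> fst \<kappa> = snd \<kappa>}) = 4 * (int h + 1) + (int c - 2 - int h)"
proof -
  define g :: "nat \<Rightarrow> int" where "g i = (if i \<le> h then 4 else 1)" for i
  have "int (card {\<kappa>\<in>pairsU c. commA \<kappa> \<and> fst \<kappa> = snd \<kappa>}) =
      (\<Sum>a\<in>S3 c. int (card (band c (2 * a - 2) \<times> band c (2 * a - 2))))"
    unfolding pairsU_comm_diag_eq[OF c] by (subst card_image) (auto simp: inj_on_def card_SigmaI)
  also have "\<dots> = (\<Sum>a\<in>S3 c. g (c + 1 - a))"
    by (intro sum.cong refl) (use c h in \<open>auto simp: card_cartesian_product card_band g_def\<close>)
  also have "\<dots> = (\<Sum>i\<le>c - 2. g i)" by (rule sum_reflect[OF c])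
  also have "\<dots> = (\<Sum>i\<le>h. g i) + (int c - 2 - int h)" by (rule sum_split_half[OF c h]) (simp add: g_def)
  also have "(\<Sum>i\<le>h. g i) = (\<Sum>i\<le>h. 4)" by (intro sum.cong refl) (auto simp: g_def)
  finally show ?thesis by simp
qed

section \<open>Codes in which u and v have weight 1 but w has not\<close>

definition pairsT :: "nat \<Rightarrow> (quad \<times> quad) set" where
  "pairsT c = {((2, 2, 2, p), (a', b', m', q)) | p a' b' m' q.
     validA c ((2, 2, 2, p), (a', b', m', q)) \<and> 3 \<le> a' \<and> (a', b') \<le> (p, q)}"

text \<open>The three parts correspond to none, one or both of v, w having weight 1; in the last
  case every product of two generators is u^2 and a single code remains.\<close>

lemma repsA_eq:
  assumes "c \<ge> 4"
  shows "repsA c = {\<kappa>\<in>pairsU c. fst \<kappa> \<le> snd \<kappa>} \<union> pairsT c \<union> {((2, 2, 2, 2), (2, 2, 2, 2))}"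
proof (intro equalityI subsetI)
  fix \<kappa> assume "\<kappa> \<in> repsA c"
  then have val: "validA c \<kappa>" and minim: "minimalA c \<kappa>" by (auto simp: repsA_def)
  obtain a b m p a' b' m' q where \<kappa>: "\<kappa> = ((a, b, m, p), (a', b', m', q))" by (metis surj_pair)
  have ge: "2 \<le> a" "2 \<le> a'" using val unfolding \<kappa> by (simp_all add: validA.simps)
  consider "3 \<le> a" | "a = 2" "3 \<le> a'" | "a = 2" "a' = 2" using ge by linarith
  then show "\<kappa> \<in> {\<kappa>\<in>pairsU c. fst \<kappa> \<le> snd \<kappa>} \<union> pairsT c \<union> {((2, 2, 2, 2), (2, 2, 2, 2))}"
  proof cases
    case 1
    then have "a' \<noteq> 2" "(a, b, m, p) \<le> (a', b', m', q)" using minim unfolding \<kappa> by simp_all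
    then show ?thesis using 1 ge val unfolding \<kappa> pairsU_def by simp
  next
    case 2
    then have "b = 2" "m = 2" using validA_2[of c b m p] val assms unfolding \<kappa> by blast+
    moreover have "(a', b') \<le> (p, q)" using minim 2 unfolding \<kappa> by simp
    ultimately have "\<kappa> \<in> pairsT c" using 2 val unfolding \<kappa> pairsT_def by blast
    then show ?thesis by blast
  next
    case 3
    then have "(b, m, p) = (2, 2, 2)" "(b', m', q) = (2, 2, 2)"
      using validA_2_2[of c "(b, m, p)" "(b', m', q)"] val assms unfolding \<kappa> by blast+
    then show ?thesis using 3 unfolding \<kappa> by simp
  qed
next
  fix \<kappa> assume *: "\<kappa> \<in> {\<kappa>\<in>pairsU c. fst \<kappa> \<le> snd \<kappa>} \<union> pairsT c \<union> {((2, 2, 2, 2), (2, 2, 2, 2))}"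
  obtain a b m p a' b' m' q where \<kappa>: "\<kappa> = ((a, b, m, p), (a', b', m', q))" by (metis surj_pair)
  consider "\<kappa> \<in> pairsU c" "fst \<kappa> \<le> snd \<kappa>" | "\<kappa> \<in> pairsT c" | "\<kappa> = ((2, 2, 2, 2), (2, 2, 2, 2))"
    using * by blast
  then show "\<kappa> \<in> repsA c"
  proof cases
    case 1
    then show ?thesis unfolding \<kappa> pairsU_def repsA_def by (simp del: less_eq_prod_simp)
  next
    case 2
    then show ?thesis unfolding pairsT_def repsA_def by (auto simp del: less_eq_prod_simp insert_Times_insert)
  next
    case 3
    then show ?thesis using assms unfolding repsA_def by (simp add: validA.simps trunc_def)
  qed
qed

text \<open>The band has a second element iff 2a - 2 >= c, that is a >= c + 1 - h, which holds for h
  - 1 of the values below c.\<close>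

lemma sum_card_band_squares:
  assumes "c \<ge> 4" "h = c div 2"
  shows "(\<Sum>a\<in>{3..<c}. card (band c (2 * a - 2))) = c - 3 + (h - 1)"
proof -
  have "(\<Sum>a\<in>{3..<c}. card (band c (2 * a - 2))) = (\<Sum>a\<in>{3..<c}. 1 + (if c + 2 \<le> 2 * a then 1 else 0))"
    by (intro sum.cong) (auto simp: card_band)
  also have "\<dots> = (\<Sum>a\<in>{3..<c}. 1) + (\<Sum>a\<in>{3..<c}. if c + 2 \<le> 2 * a then 1 else 0)"
    by (rule sum.distrib)
  also have "(\<Sum>a\<in>{3..<c}. if c + 2 \<le> 2 * a then 1 else 0) = (\<Sum>a\<in>{a\<in>{3..<c}. c + 2 \<le> 2 * a}. 1)"
    by (rule sum.inter_filter[symmetric]) simp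
  also have "(\<Sum>a\<in>{3..<c}. 1) + \<dots> = c - 3 + card {a\<in>{3..<c}. c + 2 \<le> 2 * a}" by simp
  also have "{a\<in>{3..<c}. c + 2 \<le> 2 * a} = {c + 1 - h..<c}" using assms by auto
  also have "card \<dots> = h - 1" using assms by simp
  finally show ?thesis .
qed

text \<open>Four elements in weakly increasing order: (16 + 4) / 2 = 10.\<close>

lemma card_square_le:
  "card {z\<in>(({c, c + 1} \<times> {c, c + 1}) \<times> ({c, c + 1} \<times> {c, c + 1})). fst z \<le> snd z} = (10 :: nat)" for c :: nat
proof -
  let ?A = "{c, c + 1} \<times> {c, c + 1}"
  have "2 * card {z\<in>?A \<times> ?A. fst z \<le> snd z} = card (?A \<times> ?A) + card {z\<in>?A \<times> ?A. fst z = snd z}"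
    by (rule card_symmetric_le) auto
  moreover have "card {z\<in>?A \<times> ?A. fst z = snd z} = card ?A"
  proof -
    have "{z\<in>?A \<times> ?A. fst z = snd z} = (\<lambda>x. (x, x)) ` ?A" by auto
    moreover have "card ((\<lambda>x. (x, x)) ` ?A) = card ?A" by (rule card_image) (simp add: inj_on_def)
    ultimately show ?thesis by (simp only:)
  qed
  moreover have "card ?A = 4" "card (?A \<times> ?A) = 16" by (simp_all add: card_cartesian_product)
  ultimately show ?thesis by simp
qed

lemma validA_top:
  assumes "c \<ge> 4" "{a, b, p, q, m} \<subseteq> {c, c + 1}"
  shows "validA c ((2, 2, 2, p), (a, b, m, q))"
proof -
  have "a = c \<or> a = c + 1" using assms by simp
  then have "a \<in> {2..c + 1}" "band c a = {c, c + 1}" "band c (2 * a - 2) = {c, c + 1}"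
    "band c (2 + a - 2) = {c, c + 1}" "band c 2 = {2}" "band c (2 * 2 - 2) = {2}"
    using assms(1) by (auto simp: band_def)
  note b = this
  show ?thesis unfolding validA_iff[OF assms(1)] b(2-6) using b(1) assms by simp
qed

text \<open>As v has weight 1, the exponents of wu, vw and wv lie in the band of a, the exponent of
  uw. Below c all four coincide and only m may vary; from c on, all five range over {c, c + 1},
  subject to the order condition.\<close>

lemma pairsT_eq:
  assumes "c \<ge> 4"
  shows "pairsT c = (\<lambda>(a, m). ((2, 2, 2, a), (a, a, m, a))) ` (SIGMA a : {3..<c}. band c (2 * a - 2)) \<union>
    (\<lambda>(((a, b), (p, q)), m). ((2, 2, 2, p), (a, b, m, q))) `
      ({z\<in>(({c, c + 1} \<times> {c, c + 1}) \<times> ({c, c + 1} \<times> {c, c + 1})). fst z \<le> snd z} \<times> {c, c + 1})"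
    (is "_ = ?L \<union> ?H")
proof (intro equalityI subsetI)
  fix \<kappa> assume "\<kappa> \<in> pairsT c"
  then obtain p a b m q where \<kappa>: "\<kappa> = ((2, 2, 2, p), (a, b, m, q))" and a: "3 \<le> a" "a \<le> c + 1" "(a, b) \<le> (p, q)"
    and bands: "b \<in> band c a" "m \<in> band c (2 * a - 2)" "p \<in> band c a" "q \<in> band c a"
    unfolding pairsT_def using assms by (auto simp: validA_iff simp del: less_eq_prod_simp)
  show "\<kappa> \<in> ?L \<union> ?H"
  proof (cases "a < c")
    case True
    then have "\<kappa> = (\<lambda>(a, m). ((2, 2, 2, a), (a, a, m, a))) (a, m)" "(a, m) \<in> (SIGMA a : {3..<c}. band c (2 * a - 2))"
      using bands a unfolding \<kappa> by (auto simp: band_def)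
    then show ?thesis by blast
  next
    case False
    then have "band c a = {c, c + 1}" "band c (2 * a - 2) = {c, c + 1}" "a \<in> {c, c + 1}"
      using a assms by (auto simp: band_def)
    then have "{a, b, p, q, m} \<subseteq> {c, c + 1}" using bands by simp
    then have "\<kappa> = (\<lambda>(((a, b), (p, q)), m). ((2, 2, 2, p), (a, b, m, q))) (((a, b), (p, q)), m)"
      "(((a, b), (p, q)), m) \<in> {z\<in>(({c, c + 1} \<times> {c, c + 1}) \<times> ({c, c + 1} \<times> {c, c + 1})). fst z \<le> snd z} \<times> {c, c + 1}"
      using a(3) unfolding \<kappa> by (simp_all del: less_eq_prod_simp insert_Times_insert)
    then show ?thesis by blast
  qed
next
  fix \<kappa> assume "\<kappa> \<in> ?L \<union> ?H"
  then show "\<kappa> \<in> pairsT c"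
  proof
    assume "\<kappa> \<in> ?L"
    then show ?thesis using assms unfolding pairsT_def by (auto simp: validA_iff) (auto simp: band_def)
  next
    assume "\<kappa> \<in> ?H"
    then obtain a b p q m where "\<kappa> = ((2, 2, 2, p), (a, b, m, q))" "(a, b) \<le> (p, q)" "{a, b, p, q, m} \<subseteq> {c, c + 1}"
      by (auto simp del: less_eq_prod_simp insert_Times_insert)
    moreover from this have "validA c ((2, 2, 2, p), (a, b, m, q))" "3 \<le> a"
      using validA_top[OF assms] assms by auto
    ultimately show ?thesis unfolding pairsT_def by blast
  qed
qed

lemma finite_pairsT: "c \<ge> 4 \<Longrightarrow> finite (pairsT c)"
  unfolding pairsT_eq
  by (intro finite_UnI finite_imageI finite_SigmaI finite_cartesian_product finite_Collect_conjI disjI1) auto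

lemma card_pairsT:
  assumes c: "c \<ge> 4" and h: "h = c div 2"
  shows "card (pairsT c) = c + h + 16"
proof -
  let ?L = "(\<lambda>(a, m). ((2::nat, 2::nat, 2::nat, a), (a, a, m, a))) ` (SIGMA a : {3..<c}. band c (2 * a - 2))"
  let ?X = "{z\<in>(({c, c + 1} \<times> {c, c + 1}) \<times> ({c, c + 1} \<times> {c, c + 1})). fst z \<le> snd z}"
  let ?H = "(\<lambda>(((a, b), (p, q)), m). ((2::nat, 2::nat, 2::nat, p), (a, b, m, q))) ` (?X \<times> {c, c + 1})"
  have X: "card ?X = 10" by (rule card_square_le)
  have "card (pairsT c) = card ?L + card ?H"
    unfolding pairsT_eq[OF c]
  proof (rule card_Un_disjoint)
    show "finite ?L" by simp
    have "finite ?X" using X card.infinite by fastforce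
    then show "finite ?H" by (intro finite_imageI finite_cartesian_product) auto
    show "?L \<inter> ?H = {}" by auto
  qed
  also have "card ?L = card (SIGMA a : {3..<c}. band c (2 * a - 2))"
    by (rule card_image) (auto simp: inj_on_def)
  also have "\<dots> = c - 3 + (h - 1)"
    using sum_card_band_squares[OF c h] by (simp add: card_SigmaI)
  also have "card ?H = card (?X \<times> {c, c + 1})"
    by (rule card_image) (auto simp: inj_on_def)
  also have "\<dots> = 20" using X by (simp only: card_cartesian_product) simp
  finally show ?thesis using c h by simp
qed

lemma card_pairsT_comm:
  assumes c: "c \<ge> 4" and h: "h = c div 2"
  shows "card {\<kappa>\<in>pairsT c. commA \<kappa>} = c + h + 2"
proof -
  let ?L = "(\<lambda>(a, m). ((2::nat, 2::nat, 2::nat, a), (a, a, m, a))) ` (SIGMA a : {3..<c}. band c (2 * a - 2))"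
  \<comment> \<open>With a = b and p = q the order condition reads a <= p, which leaves three pairs
    (a, p).\<close>
  let ?H = "(\<lambda>((a, p), m). ((2::nat, 2::nat, 2::nat, p), (a, a, m, p))) ` ({(c, c), (c, c + 1), (c + 1, c + 1)} \<times> {c, c + 1})"
  let ?X = "{z\<in>(({c, c + 1} \<times> {c, c + 1}) \<times> ({c, c + 1} \<times> {c, c + 1})). fst z \<le> snd z} \<times> {c, c + 1}"
  let ?f = "\<lambda>(((a, b), (p, q)), m). ((2::nat, 2::nat, 2::nat, p), (a, b, m, q))"
  have "{\<kappa>\<in>?f ` ?X. commA \<kappa>} = ?H"
  proof (intro equalityI subsetI)
    fix \<kappa> assume "\<kappa> \<in> {\<kappa>\<in>?f ` ?X. commA \<kappa>}"
    then obtain a p m where \<kappa>: "\<kappa> = ((2, 2, 2, p), (a, a, m, p))" and h: "(a, a) \<le> (p, p)" "a \<in> {c, c + 1}" "p \<in> {c, c + 1}" "m \<in> {c, c + 1}"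
      by (auto simp del: less_eq_prod_simp insert_Times_insert)
    have "(a, p) \<in> {(c, c), (c, c + 1), (c + 1, c + 1)}" using h(1-3) by auto
    then have "((a, p), m) \<in> {(c, c), (c, c + 1), (c + 1, c + 1)} \<times> {c, c + 1}" using h(4) by blast
    then have "(\<lambda>((a, p), m). ((2, 2, 2, p), (a, a, m, p))) ((a, p), m) \<in> ?H" by (rule imageI)
    then show "\<kappa> \<in> ?H" unfolding \<kappa> prod.case .
  next
    fix \<kappa> assume "\<kappa> \<in> ?H"
    then obtain z where z: "z \<in> {(c, c), (c, c + 1), (c + 1, c + 1)} \<times> {c, c + 1}"
      and \<kappa>z: "\<kappa> = (\<lambda>((a, p), m). ((2, 2, 2, p), (a, a, m, p))) z" by blast
    obtain a p m where "z = ((a, p), m)" by (metis surj_pair)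
    with z \<kappa>z have \<kappa>: "\<kappa> = ((2, 2, 2, p), (a, a, m, p))"
      and h: "(a, p) \<in> {(c, c), (c, c + 1), (c + 1, c + 1)}" "m \<in> {c, c + 1}"
      by auto
    have "a \<in> {c, c + 1}" "p \<in> {c, c + 1}" "a \<le> p" using h(1) by auto
    then have "(((a, a), (p, p)), m) \<in> ?X" using h(2) by (simp del: insert_Times_insert)
    then have "?f (((a, a), (p, p)), m) \<in> ?f ` ?X" by (rule imageI)
    then have "\<kappa> \<in> ?f ` ?X" unfolding \<kappa> prod.case .
    moreover have "commA \<kappa>" unfolding \<kappa> by simp
    ultimately show "\<kappa> \<in> {\<kappa>\<in>?f ` ?X. commA \<kappa>}" by (intro CollectI conjI)
  qed
  moreover have "{\<kappa>\<in>?L. commA \<kappa>} = ?L" by auto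
  moreover have "{\<kappa>\<in>pairsT c. commA \<kappa>} = {\<kappa>\<in>?L. commA \<kappa>} \<union> {\<kappa>\<in>?f ` ?X. commA \<kappa>}"
    unfolding pairsT_eq[OF c] by blast
  ultimately have "{\<kappa>\<in>pairsT c. commA \<kappa>} = ?L \<union> ?H" by (simp only:)
  then have "card {\<kappa>\<in>pairsT c. commA \<kappa>} = card (?L \<union> ?H)" by (rule arg_cong)
  also have "\<dots> = card ?L + card ?H" by (rule card_Un_disjoint) auto
  also have "card ?L = card (SIGMA a : {3..<c}. band c (2 * a - 2))"
    by (rule card_image) (auto simp: inj_on_def)
  also have "\<dots> = c - 3 + (h - 1)"
    using sum_card_band_squares[OF c h] by (simp add: card_SigmaI)
  also have "card ?H = card ({(c, c), (c, c + 1), (c + 1, c + 1)} \<times> {c, c + 1})"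
    by (rule card_image) (auto simp: inj_on_def)
  also have "\<dots> = 6" by (simp add: card_cartesian_product)
  finally show ?thesis using c h by simp
qed

text \<open>
  Besides the commutative codes, an anti-automorphism may interchange $v$ and $w$ (if $u$ is the only
  generator of weight $1$) or $u$ and $v$ (if $v$ has weight $1$, too).
\<close>

fun sdA :: "quad \<times> quad \<Rightarrow> bool" where
  "sdA ((a, b, m, p), (a', b', m', q)) \<longleftrightarrow> a = b \<and> a' = b' \<and> p = q \<or>
     3 \<le> a \<and> 3 \<le> a' \<and> a' = b \<and> b' = a \<and> m' = m \<or> a = 2 \<and> 3 \<le> a' \<and> p = b' \<and> q = a'"

text \<open>Interchanging u and v in the dual requires p = b' and q = a'. Then minimality reads (a',
  b') <= (b', a'), so a non-commutative code has a' = c and b' = c + 1, with m' free.\<close>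

lemma card_pairsT_sd:
  assumes c: "c \<ge> 4"
  shows "card {\<kappa>\<in>pairsT c. sdA \<kappa> \<and> \<not> commA \<kappa>} = 2"
proof -
  let ?X = "{z\<in>(({c, c + 1} \<times> {c, c + 1}) \<times> ({c, c + 1} \<times> {c, c + 1})). fst z \<le> snd z} \<times> {c, c + 1}"
  let ?f = "\<lambda>(((a, b), (p, q)), m). ((2::nat, 2::nat, 2::nat, p), (a, b, m, q))"
  let ?L = "(\<lambda>(a, m). ((2::nat, 2::nat, 2::nat, a), (a, a, m, a))) ` (SIGMA a : {3..<c}. band c (2 * a - 2))"
  let ?H = "(\<lambda>m. ((2::nat, 2::nat, 2::nat, c + 1), (c, c + 1, m, c))) ` {c, c + 1}"
  have "{\<kappa>\<in>?f ` ?X. sdA \<kappa> \<and> \<not> commA \<kappa>} = ?H"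
  proof (intro equalityI subsetI)
    fix \<kappa> assume "\<kappa> \<in> {\<kappa>\<in>?f ` ?X. sdA \<kappa> \<and> \<not> commA \<kappa>}"
    then obtain a b m where \<kappa>: "\<kappa> = ((2, 2, 2, b), (a, b, m, a))"
      and h: "(a, b) \<le> (b, a)" "a \<noteq> b" "a \<in> {c, c + 1}" "b \<in> {c, c + 1}" "m \<in> {c, c + 1}"
      by (auto simp del: less_eq_prod_simp insert_Times_insert)
    have "a = c" "b = c + 1" using h(1-4) by auto
    then show "\<kappa> \<in> ?H" using h(5) unfolding \<kappa> by simp
  next
    fix \<kappa> assume "\<kappa> \<in> ?H"
    then obtain m where \<kappa>: "\<kappa> = ((2, 2, 2, c + 1), (c, c + 1, m, c))" and m: "m \<in> {c, c + 1}" by blast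
    have "(((c, c + 1), (c + 1, c)), m) \<in> ?X" using m by simp
    then have "?f (((c, c + 1), (c + 1, c)), m) \<in> ?f ` ?X" by (rule imageI)
    then have "\<kappa> \<in> ?f ` ?X" unfolding \<kappa> prod.case .
    moreover have "sdA \<kappa>" "\<not> commA \<kappa>" using c unfolding \<kappa> by simp_all
    ultimately show "\<kappa> \<in> {\<kappa>\<in>?f ` ?X. sdA \<kappa> \<and> \<not> commA \<kappa>}" by (intro CollectI conjI)
  qed
  moreover have "{\<kappa>\<in>?L. sdA \<kappa> \<and> \<not> commA \<kappa>} = {}" by auto
  moreover have "{\<kappa>\<in>pairsT c. sdA \<kappa> \<and> \<not> commA \<kappa>} = {\<kappa>\<in>?L. sdA \<kappa> \<and> \<not> commA \<kappa>} \<union> {\<kappa>\<in>?f ` ?X. sdA \<kappa> \<and> \<not> commA \<kappa>}"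
    unfolding pairsT_eq[OF c] by blast
  ultimately have "{\<kappa>\<in>pairsT c. sdA \<kappa> \<and> \<not> commA \<kappa>} = ?H" by (simp only: Un_empty_left)
  also have "card \<dots> = card {c, c + 1}" by (rule card_image) (auto simp: inj_on_def)
  finally show ?thesis by simp
qed

text \<open>Interchanging v and w in the dual requires a' = b, b' = a and m' = m. Either a = b, and
  then p = c, q = c + 1 with a >= c + 1 - h and two values of m, or a = c, b = c + 1 with m, p, q
  free.\<close>

lemma card_pairsU_sd:
  assumes c: "c \<ge> 4" and h: "h = c div 2"
  shows "card {\<kappa>\<in>pairsU c. fst \<kappa> \<le> snd \<kappa> \<and> sdA \<kappa> \<and> \<not> commA \<kappa>} = 8 + 2 * (h + 1)"
proof -
  let ?L = "(\<lambda>(a, m). ((a, a, m, c), (a, a, m, c + 1))) ` ({c + 1 - h..c + 1} \<times> {c, c + 1})"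
  let ?H = "(\<lambda>(m, p, q). ((c, c + 1, m, p), (c + 1, c, m, q))) ` ({c, c + 1} \<times> {c, c + 1} \<times> {c, c + 1})"
  have "{\<kappa>\<in>pairsU c. fst \<kappa> \<le> snd \<kappa> \<and> sdA \<kappa> \<and> \<not> commA \<kappa>} = ?L \<union> ?H"
  proof (intro equalityI subsetI)
    fix \<kappa> assume \<kappa>': "\<kappa> \<in> {\<kappa>\<in>pairsU c. fst \<kappa> \<le> snd \<kappa> \<and> sdA \<kappa> \<and> \<not> commA \<kappa>}"
    obtain a b m p a' b' m' q where \<kappa>: "\<kappa> = ((a, b, m, p), (a', b', m', q))" by (metis surj_pair)
    have h': "3 \<le> a" "a \<le> c + 1" "a' = b" "b' = a" "m' = m" "b \<in> band c a" "m \<in> band c (2 * a - 2)" "p \<in> band c (a + a' - 2)"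
        "q \<in> band c (a + a' - 2)" "\<not> (a = b \<and> p = q)" "(a, b, m, p) \<le> (a', b', m', q)"
      using \<kappa>' c unfolding \<kappa> pairsU_def by (auto simp: validA_iff simp del: less_eq_prod_simp)
    show "\<kappa> \<in> ?L \<union> ?H"
    proof (cases "a = b")
      case True
      then have "p < q" using h' by auto
      then have "p = c" "q = c + 1" "c \<le> 2 * a - 2" "m \<in> {c, c + 1}"
        using h' True by (auto simp: band_def mult_2 split: if_splits)
      moreover from this have "a \<in> {c + 1 - h..c + 1}" using h h' by auto
      ultimately have "\<kappa> = (\<lambda>(a, m). ((a, a, m, c), (a, a, m, c + 1))) (a, m)" "(a, m) \<in> {c + 1 - h..c + 1} \<times> {c, c + 1}"
        using h' True unfolding \<kappa> by auto
      then show ?thesis by blast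
    next
      case False
      then have "a < b" using h' by auto
      then have "a = c" "b = c + 1" using h'(1,2,6) by (auto simp: band_def split: if_splits)
      then have "\<kappa> = (\<lambda>(m, p, q). ((c, c + 1, m, p), (c + 1, c, m, q))) (m, p, q)"
        "(m, p, q) \<in> {c, c + 1} \<times> {c, c + 1} \<times> {c, c + 1}"
        using h' c unfolding \<kappa> by (auto simp: band_def split: if_splits)
      then show ?thesis by blast
    qed
  next
    fix \<kappa> assume "\<kappa> \<in> ?L \<union> ?H"
    then show "\<kappa> \<in> {\<kappa>\<in>pairsU c. fst \<kappa> \<le> snd \<kappa> \<and> sdA \<kappa> \<and> \<not> commA \<kappa>}"
    proof
      assume "\<kappa> \<in> ?L"
      then show ?thesis using c h unfolding pairsU_def by (auto simp: validA_iff) (auto simp: band_def)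
    next
      assume "\<kappa> \<in> ?H"
      then show ?thesis using c unfolding pairsU_def by (auto simp: validA_iff) (auto simp: band_def)
    qed
  qed
  then have "card {\<kappa>\<in>pairsU c. fst \<kappa> \<le> snd \<kappa> \<and> sdA \<kappa> \<and> \<not> commA \<kappa>} = card (?L \<union> ?H)" by (rule arg_cong)
  also have "\<dots> = card ?L + card ?H" by (rule card_Un_disjoint) auto
  also have "card ?L = card ({c + 1 - h..c + 1} \<times> {c, c + 1})" by (rule card_image) (auto simp: inj_on_def)
  also have "\<dots> = 2 * (h + 1)" using h by (simp add: card_cartesian_product)
  also have "card ?H = card ({c, c + 1} \<times> {c, c + 1} \<times> {c, c + 1})" by (rule card_image) (auto simp: inj_on_def)
  also have "\<dots> = 8" by (simp add: card_cartesian_product)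
  finally show ?thesis by simp
qed

lemma card_repsA_filter:
  assumes c: "c \<ge> 4"
  shows "card {\<kappa>\<in>repsA c. Pr \<kappa>} = card {\<kappa>\<in>pairsU c. fst \<kappa> \<le> snd \<kappa> \<and> Pr \<kappa>} + card {\<kappa>\<in>pairsT c. Pr \<kappa>} +
    (if Pr ((2, 2, 2, 2), (2, 2, 2, 2)) then 1 else 0)"
proof -
  let ?U = "{\<kappa>\<in>pairsU c. fst \<kappa> \<le> snd \<kappa> \<and> Pr \<kappa>}" and ?T = "{\<kappa>\<in>pairsT c. Pr \<kappa>}"
    and ?O = "if Pr ((2, 2, 2, 2), (2, 2, 2, 2)) then {((2, 2, 2, 2), (2, 2, 2, 2))} else {} :: (quad \<times> quad) set"
  have fin: "finite ?U" "finite ?T"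
    by (rule finite_subset[OF _ finite_pairsU[OF c]], blast) (rule finite_subset[OF _ finite_pairsT[OF c]], blast)
  have "{\<kappa>\<in>repsA c. Pr \<kappa>} = ?U \<union> ?T \<union> ?O" unfolding repsA_eq[OF c] by auto
  then have "card {\<kappa>\<in>repsA c. Pr \<kappa>} = card (?U \<union> ?T \<union> ?O)" by (rule arg_cong)
  also have "\<dots> = card (?U \<union> ?T) + card ?O"
    by (rule card_Un_disjoint) (use fin in \<open>auto simp: pairsU_def pairsT_def\<close>)
  also have "card (?U \<union> ?T) = card ?U + card ?T"
    by (rule card_Un_disjoint[OF fin]) (auto simp: pairsU_def pairsT_def)
  finally show ?thesis by simp
qed

lemma finite_repsA: "c \<ge> 4 \<Longrightarrow> finite (repsA c)"
  unfolding repsA_eq using finite_pairsU finite_pairsT by simp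

lemma pairsU_swap: "(P, Q) \<in> pairsU c \<Longrightarrow> (Q, P) \<in> pairsU c"
  using validA_swap by (auto simp: pairsU_def)

lemma card_repsA:
  assumes c: "c \<ge> 4" and h: "h = c div 2"
  shows "2 * int (card (repsA c)) = 4 * (2 * int h + 6)^2 + 2 * (4 * (int c - 2 - int h) * (2 * int h + 6) -
      3 * (int h - 1) * (int h - 2)) + (int c - 2 - int h)^2 + (16 + 4 * (int h - 1) + (int c - 2 - int h)) +
      2 * (int c + int h + 17)"
proof -
  have "2 * card {\<kappa>\<in>pairsU c. fst \<kappa> \<le> snd \<kappa>} = card (pairsU c) + card {\<kappa>\<in>pairsU c. fst \<kappa> = snd \<kappa>}"
    using finite_pairsU[OF c] pairsU_swap by (rule card_symmetric_le)
  then have "2 * int (card {\<kappa>\<in>pairsU c. fst \<kappa> \<le> snd \<kappa>}) = int (card (pairsU c)) + int (card {\<kappa>\<in>pairsU c. fst \<kappa> = snd \<kappa>})"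
    by linarith
  moreover have "card (repsA c) = card {\<kappa>\<in>pairsU c. fst \<kappa> \<le> snd \<kappa>} + card (pairsT c) + 1"
    using card_repsA_filter[OF c, of "\<lambda>_. True"] by simp
  ultimately show ?thesis
    using card_pairsU[OF c h] card_pairsU_diag[OF c h] card_pairsT[OF c h] by (simp add: algebra_simps)
qed

lemma card_repsA_comm:
  assumes c: "c \<ge> 4" and h: "h = c div 2"
  shows "2 * int (card {\<kappa>\<in>repsA c. commA \<kappa>}) = 8 * (int h + 1)^2 + 8 * (int h + 1) * (int c - 2 - int h) -
      2 * (int h - 1) * (int h - 2) + (int c - 2 - int h)^2 + (4 * (int h + 1) + (int c - 2 - int h)) +
      2 * (int c + int h + 3)"
proof -
  let ?R = "{\<kappa>\<in>pairsU c. commA \<kappa>}"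
  have "2 * card {\<kappa>\<in>?R. fst \<kappa> \<le> snd \<kappa>} = card ?R + card {\<kappa>\<in>?R. fst \<kappa> = snd \<kappa>}"
    using finite_pairsU[OF c] pairsU_swap by (intro card_symmetric_le) auto
  moreover have "{\<kappa>\<in>?R. fst \<kappa> \<le> snd \<kappa>} = {\<kappa>\<in>pairsU c. fst \<kappa> \<le> snd \<kappa> \<and> commA \<kappa>}"
    "{\<kappa>\<in>?R. fst \<kappa> = snd \<kappa>} = {\<kappa>\<in>pairsU c. commA \<kappa> \<and> fst \<kappa> = snd \<kappa>}" by auto
  ultimately have "2 * int (card {\<kappa>\<in>pairsU c. fst \<kappa> \<le> snd \<kappa> \<and> commA \<kappa>}) =
      int (card ?R) + int (card {\<kappa>\<in>pairsU c. commA \<kappa> \<and> fst \<kappa> = snd \<kappa>})"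
    by simp
  moreover have "card {\<kappa>\<in>repsA c. commA \<kappa>} = card {\<kappa>\<in>pairsU c. fst \<kappa> \<le> snd \<kappa> \<and> commA \<kappa>} + card {\<kappa>\<in>pairsT c. commA \<kappa>} + 1"
    using card_repsA_filter[OF c, of commA] by simp
  ultimately show ?thesis
    using card_pairsU_comm[OF c h] card_pairsU_comm_diag[OF c h] card_pairsT_comm[OF c h] by (simp add: algebra_simps)
qed

lemma card_repsA_sd:
  assumes c: "c \<ge> 4" and h: "h = c div 2"
  shows "card {\<kappa>\<in>repsA c. sdA \<kappa>} = card {\<kappa>\<in>repsA c. commA \<kappa>} + 2 * h + 12"
proof -
  have "commA \<kappa> \<Longrightarrow> sdA \<kappa>" for \<kappa> by (cases \<kappa>) auto
  then have "{\<kappa>\<in>repsA c. sdA \<kappa>} = {\<kappa>\<in>repsA c. commA \<kappa>} \<union> {\<kappa>\<in>repsA c. sdA \<kappa> \<and> \<not> commA \<kappa>}" by auto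
  then have "card {\<kappa>\<in>repsA c. sdA \<kappa>} = card ({\<kappa>\<in>repsA c. commA \<kappa>} \<union> {\<kappa>\<in>repsA c. sdA \<kappa> \<and> \<not> commA \<kappa>})"
    by (rule arg_cong)
  also have "\<dots> = card {\<kappa>\<in>repsA c. commA \<kappa>} + card {\<kappa>\<in>repsA c. sdA \<kappa> \<and> \<not> commA \<kappa>}"
    using finite_repsA[OF c] by (intro card_Un_disjoint) auto
  also have "card {\<kappa>\<in>repsA c. sdA \<kappa> \<and> \<not> commA \<kappa>} = 8 + 2 * (h + 1) + 2"
    using card_repsA_filter[OF c, of "\<lambda>\<kappa>. sdA \<kappa> \<and> \<not> commA \<kappa>"] card_pairsU_sd[OF c h] card_pairsT_sd[OF c] by simp
  finally show ?thesis by simp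
qed

section \<open>Commutativity and self-duality in type A\<close>

lemma frameA_flip:
  assumes "frameA c f" shows "frameA c (\<lambda>x y. f y x)"
proof -
  have pt: "power_table c f" using assms by (simp add: frameA_def)
  then have "is_semigroup (dual (table c f))" by (simp add: power_table_def is_semigroup_dual)
  then have "is_semigroup (table c (\<lambda>x y. f y x))" by (simp add: dual_def table_def)
  then show ?thesis using assms unfolding frameA_def power_table_def by (simp add: add.commute)
qed

lemma dual_table: "dual (table c f) = table c (\<lambda>x y. f y x)"
  by (simp add: dual_def table_def)

lemma is_commutative_opA:
  assumes "c \<ge> 4" "validA c \<kappa>"
  shows "is_commutative (table c (opA c \<kappa>)) \<longleftrightarrow> commA \<kappa>"
proof -
  obtain a b m p a' b' m' q where \<kappa>: "\<kappa> = ((a, b, m, p), (a', b', m', q))" by (metis surj_pair)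
  show ?thesis
  proof
    assume com: "is_commutative (table c (opA c \<kappa>))"
    have "opA c \<kappa> x y = opA c \<kappa> y x" if "x \<in> {1..c + 3}" "y \<in> {1..c + 3}" for x y
      using com that unfolding is_commutative_def by simp
    from this[of 1 "c + 2"] this[of 1 "c + 3"] this[of "c + 2" "c + 3"]
    show "commA \<kappa>" unfolding \<kappa> opA_gens by simp
  next
    assume "commA \<kappa>"
    \<comment> \<open>The reversed operation has the same code, and a code determines its
      operation.\<close>
    then have "codeA c (\<lambda>x y. opA c \<kappa> y x) = \<kappa>" unfolding codeA_def \<kappa> opA_gens by simp
    then have "opA c \<kappa> y x = opA c \<kappa> x y" if "x \<in> {1..c + 3}" "y \<in> {1..c + 3}" for x y
      using frameA_valid(2)[OF frameA_flip[OF frameA_opA[OF assms(2,1)]] assms(1) that] by simp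
    then show "is_commutative (table c (opA c \<kappa>))" unfolding is_commutative_def carr_table mul_table by blast
  qed
qed

text \<open>Reversal exchanges a with b, a' with b' and p with q. The alternatives of
  \<open>sdA\<close> say that the reversed code is the original one, or becomes it by interchanging
  v and w, or u and v.\<close>

lemma self_dual_opA:
  assumes c: "c \<ge> 4" and rep: "\<kappa> \<in> repsA c"
  shows "isomorphic (table c (opA c \<kappa>)) (dual (table c (opA c \<kappa>))) \<longleftrightarrow> sdA \<kappa>"
proof -
  obtain a b m p a' b' m' q where \<kappa>: "\<kappa> = ((a, b, m, p), (a', b', m', q))" by (metis surj_pair)
  have val: "validA c \<kappa>" and minim: "minimalA c \<kappa>" using rep by (auto simp: repsA_def)
  have rng: "2 \<le> a" "2 \<le> b" "2 \<le> a'" "2 \<le> b'" and tr: "trunc c (a + 1) = trunc c (b + 1)" "trunc c (a' + 1) = trunc c (b' + 1)"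
    using val unfolding \<kappa> by (simp_all add: validA.simps)
  have two: "a = 2 \<longleftrightarrow> b = 2" "a' = 2 \<longleftrightarrow> b' = 2" using tr rng c by (auto simp: trunc_def min_def split: if_splits)
  let ?f = "opA c \<kappa>" and ?g = "\<lambda>x y. opA c \<kappa> y x"
  have f: "frameA c ?f" using frameA_opA[OF val c] .
  have g: "frameA c ?g" using frameA_flip[OF f] .
  have code_f: "codeA c ?f = ((a, b, m, p), (a', b', m', q))" unfolding codeA_opA \<kappa> ..
  have code_g: "codeA c ?g = ((b, a, m, q), (b', a', m', p))" unfolding codeA_def \<kappa> opA_gens ..
  have min_a: "a = 2 \<or> a' \<noteq> 2" using minim unfolding \<kappa> by (auto split: if_splits)
  show ?thesis
  proof
    assume "isomorphic (table c ?f) (dual (table c ?f))"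
    then have iso: "isomorphic (table c ?f) (table c ?g)" by (simp only: dual_table)
    show "sdA \<kappa>"
    proof (cases rule: frameA_iso_cases[OF f g c iso code_f code_g,
        case_names unique reversed reversed' two two' three])
      case unique
      then show ?thesis unfolding code_f code_g unfolding \<kappa> by auto
    next
      case reversed
      then show ?thesis using min_a by blast
    next
      case reversed'
      then show ?thesis using min_a two by blast
    next
      case two
      then show ?thesis unfolding code_f code_g unfolding \<kappa> using \<open>a = 2 \<longleftrightarrow> b = 2\<close> \<open>a' = 2 \<longleftrightarrow> b' = 2\<close> rng by auto
    next
      case two'
      then show ?thesis unfolding code_f code_g unfolding \<kappa> by auto
    next
      case three
      have "((a, b, m, p), (a', b', m', q)) = ((b, a, m, q), (b', a', m', p))"
        using three(5) unfolding code_f code_g .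
      then have "a = b" "a' = b'" "p = q" by (metis prod.inject)+
      then show ?thesis unfolding \<kappa> by simp
    qed
  next
    assume sd: "sdA \<kappa>"
    have g_iso: "isomorphic (table c (opA c ((b, a, m, q), (b', a', m', p)))) (table c ?g)"
      using isomorphic_sym[OF isomorphic_opA_codeA[OF g c]] g unfolding code_g
      by (simp add: frameA_def power_table_def)
    consider "commA \<kappa>" | "a' = b" "b' = a" "m' = m" | "a = 2" "3 \<le> a'" "p = b'" "q = a'"
      using sd unfolding \<kappa> by auto
    then have "isomorphic (table c ?f) (table c ?g)"
    proof cases
      case 1
      then have "((b, a, m, q), (b', a', m', p)) = \<kappa>" unfolding \<kappa> by simp
      then show ?thesis using g_iso by simp
    next
      case 2
      have "isomorphic (table c ?f) (table c (opA c ((a', b', m', q), (a, b, m, p))))"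
        using isomorphic_swap_vw val c unfolding \<kappa> by blast
      then show ?thesis using isomorphic_trans g_iso unfolding 2 by blast
    next
      case 3
      then have \<kappa>2: "\<kappa> = ((2, 2, 2, p), (a', b', m', q))" using validA_2 val c unfolding \<kappa> by blast
      then have "b = 2" "m = 2" unfolding \<kappa> by simp_all
      have "isomorphic (table c ?f) (table c (opA c ((2, 2, 2, a'), (p, q, m', b'))))"
        unfolding \<kappa>2 by (rule isomorphic_swap_uv(3)) (use val c 3 \<kappa>2 in simp_all)
      then show ?thesis using isomorphic_trans g_iso unfolding 3 \<open>b = 2\<close> \<open>m = 2\<close> by blast
    qed
    then show "isomorphic (table c ?f) (dual (table c ?f))" by (simp only: dual_table)
  qed
qed


section \<open>Two generators\<close>

text \<open>The products \<open>uuv\<close> and \<open>vuu\<close> are kept beside \<open>uv\<close>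
  and \<open>vu\<close> so that products of v with u^k for k >= 2 can be read off without asking
  whether uv or vu is z.\<close>

record valsB =
  uv :: nat
  vu :: nat
  vv :: nat
  uuv :: nat
  vuu :: nat
  uz :: nat
  zu :: nat
  vz :: nat
  zv :: nat
  zz :: nat

definition tabB :: "nat \<Rightarrow> valsB \<Rightarrow> nat \<Rightarrow> nat \<Rightarrow> nat" where
  "tabB c P x y =
    (if x \<le> c + 1 then
       if y \<le> c + 1 then trunc c (x + y)
       else if y = c + 2 then (if x = 1 then uv P else trunc c (x - 2 + uuv P))
       else trunc c (x - 1 + uz P)
     else if x = c + 2 then
       if y \<le> c + 1 then (if y = 1 then vu P else trunc c (y - 2 + vuu P))
       else if y = c + 2 then vv P
       else vz P
     else
       if y \<le> c + 1 then trunc c (y - 1 + zu P)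
       else if y = c + 2 then zv P
       else zz P)"

text \<open>
  The code of a semigroup of type B is $(uv, vu, vv, e)$, where $e$ is $uz = u^2v$ if $uv = z$, otherwise $zu = vu^2$ if
  $vu = z$, and $vz = v^3$ if $vv$ is the only product equal to $z$.
\<close>

definition paramsB :: "nat \<Rightarrow> quad \<Rightarrow> valsB" where
  "paramsB c \<kappa> = (case \<kappa> of (p, q, r, e) \<Rightarrow>
     let Z = c + 3;
         L = (if p = Z then e else trunc c (p + 1));
         R = (if q = Z then e else trunc c (q + 1));
         uz' = (if p = Z \<or> q = Z then L else trunc c (p - 2 + L));
         zu' = (if p = Z \<or> q = Z then R else trunc c (q - 2 + R));
         vz' = (if q = Z then (if r = Z then zu' else trunc c (r + 1))
                else if p = Z then trunc c (q - 2 + L) else e);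
         zv' = (if p = Z then (if r = Z then uz' else trunc c (r + 1))
                else if q = Z then trunc c (p - 2 + R) else e);
         zz' = (if p = Z then trunc c (vz' + 1) else if q = Z then trunc c (zv' + 1)
                else trunc c (e - 2 + R))
     in \<lparr>uv = p, vu = q, vv = r, uuv = L, vuu = R, uz = uz', zu = zu', vz = vz', zv = zv', zz = zz'\<rparr>)"

definition opB :: "nat \<Rightarrow> quad \<Rightarrow> nat \<Rightarrow> nat \<Rightarrow> nat" where
  "opB c \<kappa> = tabB c (paramsB c \<kappa>)"

text \<open>The branches are uv = vu = z, only uv = z, only vu = z (vv being arbitrary so far), and
  vv = z alone. The first uses (vv)u^2 = v(vu^2). If vv is a power, the second uses u^2(vu) = (u^2
  v)u and (vv)u = v(vu), and the third their mirror images. The last uses u(vu) = (uv)u and (uv)z =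
  u(vz). If vv coincides with exactly one of uv and vu, the laws leave only the lowest and the
  highest exponents. The entries of \<open>paramsB\<close> come from such rebracketings too, for
  example uz = u(vv) = (uv)v.\<close>

definition validB :: "nat \<Rightarrow> quad \<Rightarrow> bool" where
  "validB c \<kappa> \<longleftrightarrow> (case \<kappa> of (p, q, r, e) \<Rightarrow>
     let Z = c + 3; N = {2..c + 1} in
     e \<in> {3..c + 1} \<and>
     (if p = Z \<and> q = Z then
        r = Z \<and> trunc c (e + 1) = trunc c (2 * e - 2) \<or> r \<in> N \<and> trunc c (r + 2) = trunc c (2 * e - 2)
      else if p = Z then
        q \<in> N \<and> (r = Z \<and> (q = 2 \<and> e = 3 \<or> c \<le> q \<and> e = c + 1) \<or>
          r \<in> N \<and> trunc c (e + 1) = trunc c (q + 2) \<and> trunc c (r + 1) = trunc c (2 * q - 1))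
      else if q = Z then
        p \<in> N \<and> (r = Z \<and> (p = 2 \<and> e = 3 \<or> c \<le> p \<and> e = c + 1) \<or>
          r \<in> N \<and> trunc c (e + 1) = trunc c (p + 2) \<and> trunc c (r + 1) = trunc c (2 * p - 1))
      else p \<in> N \<and> q \<in> N \<and> r = Z \<and> trunc c (p + 1) = trunc c (q + 1) \<and>
          trunc c (e + 1) = trunc c (3 * p - 2)))"

lemma trunc_eq_iff: "trunc c j = trunc c k \<longleftrightarrow> j = k \<or> c + 1 \<le> j \<and> c + 1 \<le> k"
  by (auto simp: trunc_def)

lemma tabB_simps:
  "1 \<le> i \<Longrightarrow> i \<le> c + 1 \<Longrightarrow> 1 \<le> j \<Longrightarrow> j \<le> c + 1 \<Longrightarrow> tabB c P i j = trunc c (i + j)"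
  "c \<ge> 4 \<Longrightarrow> tabB c P 1 (c + 2) = uv P"
  "2 \<le> i \<Longrightarrow> i \<le> c + 1 \<Longrightarrow> tabB c P i (c + 2) = trunc c (i - 2 + uuv P)"
  "1 \<le> i \<Longrightarrow> i \<le> c + 1 \<Longrightarrow> tabB c P i (c + 3) = trunc c (i - 1 + uz P)"
  "c \<ge> 4 \<Longrightarrow> tabB c P (c + 2) 1 = vu P"
  "2 \<le> i \<Longrightarrow> i \<le> c + 1 \<Longrightarrow> tabB c P (c + 2) i = trunc c (i - 2 + vuu P)"
  "tabB c P (c + 2) (c + 2) = vv P"
  "tabB c P (c + 2) (c + 3) = vz P"
  "1 \<le> i \<Longrightarrow> i \<le> c + 1 \<Longrightarrow> tabB c P (c + 3) i = trunc c (i - 1 + zu P)"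
  "tabB c P (c + 3) (c + 2) = zv P"
  "tabB c P (c + 3) (c + 3) = zz P"
  by (simp_all add: tabB_def)

text \<open>
  The elements $v$ and $z$ get weights \<open>\<alpha>\<close> and \<open>\<zeta>\<close>. If short products respect the weights up to truncation,
  then every product of three elements that involves an element of $S^2$ is determined by the
  total weight, so associativity needs to be checked for generators only.
\<close>

locale weightedB =
  fixes c :: nat and P :: valsB and \<alpha> \<zeta> :: nat
  assumes c: "c \<ge> 4" and pos: "1 \<le> \<alpha>" "2 \<le> \<zeta>"
    and second: "{uv P, vu P, vv P} \<subseteq> insert (c + 3) {2..c + 1}" "c + 3 \<in> {uv P, vu P, vv P}"
    and third: "{uuv P, vuu P, uz P, zu P, vz P, zv P, zz P} \<subseteq> {3..c + 1}"
    and weight_uv: "trunc c ((if uv P = c + 3 then \<zeta> else uv P) + 2) = trunc c (1 + \<alpha> + 2)"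
    and weight_vu: "trunc c ((if vu P = c + 3 then \<zeta> else vu P) + 2) = trunc c (\<alpha> + 1 + 2)"
    and weight_vv: "trunc c ((if vv P = c + 3 then \<zeta> else vv P) + 2) = trunc c (\<alpha> + \<alpha> + 2)"
    and weight_uuv: "trunc c (uuv P + 1) = trunc c (2 + \<alpha> + 1)"
    and weight_vuu: "trunc c (vuu P + 1) = trunc c (\<alpha> + 2 + 1)"
    and weight_uz: "trunc c (uz P + 1) = trunc c (1 + \<zeta> + 1)"
    and weight_zu: "trunc c (zu P + 1) = trunc c (\<zeta> + 1 + 1)"
    and weight_vz: "trunc c (vz P + 1) = trunc c (\<alpha> + \<zeta> + 1)"
    and weight_zv: "trunc c (zv P + 1) = trunc c (\<zeta> + \<alpha> + 1)"
    and weight_zz: "zz P = trunc c (\<zeta> + \<zeta>)"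
    and assoc_uuv: "uuv P = (if uv P = c + 3 then uz P else trunc c (uv P + 1))"
    and assoc_vuu: "vuu P = (if vu P = c + 3 then zu P else trunc c (vu P + 1))"
    and assoc_uvu: "(if uv P = c + 3 then zu P else trunc c (uv P + 1)) =
      (if vu P = c + 3 then uz P else trunc c (vu P + 1))"
    and assoc_uvv: "(if uv P = c + 3 then zv P else trunc c (uv P - 2 + uuv P)) =
      (if vv P = c + 3 then uz P else trunc c (vv P + 1))"
    and assoc_vuv: "(if vu P = c + 3 then zv P else trunc c (vu P - 2 + uuv P)) =
      (if uv P = c + 3 then vz P else trunc c (uv P - 2 + vuu P))"
    and assoc_vvu: "(if vv P = c + 3 then zu P else trunc c (vv P + 1)) =
      (if vu P = c + 3 then vz P else trunc c (vu P - 2 + vuu P))"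
    and assoc_vvv: "(if vv P = c + 3 then zv P else trunc c (vv P - 2 + uuv P)) =
      (if vv P = c + 3 then vz P else trunc c (vv P - 2 + vuu P))"
begin

abbreviation "f \<equiv> tabB c P"
abbreviation "G \<equiv> {1, c + 2}"
abbreviation "N \<equiv> insert (c + 3) {2..c + 1}"

definition w :: "nat \<Rightarrow> nat" where
  "w x = (if x = c + 2 then \<alpha> else if x = c + 3 then \<zeta> else x)"

lemma carrier_cases: "x \<in> {1..c + 3} \<Longrightarrow> x \<in> G \<or> x \<in> N"
  by auto

lemma gens_mul: "x \<in> G \<Longrightarrow> y \<in> G \<Longrightarrow> f x y \<in> N"
  using second c by (auto simp: tabB_def trunc_def)

lemma N_mul: "x \<in> N \<Longrightarrow> y \<in> {1..c + 3} \<Longrightarrow> f x y \<in> {3..c + 1}"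
  using third c by (auto simp: tabB_def trunc_def)

lemma mul_N: "x \<in> {1..c + 3} \<Longrightarrow> y \<in> N \<Longrightarrow> f x y \<in> {3..c + 1}"
  using third c by (auto simp: tabB_def trunc_def)

lemma w_pos: "x \<in> {1..c + 3} \<Longrightarrow> w x \<ge> 1" "x \<in> N \<Longrightarrow> w x \<ge> 2"
  using pos by (auto simp: w_def)

text \<open>With two units of slack, exponents from c - 1 on are not distinguished. Products of at
  least three generators have one unit (\<open>weight_3\<close>), those of at least four have none
  (\<open>weight_4\<close>).\<close>

lemma weight_gens:
  assumes "x \<in> G" "y \<in> G" shows "trunc c (w (f x y) + 2) = trunc c (w x + w y + 2)"
proof -
  have w': "w a = (if a = c + 3 then \<zeta> else a)" if "a \<in> N" for a using that by (auto simp: w_def)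
  have "f 1 1 = 2" using c by (simp add: tabB_def trunc_def)
  moreover have "f 1 (c + 2) = uv P" "f (c + 2) 1 = vu P" "f (c + 2) (c + 2) = vv P"
    using c by (simp_all add: tabB_def)
  moreover have "w 1 = 1" "w 2 = 2" "w (c + 2) = \<alpha>" using c by (simp_all add: w_def)
  moreover have "w (uv P) = (if uv P = c + 3 then \<zeta> else uv P)"
    "w (vu P) = (if vu P = c + 3 then \<zeta> else vu P)" "w (vv P) = (if vv P = c + 3 then \<zeta> else vv P)"
    using second by (intro w', simp)+
  ultimately show ?thesis
    using assms weight_uv weight_vu weight_vv by (elim insertE emptyE) (simp_all only: one_add_one)
qed

lemma Suc_trunc: "trunc c (Suc (trunc c k)) = trunc c (Suc k)"
  by (simp add: trunc_def)

lemma weight_power_3: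
  "2 \<le> k \<Longrightarrow> k \<le> c + 1 \<Longrightarrow> trunc c (f k (c + 2) + 1) = trunc c (k + \<alpha> + 1)"
  "2 \<le> k \<Longrightarrow> k \<le> c + 1 \<Longrightarrow> trunc c (f (c + 2) k + 1) = trunc c (\<alpha> + k + 1)"
  "1 \<le> k \<Longrightarrow> k \<le> c + 1 \<Longrightarrow> trunc c (f k (c + 3) + 1) = trunc c (k + \<zeta> + 1)"
  "1 \<le> k \<Longrightarrow> k \<le> c + 1 \<Longrightarrow> trunc c (f (c + 3) k + 1) = trunc c (\<zeta> + k + 1)"
  subgoal using weight_uuv by (auto simp: tabB_def Suc_trunc trunc_eq_iff)
  subgoal using weight_vuu by (auto simp: tabB_def Suc_trunc trunc_eq_iff)
  subgoal using weight_uz by (auto simp: tabB_def Suc_trunc trunc_eq_iff)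
  subgoal using weight_zu by (auto simp: tabB_def Suc_trunc trunc_eq_iff)
  done

lemma weight_power_4:
  "3 \<le> k \<Longrightarrow> k \<le> c + 1 \<Longrightarrow> f k (c + 2) = trunc c (k + \<alpha>)"
  "3 \<le> k \<Longrightarrow> k \<le> c + 1 \<Longrightarrow> f (c + 2) k = trunc c (\<alpha> + k)"
  "2 \<le> k \<Longrightarrow> k \<le> c + 1 \<Longrightarrow> f k (c + 3) = trunc c (k + \<zeta>)"
  "2 \<le> k \<Longrightarrow> k \<le> c + 1 \<Longrightarrow> f (c + 3) k = trunc c (\<zeta> + k)"
  subgoal using weight_uuv by (auto simp: tabB_def trunc_eq_iff)
  subgoal using weight_vuu by (auto simp: tabB_def trunc_eq_iff)
  subgoal using weight_uz by (auto simp: tabB_def trunc_eq_iff)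
  subgoal using weight_zu by (auto simp: tabB_def trunc_eq_iff)
  done

lemma w_simps: "w (c + 2) = \<alpha>" "w (c + 3) = \<zeta>" "k \<le> c + 1 \<Longrightarrow> w k = k"
  by (simp_all add: w_def)

lemma weight_3:
  assumes "x \<in> {1..c + 3}" "y \<in> N"
  shows "trunc c (f x y + 1) = trunc c (w x + w y + 1)" "trunc c (f y x + 1) = trunc c (w y + w x + 1)"
proof -
  have y: "y = c + 3 \<or> 2 \<le> y \<and> y \<le> c + 1" using assms(2) by auto
  have x: "x = c + 2 \<or> x = c + 3 \<or> 1 \<le> x \<and> x \<le> c + 1" using assms(1) by auto
  have zz: "f (c + 3) (c + 3) = trunc c (\<zeta> + \<zeta>)" "f (c + 2) (c + 3) = vz P" "f (c + 3) (c + 2) = zv P"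
    using weight_zz by (simp_all add: tabB_def)
  have pow: "f x y = trunc c (x + y)" "f y x = trunc c (y + x)" if "1 \<le> x" "x \<le> c + 1" "2 \<le> y" "y \<le> c + 1"
    using that by (simp_all add: tabB_def)
  have *: "trunc c (trunc c k + 1) = trunc c (k + 1)" for k using Suc_trunc by simp
  show "trunc c (f x y + 1) = trunc c (w x + w y + 1)"
    using x y
    by (elim disjE conjE) (simp_all only: w_simps weight_power_3 pow zz weight_vz weight_zv *)
  show "trunc c (f y x + 1) = trunc c (w y + w x + 1)"
    using x y
    by (elim disjE conjE) (simp_all only: w_simps weight_power_3 pow zz weight_vz weight_zv *)
qed

lemma weight_4:
  assumes "x \<in> N" "y \<in> N \<or> x \<in> {3..c + 1} \<and> y \<in> {1..c + 3}"
  shows "f x y = trunc c (w x + w y)" "f y x = trunc c (w y + w x)"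
proof -
  have xy: "x = c + 3 \<and> y = c + 3 \<or> x = c + 3 \<and> 2 \<le> y \<and> y \<le> c + 1 \<or> 2 \<le> x \<and> x \<le> c + 1 \<and> y = c + 3 \<or>
      2 \<le> x \<and> x \<le> c + 1 \<and> 1 \<le> y \<and> y \<le> c + 1 \<or> 3 \<le> x \<and> x \<le> c + 1 \<and> y = c + 2"
    using assms by auto
  have zz: "f (c + 3) (c + 3) = trunc c (\<zeta> + \<zeta>)" using weight_zz by (simp add: tabB_def)
  have pow: "f x y = trunc c (x + y)" "f y x = trunc c (y + x)" if "2 \<le> x" "x \<le> c + 1" "1 \<le> y" "y \<le> c + 1"
    using that by (simp_all add: tabB_def)
  show "f x y = trunc c (w x + w y)"
    using xy by (elim disjE conjE) (simp_all only: w_simps weight_power_4 pow zz)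
  show "f y x = trunc c (w y + w x)"
    using xy by (elim disjE conjE) (simp_all only: w_simps weight_power_4 pow zz)
qed

text \<open>A triple with a factor in S^2 has length at least four, so its value is exact. The outer
  factor absorbs the slack of the inner product: weight 1 suffices if that has length three, and
  otherwise the outer factor lies in S^2 and has weight at least 2.\<close>

lemma triple:
  assumes "x \<in> {1..c + 3}" "y \<in> {1..c + 3}" "z \<in> {1..c + 3}" "x \<in> N \<or> y \<in> N \<or> z \<in> N"
  shows "f (f x y) z = trunc c (w x + w y + w z)" "f x (f y z) = trunc c (w x + w y + w z)"
proof -
  have w3: "w k = k" if "k \<in> {3..c + 1}" for k using that by (auto simp: w_def)
  have N3: "k \<in> N" if "k \<in> {3..c + 1}" for k using that by auto
  show "f (f x y) z = trunc c (w x + w y + w z)"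
  proof (cases "x \<in> N \<or> y \<in> N")
    case True
    then have xy: "f x y \<in> {3..c + 1}" "trunc c (f x y + 1) = trunc c (w x + w y + 1)"
      using N_mul mul_N weight_3 assms by auto
    have "f (f x y) z = trunc c (f x y + w z)"
      using weight_4(1)[of "f x y" z] N3[OF xy(1)] w3[OF xy(1)] xy(1) assms(3) by simp
    then show ?thesis using trunc_add_cong[OF xy(2) w_pos(1)[OF assms(3)]] by simp
  next
    case False
    then have z: "z \<in> N" and xy: "x \<in> G" "y \<in> G" using assms carrier_cases by blast+
    have "f (f x y) z = trunc c (w (f x y) + w z)"
      by (rule weight_4(1)[OF gens_mul[OF xy] disjI1[OF z]])
    also have "\<dots> = trunc c (w x + w y + w z)"
      using trunc_add_cong[of c "w (f x y) + 1" "w x + w y + 1" "w z - 1"] weight_gens[OF xy] w_pos(2)[OF z]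
      by simp
    finally show ?thesis .
  qed
  show "f x (f y z) = trunc c (w x + w y + w z)"
  proof (cases "y \<in> N \<or> z \<in> N")
    case True
    then have yz: "f y z \<in> {3..c + 1}" "trunc c (f y z + 1) = trunc c (w y + w z + 1)"
      using N_mul mul_N weight_3 assms by auto
    have "f x (f y z) = trunc c (f y z + w x)"
      using weight_4(2)[of "f y z" x] N3[OF yz(1)] w3[OF yz(1)] yz(1) assms(1) by (simp add: add.commute)
    then show ?thesis using trunc_add_cong[OF yz(2) w_pos(1)[OF assms(1)]] by (simp add: ac_simps)
  next
    case False
    then have x: "x \<in> N" and yz: "y \<in> G" "z \<in> G" using assms carrier_cases by blast+
    have "f x (f y z) = trunc c (w (f y z) + w x)"
      using weight_4(2)[OF gens_mul[OF yz] disjI1[OF x]] by (simp only: add.commute)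
    also have "\<dots> = trunc c (w y + w z + w x)"
      using trunc_add_cong[of c "w (f y z) + 1" "w y + w z + 1" "w x - 1"] weight_gens[OF yz] w_pos(2)[OF x]
      by simp
    finally show ?thesis by (simp add: ac_simps)
  qed
qed

text \<open>For three generators the weights leave too much slack. Apart from uuu, the eight laws
  are taken from the locale one by one.\<close>

lemma gens_assoc:
  assumes "x \<in> G" "y \<in> G" "z \<in> G" shows "f (f x y) z = f x (f y z)"
proof -
  have f1: "f 1 1 = 2" "f 1 (c + 2) = uv P" "f (c + 2) 1 = vu P" "f (c + 2) (c + 2) = vv P"
    "f 2 1 = f 1 2" "f 2 (c + 2) = uuv P" "f (c + 2) 2 = vuu P"
    using c third by (auto simp: tabB_def trunc_def)
  have f1a: "f 1 a = (if a = c + 3 then uz P else trunc c (a + 1))"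
      "f a 1 = (if a = c + 3 then zu P else trunc c (a + 1))"
      "f a (c + 2) = (if a = c + 3 then zv P else trunc c (a - 2 + uuv P))"
      "f (c + 2) a = (if a = c + 3 then vz P else trunc c (a - 2 + vuu P))" if "a \<in> N" for a
    using that third c by (auto simp: tabB_def trunc_def)
  have N: "uv P \<in> N" "vu P \<in> N" "vv P \<in> N" using second by auto
  show ?thesis
    using assms
    by (elim insertE emptyE)
      (simp_all only: f1 f1a[OF N(1)] f1a[OF N(2)] f1a[OF N(3)] assoc_uuv[symmetric] assoc_vuu[symmetric]
        assoc_uvu assoc_uvv assoc_vuv assoc_vvu assoc_vvv)
qed

lemma frameB: "frameB c f"
proof -
  have "f x y \<in> {1..c + 3}" if "x \<in> {1..c + 3}" "y \<in> {1..c + 3}" for x y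
    using carrier_cases[OF that(1)] carrier_cases[OF that(2)] gens_mul[of x y] N_mul[of x y] mul_N[of x y] that by auto
  moreover have "f (f x y) z = f x (f y z)" if "x \<in> {1..c + 3}" "y \<in> {1..c + 3}" "z \<in> {1..c + 3}" for x y z
  proof (cases "x \<in> N \<or> y \<in> N \<or> z \<in> N")
    case True
    then show ?thesis using triple[OF that] by simp
  next
    case False
    then have "x \<in> G" "y \<in> G" "z \<in> G" using that carrier_cases by blast+
    then show ?thesis by (rule gens_assoc)
  qed
  ultimately have "is_semigroup (table c f)" by (rule is_semigroup_tableI)
  then have "power_table c f" by (simp add: power_table_def tabB_simps)
  moreover have "f x y \<in> N" if "x \<in> {1..c + 3}" "y \<in> {1..c + 3}" for x y
    using carrier_cases[OF that(1)] carrier_cases[OF that(2)] gens_mul[of x y] N_mul[of x y] mul_N[of x y] that by auto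
  moreover have "\<exists>x\<in>G. \<exists>y\<in>G. f x y = c + 3"
  proof -
    have "f 1 (c + 2) = uv P" "f (c + 2) 1 = vu P" "f (c + 2) (c + 2) = vv P"
      using c by (simp_all add: tabB_def)
    then show ?thesis using second(2) by fastforce
  qed
  ultimately show ?thesis unfolding frameB_def using N_mul mul_N by blast
qed

end

text \<open>The lemmas from here on provide weights for all families of valid codes. The digit 1
  stands for uv = vu = z, 2 for uv = z with vu a power, 4 for vv = z alone. The weight of z is
  \<alpha> + 1 if z = uv and 2 \<alpha> if only vv = z. In the \<open>low\<close> families the
  exponents equal the weights; in the \<open>mid\<close> and \<open>high\<close> ones some exponents
  are so large that they may deviate.\<close>

lemma weightedB_1_special:
  assumes "c \<ge> 4" shows "weightedB c (paramsB c (c + 3, c + 3, c + 3, 3)) 1 2"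
  by (unfold_locales; insert assms; simp add: paramsB_def Let_def trunc_def)

lemma weightedB_2_special:
  assumes "c \<ge> 4" shows "weightedB c (paramsB c (c + 3, 2, c + 3, 3)) 1 2"
  by (unfold_locales; insert assms; simp add: paramsB_def Let_def trunc_def)

lemma weightedB_1_top:
  assumes "c \<ge> 4" "c \<le> \<alpha> + 2" "\<alpha> + 1 \<le> c"
  shows "weightedB c (paramsB c (c + 3, c + 3, c + 3, \<alpha> + 2)) \<alpha> (\<alpha> + 1)"
  by (unfold_locales; insert assms; simp add: paramsB_def Let_def trunc_eq_iff; (auto simp: trunc_def)?)

lemma weightedB_1_low:
  assumes "c \<ge> 4" "1 \<le> \<alpha>" "\<alpha> + 1 \<le> c" "2 * \<alpha> \<le> c + 1"
  shows "weightedB c (paramsB c (c + 3, c + 3, 2 * \<alpha>, \<alpha> + 2)) \<alpha> (\<alpha> + 1)"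
  by (unfold_locales; insert assms; simp add: paramsB_def Let_def trunc_eq_iff; (auto simp: trunc_def)?)

lemma weightedB_1_high:
  assumes "c \<ge> 4" "\<alpha> + 1 \<le> c" "c \<le> r + 1" "r \<le> c + 1" "c \<le> 2 * \<alpha> + 1"
  shows "weightedB c (paramsB c (c + 3, c + 3, r, \<alpha> + 2)) \<alpha> (\<alpha> + 1)"
  by (unfold_locales; insert assms; simp add: paramsB_def Let_def trunc_eq_iff; (auto simp: trunc_def)?)

lemma weightedB_2_top:
  assumes "c \<ge> 4" "c \<le> \<alpha> + 1" "\<alpha> \<le> c"
  shows "weightedB c (paramsB c (c + 3, \<alpha> + 1, c + 3, c + 1)) \<alpha> (\<alpha> + 1)"
  by (unfold_locales; insert assms; simp add: paramsB_def Let_def trunc_eq_iff; (auto simp: trunc_def)?)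

lemma weightedB_2_low:
  assumes "c \<ge> 4" "1 \<le> \<alpha>" "\<alpha> + 1 \<le> c" "2 * \<alpha> \<le> c + 1"
  shows "weightedB c (paramsB c (c + 3, \<alpha> + 1, 2 * \<alpha>, \<alpha> + 2)) \<alpha> (\<alpha> + 1)"
  by (unfold_locales; insert assms; simp add: paramsB_def Let_def trunc_eq_iff; (auto simp: trunc_def)?)

lemma weightedB_2_mid:
  assumes "c \<ge> 4" "\<alpha> + 1 \<le> c" "c \<le> r" "r \<le> c + 1" "c \<le> 2 * \<alpha>"
  shows "weightedB c (paramsB c (c + 3, \<alpha> + 1, r, \<alpha> + 2)) \<alpha> (\<alpha> + 1)"
  by (unfold_locales; insert assms; simp add: paramsB_def Let_def trunc_eq_iff; (auto simp: trunc_def)?)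

lemma weightedB_2_high:
  assumes "c \<ge> 4" "\<alpha> \<le> c" "c \<le> e" "e \<le> c + 1" "c \<le> \<alpha> + 2" "c \<le> r" "r \<le> c + 1"
  shows "weightedB c (paramsB c (c + 3, \<alpha> + 1, r, e)) \<alpha> (\<alpha> + 1)"
  by (unfold_locales; insert assms; simp add: paramsB_def Let_def trunc_eq_iff; (auto simp: trunc_def)?)

lemma weightedB_4_low:
  assumes "c \<ge> 4" "1 \<le> \<alpha>" "3 * \<alpha> \<le> c + 1"
  shows "weightedB c (paramsB c (\<alpha> + 1, \<alpha> + 1, c + 3, 3 * \<alpha>)) \<alpha> (2 * \<alpha>)"
  by (unfold_locales; insert assms; simp add: paramsB_def Let_def trunc_eq_iff; (auto simp: trunc_def)?)

lemma weightedB_4_mid: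
  assumes "c \<ge> 4" "1 \<le> \<alpha>" "\<alpha> \<le> c" "c \<le> e" "e \<le> c + 1" "c \<le> 3 * \<alpha>"
  shows "weightedB c (paramsB c (\<alpha> + 1, \<alpha> + 1, c + 3, e)) \<alpha> (2 * \<alpha>)"
  by (unfold_locales; insert assms; simp add: paramsB_def Let_def trunc_eq_iff; (auto simp: trunc_def)?)

lemma weightedB_4_high:
  assumes "c \<ge> 4" "c \<le> \<alpha> + 1" "\<alpha> \<le> c" "c \<le> e" "e \<le> c + 1" "c \<le> q" "q \<le> c + 1"
  shows "weightedB c (paramsB c (\<alpha> + 1, q, c + 3, e)) \<alpha> (2 * \<alpha>)"
  by (unfold_locales; insert assms; simp add: paramsB_def Let_def trunc_eq_iff; (auto simp: trunc_def)?)

lemma tabB_flip: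
  "tabB c \<lparr>uv = vu P, vu = uv P, vv = vv P, uuv = vuu P, vuu = uuv P, uz = zu P, zu = uz P,
     vz = zv P, zv = vz P, zz = zz P\<rparr> y x = tabB c P x y"
  by (auto simp: tabB_def add.commute)

lemma validB_swap: "validB c (p, q, r, e) \<Longrightarrow> validB c (q, p, r, e)"
  by (auto simp: validB_def Let_def trunc_eq_iff split: if_splits)

text \<open>If only vv = z, the entry \<open>zz\<close> is computed from vu, after the swap from uv;
  validity makes the two values equal.\<close>

lemma paramsB_swap:
  assumes "validB c (p, q, r, e)"
  shows "paramsB c (q, p, r, e) = (let P = paramsB c (p, q, r, e) in
    \<lparr>uv = vu P, vu = uv P, vv = vv P, uuv = vuu P, vuu = uuv P, uz = zu P, zu = uz P,
     vz = zv P, zv = vz P, zz = zz P\<rparr>)"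
  using assms by (auto simp: validB_def paramsB_def Let_def)

lemma opB_swap:
  assumes "validB c (p, q, r, e)" shows "opB c (q, p, r, e) y x = opB c (p, q, r, e) x y"
  unfolding opB_def paramsB_swap[OF assms] Let_def by (rule tabB_flip)

lemma frameB_flip:
  assumes "frameB c f" shows "frameB c (\<lambda>x y. f y x)"
proof -
  have "is_semigroup (table c f)" using assms by (simp add: frameB_def power_table_def)
  then have "is_semigroup (table c (\<lambda>x y. f y x))"
    by (intro is_semigroup_tableI) (auto simp: is_semigroup_def simp del: atLeastAtMost_iff)
  then show ?thesis using assms unfolding frameB_def power_table_def by (auto simp: add.commute)
qed

text \<open>Each valid code fits a weighted family. Codes with vu = z and uv a power are reversals
  of codes with uv = z and vu a power.\<close>

lemma frameB_opB:
  assumes c: "c \<ge> 4" and val: "validB c \<kappa>" shows "frameB c (opB c \<kappa>)"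
proof -
  have frame: "frameB c (opB c \<kappa>)" if "weightedB c (paramsB c \<kappa>) \<alpha> \<zeta>" for \<kappa> \<alpha> \<zeta>
    unfolding opB_def using that by (rule weightedB.frameB)
  have second_family: "frameB c (opB c (c + 3, q, r, e))" if val: "validB c (c + 3, q, r, e)" and q: "q \<noteq> c + 3" for q r e
  proof -
    have "2 \<le> q" "q \<le> c + 1" using val q by (auto simp: validB_def Let_def)
    moreover define \<alpha> where "\<alpha> = q - 1"
    ultimately have \<alpha>: "q = \<alpha> + 1" "1 \<le> \<alpha>" "\<alpha> \<le> c" by simp_all
    have "r = c + 3 \<and> (q = 2 \<and> e = 3 \<or> c \<le> q \<and> e = c + 1) \<or>
      2 \<le> r \<and> r \<le> c + 1 \<and> (e = \<alpha> + 2 \<or> c \<le> e \<and> c \<le> \<alpha> + 2) \<and> (r = 2 * \<alpha> \<or> c \<le> r \<and> c \<le> 2 * \<alpha>)"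
      and e: "3 \<le> e" "e \<le> c + 1"
      using val q unfolding \<alpha> by (auto simp: validB_def trunc_eq_iff)
    then consider "r = c + 3" "q = 2" "e = 3" | "r = c + 3" "c \<le> q" "e = c + 1"
      | "r \<le> c + 1" "e = \<alpha> + 2" "r = 2 * \<alpha>" | "r \<le> c + 1" "e = \<alpha> + 2" "c \<le> r" "c \<le> 2 * \<alpha>"
      | "r \<le> c + 1" "c \<le> e" "c \<le> \<alpha> + 2" "r = 2 * \<alpha> \<or> c \<le> r"
      by blast
    then show ?thesis
    proof cases
      case 1
      then show ?thesis using frame weightedB_2_special[OF c] by simp
    next
      case 2
      then show ?thesis using frame[OF weightedB_2_top[of c \<alpha>]] c \<alpha> by simp
    next
      case 3
      then show ?thesis using frame[OF weightedB_2_low[of c \<alpha>]] c \<alpha> e by simp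
    next
      case 4
      then show ?thesis using frame[OF weightedB_2_mid[of c \<alpha> r]] c \<alpha> e by simp
    next
      case 5
      then show ?thesis using frame[OF weightedB_2_high[of c \<alpha> e r]] c \<alpha> e by auto
    qed
  qed
  obtain p q r e where \<kappa>: "\<kappa> = (p, q, r, e)" by (metis surj_pair)
  have e: "3 \<le> e" "e \<le> c + 1" using val unfolding \<kappa> by (auto simp: validB_def Let_def)
  consider (B1) "p = c + 3" "q = c + 3" | (B2) "p = c + 3" "q \<noteq> c + 3" | (B3) "p \<noteq> c + 3" "q = c + 3"
    | (B4) "p \<noteq> c + 3" "q \<noteq> c + 3" by blast
  then show ?thesis
  proof cases
    case B1
    \<comment> \<open>The product uz = u(uv) has exponent e and weight \<alpha> + 2.\<close>
    define \<alpha> where "\<alpha> = e - 2"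
    then have \<alpha>: "e = \<alpha> + 2" "1 \<le> \<alpha>" "\<alpha> + 1 \<le> c" using e by simp_all
    then have "r = c + 3 \<and> (e = 3 \<or> c \<le> e) \<or>
       2 \<le> r \<and> r \<le> c + 1 \<and> (r = 2 * \<alpha> \<or> c \<le> r + 1 \<and> c \<le> 2 * \<alpha> + 1)"
      using val e c unfolding \<kappa> B1 \<alpha> by (auto simp: validB_def trunc_eq_iff)
    then consider "r = c + 3" "e = 3" | "r = c + 3" "c \<le> e" | "r \<le> c + 1" "r = 2 * \<alpha>"
      | "r \<le> c + 1" "c \<le> r + 1" "c \<le> 2 * \<alpha> + 1" by blast
    then show ?thesis
    proof cases
      case 1
      then show ?thesis using frame[OF weightedB_1_special[OF c]] unfolding \<kappa> B1 by simp
    next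
      case 2
      then show ?thesis using frame[OF weightedB_1_top[of c \<alpha>]] c \<alpha> unfolding \<kappa> B1 by simp
    next
      case 3
      then show ?thesis using frame[OF weightedB_1_low[of c \<alpha>]] c \<alpha> unfolding \<kappa> B1 by simp
    next
      case 4
      then show ?thesis using frame[OF weightedB_1_high[of c \<alpha> r]] c \<alpha> unfolding \<kappa> B1 by simp
    qed
  next
    case B2
    then show ?thesis using second_family val unfolding \<kappa> by blast
  next
    case B3
    have "frameB c (opB c (c + 3, p, r, e))"
      by (rule second_family[OF validB_swap]) (use val B3 in \<open>simp_all add: \<kappa>\<close>)
    moreover have "opB c (p, c + 3, r, e) = (\<lambda>x y. opB c (c + 3, p, r, e) y x)"
      using opB_swap[of c p "c + 3" r e] val unfolding \<kappa> B3 by (intro ext) simp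
    ultimately show ?thesis using frameB_flip unfolding \<kappa> B3 by simp
  next
    case B4
    have "2 \<le> p" "p \<le> c + 1" using val B4 unfolding \<kappa> by (auto simp: validB_def Let_def)
    moreover define \<alpha> where "\<alpha> = p - 1"
    ultimately have \<alpha>: "p = \<alpha> + 1" "1 \<le> \<alpha>" "\<alpha> \<le> c" by simp_all
    have h: "r = c + 3" "2 \<le> q" "q \<le> c + 1" "q = \<alpha> + 1 \<or> c \<le> \<alpha> + 1 \<and> c \<le> q"
        "e = 3 * \<alpha> \<or> c \<le> e \<and> c \<le> 3 * \<alpha>"
      using val B4 e unfolding \<kappa> \<alpha> by (auto simp: validB_def trunc_eq_iff)
    then consider "e = 3 * \<alpha>" "q = \<alpha> + 1" | "c \<le> e" "c \<le> 3 * \<alpha>" "q = \<alpha> + 1"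
      | "c \<le> e" "c \<le> \<alpha> + 1" "c \<le> q" using c e by linarith
    then show ?thesis
    proof cases
      case 1
      then show ?thesis using frame[OF weightedB_4_low[of c \<alpha>]] c \<alpha> e h(1) unfolding \<kappa> by simp
    next
      case 2
      then show ?thesis using frame[OF weightedB_4_mid[of c \<alpha> e]] c \<alpha> e h(1) unfolding \<kappa> by simp
    next
      case 3
      then show ?thesis using frame[OF weightedB_4_high[of c \<alpha> e q]] c \<alpha> e h unfolding \<kappa> by simp
    qed
  qed
qed

definition codeB :: "nat \<Rightarrow> (nat \<Rightarrow> nat \<Rightarrow> nat) \<Rightarrow> quad" where
  "codeB c f = (f 1 (c + 2), f (c + 2) 1, f (c + 2) (c + 2),
     if f 1 (c + 2) = c + 3 then f 1 (c + 3) else if f (c + 2) 1 = c + 3 then f (c + 3) 1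
     else f (c + 2) (c + 3))"

text \<open>The semigroup is replaced by its ten products, and the hypotheses are instances of
  associativity: \<open>e1\<close> to \<open>e7\<close> for generators, \<open>z1\<close> to
  \<open>z3\<close> for zz with one factor z written as a product, \<open>c1\<close> to
  \<open>c3\<close> for longer products. What remains is arithmetic.\<close>

lemma paramsB_arith:
  assumes "c \<ge> 4" and N: "{p, q, r} \<subseteq> insert (c + 3) {2..c + 1}" "c + 3 \<in> {p, q, r}"
    "{uz', zu', vz'} \<subseteq> {3..c + 1}"
    and e1: "L = (if p = c + 3 then uz' else trunc c (p + 1))"
    and e2: "R = (if q = c + 3 then zu' else trunc c (q + 1))"
    and e3: "(if p = c + 3 then zu' else trunc c (p + 1)) = (if q = c + 3 then uz' else trunc c (q + 1))"
    and e4: "(if p = c + 3 then zv' else trunc c (p - 2 + L)) = (if r = c + 3 then uz' else trunc c (r + 1))"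
    and e5: "(if q = c + 3 then zv' else trunc c (q - 2 + L)) = (if p = c + 3 then vz' else trunc c (p - 2 + R))"
    and e6: "(if r = c + 3 then zu' else trunc c (r + 1)) = (if q = c + 3 then vz' else trunc c (q - 2 + R))"
    and e7: "r = c + 3 \<Longrightarrow> zv' = vz'"
    and z1: "p = c + 3 \<Longrightarrow> zz' = trunc c (vz' + 1)"
    and z2: "q = c + 3 \<Longrightarrow> zz' = trunc c (zv' + 1)"
    and z3: "r = c + 3 \<Longrightarrow> zz' = trunc c (vz' - 2 + R)"
    and c1: "q \<noteq> c + 3 \<Longrightarrow> trunc c (q + 2) = trunc c (L + 1)"
    and c1': "p \<noteq> c + 3 \<Longrightarrow> trunc c (p + 2) = trunc c (R + 1)"
    and c2: "(if r = c + 3 then trunc c (zu' + 1) else trunc c (r + 2)) = trunc c (R - 2 + R)"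
    and c3: "p \<noteq> c + 3 \<Longrightarrow> trunc c (vz' + 1) = trunc c (p - 1 + uz')"
  defines "\<kappa> \<equiv> (p, q, r, if p = c + 3 then uz' else if q = c + 3 then zu' else vz')"
  shows "validB c \<kappa>"
    and "\<lparr>uv = p, vu = q, vv = r, uuv = L, vuu = R, uz = uz', zu = zu', vz = vz', zv = zv', zz = zz'\<rparr> = paramsB c \<kappa>"
proof -
  consider (B1) "p = c + 3" "q = c + 3" | (B2) "p = c + 3" "q \<noteq> c + 3" | (B3) "p \<noteq> c + 3" "q = c + 3"
    | (B4) "p \<noteq> c + 3" "q \<noteq> c + 3" "r = c + 3" using N(2) by blast
  then show "\<lparr>uv = p, vu = q, vv = r, uuv = L, vuu = R, uz = uz', zu = zu', vz = vz', zv = zv', zz = zz'\<rparr> = paramsB c \<kappa>"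
  proof cases
    case B1
    then show ?thesis
      using e1 e2 e3 e4 e6 z1 unfolding \<kappa>_def by (cases "r = c + 3") (simp_all add: paramsB_def Let_def)
  next
    case B2
    then show ?thesis using e1 e2 e3 e4 e5 z1 unfolding \<kappa>_def by (simp add: paramsB_def Let_def)
  next
    case B3
    then show ?thesis
      using e1 e2 e3 e5 e6 z2 unfolding \<kappa>_def by (cases "r = c + 3") (simp_all add: paramsB_def Let_def)
  next
    case B4
    then show ?thesis using e1 e2 e4 e6 e7 z3 unfolding \<kappa>_def by (simp add: paramsB_def Let_def)
  qed
  consider (B1) "p = c + 3" "q = c + 3" | (B2) "p = c + 3" "q \<noteq> c + 3" | (B3) "p \<noteq> c + 3" "q = c + 3"
    | (B4) "p \<noteq> c + 3" "q \<noteq> c + 3" "r = c + 3" using N(2) by blast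
  then show "validB c \<kappa>"
  proof cases
    case B1
    then have "L = uz'" "R = uz'" "zu' = uz'" using e1 e2 e3 by simp_all
    then show ?thesis using B1 N c2 unfolding \<kappa>_def by (auto simp: validB_def Let_def mult_2 split: if_splits)
  next
    case B2
    have q: "2 \<le> q" "q \<le> c + 1" and r: "r = c + 3 \<or> 2 \<le> r \<and> r \<le> c + 1" using B2 N by auto
    have L: "L = uz'" "R = trunc c (q + 1)" "zu' = trunc c (q + 1)" using B2 e1 e2 e3 by simp_all
    have "trunc c (q - 2 + R) = trunc c (q - 2 + (q + 1))" unfolding L(2) by (simp add: trunc_def)
    moreover have "q - 2 + (q + 1) = 2 * q - 1" using q by simp
    ultimately have dbl: "trunc c (q - 2 + R) = trunc c (2 * q - 1)" by (simp only:)
    have c1': "trunc c (uz' + 1) = trunc c (q + 2)" using c1 B2 L by simp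
    show ?thesis
    proof (cases "r = c + 3")
      case True
      have "trunc c (q + 1) = trunc c (2 * q - 1)" using e6 B2 L True dbl by simp
      moreover have "uz' = trunc c (q - 2 + uz')" using e4 e5 e7 B2 L True by simp
      \<comment> \<open>The equations say q = 2 or q >= c, and q = 2 or uz = 0 (exponent c + 1). For
        q = 2 the congruence \<open>c1'\<close> gives exponent 3.\<close>
      ultimately have "q = 2 \<and> uz' = 3 \<or> c \<le> q \<and> uz' = c + 1"
        using c1' q assms(1) by (auto simp: trunc_def split: if_splits)
      then show ?thesis using B2 True N q unfolding \<kappa>_def by (auto simp: validB_def Let_def)
    next
      case False
      then have "trunc c (r + 1) = trunc c (2 * q - 1)" using e6 B2 L dbl by simp
      then show ?thesis using B2 False N q r c1' unfolding \<kappa>_def by (simp add: validB_def Let_def)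
    qed
  next
    case B3
    have p: "2 \<le> p" "p \<le> c + 1" and r: "r = c + 3 \<or> 2 \<le> r \<and> r \<le> c + 1" using B3 N by auto
    have L: "R = zu'" "L = trunc c (p + 1)" "uz' = trunc c (p + 1)" using B3 e1 e2 e3 by simp_all
    have "trunc c (p - 2 + L) = trunc c (p - 2 + (p + 1))" unfolding L(2) by (simp add: trunc_def)
    moreover have "p - 2 + (p + 1) = 2 * p - 1" using p by simp
    ultimately have dbl: "trunc c (p - 2 + L) = trunc c (2 * p - 1)" by (simp only:)
    have c1'': "trunc c (zu' + 1) = trunc c (p + 2)" using c1' B3 L by simp
    show ?thesis
    proof (cases "r = c + 3")
      case True
      have "trunc c (p + 1) = trunc c (2 * p - 1)" using e4 B3 L True dbl by simp
      moreover have "zu' = trunc c (p - 2 + zu')" using e5 e6 e7 B3 L True by simp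
      ultimately have "p = 2 \<and> zu' = 3 \<or> c \<le> p \<and> zu' = c + 1"
        using c1'' p assms(1) by (auto simp: trunc_def split: if_splits)
      then show ?thesis using B3 True N p unfolding \<kappa>_def by (auto simp: validB_def Let_def)
    next
      case False
      then have "trunc c (r + 1) = trunc c (2 * p - 1)" using e4 B3 L dbl by simp
      then show ?thesis using B3 False N p r c1'' unfolding \<kappa>_def by (simp add: validB_def Let_def)
    qed
  next
    case B4
    have pq: "2 \<le> q" "q \<le> c + 1" "2 \<le> p" "p \<le> c + 1" using B4 N by auto
    have "L = trunc c (p + 1)" "uz' = trunc c (p - 2 + L)" using B4 e1 e4 by simp_all
    moreover have "trunc c (k + trunc c j) = trunc c (k + j)" for j k by (simp add: trunc_def)
    \<comment> \<open>u(vz) = u^p z = u^(p-1)(uz), where uz = (uv)v = u^(p-2)(u^2 v) and u^2 v =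
      u(uv).\<close>
    ultimately have "trunc c (vz' + 1) = trunc c (p - 1 + (p - 2 + (p + 1)))" using c3 B4 by simp
    moreover have "p - 1 + (p - 2 + (p + 1)) = 3 * p - 2" using pq by simp
    ultimately have "trunc c (vz' + 1) = trunc c (3 * p - 2)" by (simp only:)
    then show ?thesis using B4 N pq e3 unfolding \<kappa>_def by (simp add: validB_def Let_def)
  qed
qed

section \<open>Every frame of type B comes from a valid code\<close>

locale frB =
  fixes c :: nat and f :: "nat \<Rightarrow> nat \<Rightarrow> nat"
  assumes c: "c \<ge> 4" and frame: "frameB c f"
begin

abbreviation "N \<equiv> insert (c + 3) {2..c + 1}"

lemma pt: "power_table c f"
  using frame by (simp add: frameB_def)

lemmas mul = power_table_mul[OF pt]
lemmas as = power_table_assoc[OF pt]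

lemma ran_N: "x \<in> {1..c + 3} \<Longrightarrow> y \<in> {1..c + 3} \<Longrightarrow> f x y \<in> N"
  using frame unfolding frameB_def by blast

lemma ran_3: "x \<in> N \<Longrightarrow> y \<in> {1..c + 3} \<Longrightarrow> f x y \<in> {3..c + 1}"
  "x \<in> N \<Longrightarrow> y \<in> {1..c + 3} \<Longrightarrow> f y x \<in> {3..c + 1}"
  using frame unfolding frameB_def by blast+

lemma trunc_3: "k \<in> {3..c + 1} \<Longrightarrow> trunc c k = k"
  by (simp add: trunc_def)

text \<open>The recursion starts at u^2 v because uv may be z, whereas u^2 v lies in S^3 and is a
  power of u.\<close>

lemma left_v:
  assumes "2 \<le> k" "k \<le> c + 1" shows "f k (c + 2) = trunc c (k - 2 + f 2 (c + 2))"
proof (cases "k = 2")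
  case True
  then show ?thesis using trunc_3[of "f 2 (c + 2)"] ran_3(1)[of 2 "c + 2"] c by simp
next
  case False
  then have k: "k - 2 \<in> {1..c + 3}" using assms by auto
  have "f (k - 2) 2 = k" using mul[of "k - 2" 2] assms False c by (auto simp: trunc_def)
  then have "f k (c + 2) = f (f (k - 2) 2) (c + 2)" by simp
  also have "\<dots> = f (k - 2) (f 2 (c + 2))" using as[OF k, of 2 "c + 2"] by simp
  also have "\<dots> = trunc c (k - 2 + f 2 (c + 2))"
    using mul[of "k - 2" "f 2 (c + 2)"] ran_3(1)[of 2 "c + 2"] assms False c by simp
  finally show ?thesis .
qed

lemma left_z:
  assumes "1 \<le> k" "k \<le> c + 1" shows "f k (c + 3) = trunc c (k - 1 + f 1 (c + 3))"
proof (cases "k = 1")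
  case True
  then show ?thesis using trunc_3[of "f 1 (c + 3)"] ran_3(2)[of "c + 3" 1] c by simp
next
  case False
  then have k: "k - 1 \<in> {1..c + 3}" using assms by auto
  have "f k (c + 3) = f (f (k - 1) 1) (c + 3)" using mul[of "k - 1" 1] assms False c by (simp add: trunc_def)
  also have "\<dots> = f (k - 1) (f 1 (c + 3))" using as[OF k, of 1 "c + 3"] by simp
  also have "\<dots> = trunc c (k - 1 + f 1 (c + 3))"
    using mul[of "k - 1" "f 1 (c + 3)"] ran_3(2)[of "c + 3" 1] assms False c by simp
  finally show ?thesis .
qed

end

text \<open>Facts on left multiplication yield those on right multiplication through the reversed
  operation.\<close>

sublocale frB \<subseteq> flip: frB c "\<lambda>x y. f y x"
  by unfold_locales (use c frameB_flip[OF frame] in auto)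

context frB
begin

lemmas right_v = flip.left_v and right_z = flip.left_z

definition vals :: valsB where
  "vals = \<lparr>uv = f 1 (c + 2), vu = f (c + 2) 1, vv = f (c + 2) (c + 2), uuv = f 2 (c + 2), vuu = f (c + 2) 2,
     uz = f 1 (c + 3), zu = f (c + 3) 1, vz = f (c + 2) (c + 3), zv = f (c + 3) (c + 2), zz = f (c + 3) (c + 3)\<rparr>"

lemma eq_tabB:
  assumes "x \<in> {1..c + 3}" "y \<in> {1..c + 3}" shows "f x y = tabB c vals x y"
proof -
  have split: "a \<le> c + 1 \<and> (a = 1 \<or> 2 \<le> a) \<or> a = c + 2 \<or> a = c + 3" if "a \<in> {1..c + 3}" for a
    using that by auto
  consider "x \<le> c + 1" "y \<le> c + 1" | "x = 1" "y = c + 2" | "2 \<le> x" "x \<le> c + 1" "y = c + 2"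
    | "x \<le> c + 1" "y = c + 3" | "x = c + 2" "y = 1" | "x = c + 2" "2 \<le> y" "y \<le> c + 1"
    | "x = c + 2" "y = c + 2" | "x = c + 2" "y = c + 3" | "x = c + 3" "y \<le> c + 1"
    | "x = c + 3" "y = c + 2" | "x = c + 3" "y = c + 3"
    using split[OF assms(1)] split[OF assms(2)] by blast
  then show ?thesis
  proof cases
    case 1 then show ?thesis using mul assms by (simp add: tabB_def)
  next
    case 2 then show ?thesis by (simp add: tabB_def vals_def)
  next
    case 3 then show ?thesis using left_v[of x] by (simp add: tabB_def vals_def)
  next
    case 4 then show ?thesis using left_z[of x] assms by (simp add: tabB_def vals_def)
  next
    case 5 then show ?thesis by (simp add: tabB_def vals_def)
  next
    case 6 then show ?thesis using right_v[of y] by (simp add: tabB_def vals_def)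
  next
    case 7 then show ?thesis by (simp add: tabB_def vals_def)
  next
    case 8 then show ?thesis by (simp add: tabB_def vals_def)
  next
    case 9 then show ?thesis using right_z[of y] assms by (simp add: tabB_def vals_def)
  next
    case 10 then show ?thesis by (simp add: tabB_def vals_def)
  next
    case 11 then show ?thesis by (simp add: tabB_def vals_def)
  qed
qed

lemma mul_N:
  assumes "a \<in> N"
  shows "f 1 a = (if a = c + 3 then f 1 (c + 3) else trunc c (a + 1))"
    "f a 1 = (if a = c + 3 then f (c + 3) 1 else trunc c (a + 1))"
    "f a (c + 2) = (if a = c + 3 then f (c + 3) (c + 2) else trunc c (a - 2 + f 2 (c + 2)))"
    "f (c + 2) a = (if a = c + 3 then f (c + 2) (c + 3) else trunc c (a - 2 + f (c + 2) 2))"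
    "f 2 a = (if a = c + 3 then trunc c (f 1 (c + 3) + 1) else trunc c (a + 2))"
    "f a 2 = (if a = c + 3 then trunc c (f (c + 3) 1 + 1) else trunc c (a + 2))"
    "f a (c + 3) = (if a = c + 3 then f (c + 3) (c + 3) else trunc c (a - 1 + f 1 (c + 3)))"
proof -
  have a: "2 \<le> a" "a \<le> c + 1" if "a \<noteq> c + 3" using that assms by auto
  have p: "f 1 a = trunc c (1 + a)" "f a 1 = trunc c (a + 1)" "f 2 a = trunc c (2 + a)" "f a 2 = trunc c (a + 2)"
    if "a \<noteq> c + 3" using a[OF that] mul c by simp_all
  have z: "f 2 (c + 3) = trunc c (f 1 (c + 3) + 1)" "f (c + 3) 2 = trunc c (f (c + 3) 1 + 1)"
    using left_z[of 2] right_z[of 2] c by simp_all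
  show "f 1 a = (if a = c + 3 then f 1 (c + 3) else trunc c (a + 1))"
    "f a 1 = (if a = c + 3 then f (c + 3) 1 else trunc c (a + 1))"
    using p by simp_all
  show "f a (c + 2) = (if a = c + 3 then f (c + 3) (c + 2) else trunc c (a - 2 + f 2 (c + 2)))"
    using a left_v[of a] by auto
  show "f (c + 2) a = (if a = c + 3 then f (c + 2) (c + 3) else trunc c (a - 2 + f (c + 2) 2))"
    using a right_v[of a] by auto
  show "f 2 a = (if a = c + 3 then trunc c (f 1 (c + 3) + 1) else trunc c (a + 2))"
    "f a 2 = (if a = c + 3 then trunc c (f (c + 3) 1 + 1) else trunc c (a + 2))"
    using p z by (simp_all add: add.commute)
  show "f a (c + 3) = (if a = c + 3 then f (c + 3) (c + 3) else trunc c (a - 1 + f 1 (c + 3)))"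
    using a left_z[of a] by auto
qed

lemma code_valid: "validB c (codeB c f)" and vals_eq: "vals = paramsB c (codeB c f)"
proof -
  have mem: "1 \<in> {1..c + 3}" "2 \<in> {1..c + 3}" "c + 2 \<in> {1..c + 3}" "c + 3 \<in> {1..c + 3}" using c by auto
  have f11: "f 1 1 = 2" using mul[of 1 1] c by (simp add: trunc_def)
  note N = ran_N[OF mem(1,3)] ran_N[OF mem(3,1)] ran_N[OF mem(3,3)]
  have three: "f 1 (c + 3) \<in> {3..c + 1}" "f (c + 3) 1 \<in> {3..c + 1}" "f (c + 2) (c + 3) \<in> {3..c + 1}"
    "f (c + 3) (c + 2) \<in> {3..c + 1}" "f 2 (c + 2) \<in> {3..c + 1}" "f (c + 2) 2 \<in> {3..c + 1}"
    using ran_3 mem c by auto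
  have three_N: "k \<in> N" "k \<noteq> c + 3" if "k \<in> {3..c + 1}" for k using that by auto
  have z: "c + 3 \<in> {f 1 (c + 2), f (c + 2) 1, f (c + 2) (c + 2)}"
    using frame f11 c unfolding frameB_def by auto
  have e1: "f 2 (c + 2) = (if f 1 (c + 2) = c + 3 then f 1 (c + 3) else trunc c (f 1 (c + 2) + 1))"
    using as[OF mem(1,1,3)] f11 mul_N(1)[OF N(1)] by simp
  have e2: "f (c + 2) 2 = (if f (c + 2) 1 = c + 3 then f (c + 3) 1 else trunc c (f (c + 2) 1 + 1))"
    using as[OF mem(3,1,1)] f11 mul_N(2)[OF N(2)] by simp
  have e3: "(if f 1 (c + 2) = c + 3 then f (c + 3) 1 else trunc c (f 1 (c + 2) + 1)) =
      (if f (c + 2) 1 = c + 3 then f 1 (c + 3) else trunc c (f (c + 2) 1 + 1))"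
    using as[OF mem(1,3,1)] unfolding mul_N(2)[OF N(1)] mul_N(1)[OF N(2)] .
  have e4: "(if f 1 (c + 2) = c + 3 then f (c + 3) (c + 2) else trunc c (f 1 (c + 2) - 2 + f 2 (c + 2))) =
      (if f (c + 2) (c + 2) = c + 3 then f 1 (c + 3) else trunc c (f (c + 2) (c + 2) + 1))"
    using as[OF mem(1,3,3)] unfolding mul_N(3)[OF N(1)] mul_N(1)[OF N(3)] .
  have e5: "(if f (c + 2) 1 = c + 3 then f (c + 3) (c + 2) else trunc c (f (c + 2) 1 - 2 + f 2 (c + 2))) =
      (if f 1 (c + 2) = c + 3 then f (c + 2) (c + 3) else trunc c (f 1 (c + 2) - 2 + f (c + 2) 2))"
    using as[OF mem(3,1,3)] unfolding mul_N(3)[OF N(2)] mul_N(4)[OF N(1)] .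
  have e6: "(if f (c + 2) (c + 2) = c + 3 then f (c + 3) 1 else trunc c (f (c + 2) (c + 2) + 1)) =
      (if f (c + 2) 1 = c + 3 then f (c + 2) (c + 3) else trunc c (f (c + 2) 1 - 2 + f (c + 2) 2))"
    using as[OF mem(3,3,1)] unfolding mul_N(2)[OF N(3)] mul_N(4)[OF N(2)] .
  have e7: "f (c + 3) (c + 2) = f (c + 2) (c + 3)" if "f (c + 2) (c + 2) = c + 3"
    using as[OF mem(3,3,3)] unfolding that .
  have z1: "f (c + 3) (c + 3) = trunc c (f (c + 2) (c + 3) + 1)" if "f 1 (c + 2) = c + 3"
    using as[OF mem(1,3,4)] mul_N(1)[OF three_N(1)[OF three(3)]] three_N(2)[OF three(3)] unfolding that by simp
  have z2: "f (c + 3) (c + 3) = trunc c (f (c + 3) (c + 2) + 1)" if "f (c + 2) 1 = c + 3"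
    using as[OF mem(4,3,1)] mul_N(2)[OF three_N(1)[OF three(4)]] three_N(2)[OF three(4)] unfolding that by simp
  have z3: "f (c + 3) (c + 3) = trunc c (f (c + 2) (c + 3) - 2 + f (c + 2) 2)" if "f (c + 2) (c + 2) = c + 3"
    using as[OF mem(3,3,4)] mul_N(4)[OF three_N(1)[OF three(3)]] three_N(2)[OF three(3)] unfolding that by simp
  have c1: "trunc c (f (c + 2) 1 + 2) = trunc c (f 2 (c + 2) + 1)" if "f (c + 2) 1 \<noteq> c + 3"
    using as[OF mem(2,3,1)] mul_N(5)[OF N(2)] mul_N(2)[OF three_N(1)[OF three(5)]] three_N(2)[OF three(5)] that by simp
  have c1': "trunc c (f 1 (c + 2) + 2) = trunc c (f (c + 2) 2 + 1)" if "f 1 (c + 2) \<noteq> c + 3"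
    using as[OF mem(1,3,2)] mul_N(6)[OF N(1)] mul_N(1)[OF three_N(1)[OF three(6)]] three_N(2)[OF three(6)] that by simp
  have c2: "(if f (c + 2) (c + 2) = c + 3 then trunc c (f (c + 3) 1 + 1) else trunc c (f (c + 2) (c + 2) + 2)) =
      trunc c (f (c + 2) 2 - 2 + f (c + 2) 2)"
    using as[OF mem(3,3,2)] mul_N(6)[OF N(3)] mul_N(4)[OF three_N(1)[OF three(6)]] three_N(2)[OF three(6)] by simp
  have c3: "trunc c (f (c + 2) (c + 3) + 1) = trunc c (f 1 (c + 2) - 1 + f 1 (c + 3))" if "f 1 (c + 2) \<noteq> c + 3"
    using as[OF mem(1,3,4)] mul_N(7)[OF N(1)] mul_N(1)[OF three_N(1)[OF three(3)]] three_N(2)[OF three(3)] that by simp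
  have "{f 1 (c + 2), f (c + 2) 1, f (c + 2) (c + 2)} \<subseteq> N"
    "{f 1 (c + 3), f (c + 3) 1, f (c + 2) (c + 3)} \<subseteq> {3..c + 1}"
    using N three by blast+
  note * = paramsB_arith[OF c this(1) z this(2) e1 e2 e3 e4 e5 e6 e7 z1 z2 z3 c1 c1' c2 c3]
  show "validB c (codeB c f)" unfolding codeB_def using *(1) .
  show "vals = paramsB c (codeB c f)" unfolding codeB_def vals_def using *(2) .
qed

lemma eq_opB: "x \<in> {1..c + 3} \<Longrightarrow> y \<in> {1..c + 3} \<Longrightarrow> f x y = opB c (codeB c f) x y"
  using eq_tabB unfolding opB_def vals_eq .

lemma isomorphic_opB: "isomorphic (table c f) (table c (opB c (codeB c f)))"
  unfolding isomorphic_iff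
  by (intro exI[of _ id] iso_map_id) (simp_all add: eq_opB del: One_nat_def)

lemma products_2: "products (table c f) 2 = N"
proof -
  have "products (table c f) 2 = {f x y | x y. x \<in> {1..c + 3} \<and> y \<in> {1..c + 3}}"
    by (simp add: numeral_2_eq_2 products_Suc products_1)
  also have "\<dots> = N"
  proof (intro equalityI subsetI)
    fix w assume w: "w \<in> N"
    show "w \<in> {f x y | x y. x \<in> {1..c + 3} \<and> y \<in> {1..c + 3}}"
    proof (cases "w = c + 3")
      case True
      obtain x y where "x \<in> {1, c + 2}" "y \<in> {1, c + 2}" "f x y = c + 3"
        using frame unfolding frameB_def by blast
      moreover from this have "x \<in> {1..c + 3}" "y \<in> {1..c + 3}" by auto
      ultimately show ?thesis using True by (intro CollectI exI[of _ x] exI[of _ y]) simp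
    next
      case False
      then have "w = f (w - 1) 1" using w mul[of "w - 1" 1] by (auto simp: trunc_def)
      moreover have "w - 1 \<in> {1..c + 3}" "(1::nat) \<in> {1..c + 3}" using w False by auto
      ultimately show ?thesis by blast
    qed
  qed (use ran_N in blast)
  finally show ?thesis .
qed

lemma products_3:
  assumes "3 \<le> k" "k \<le> c + 1" shows "products (table c f) k = {k..c + 1}"
  using assms
proof (induction k rule: dec_induct)
  case base
  have "products (table c f) 3 = {f x y | x y. x \<in> N \<and> y \<in> {1..c + 3}}"
    using products_Suc[of 2 "table c f"] by (simp add: products_2 numeral_3_eq_3 del: insert_iff)
  also have "\<dots> = {3..c + 1}"
  proof (intro equalityI subsetI)
    fix w assume w: "w \<in> {3..c + 1}"
    then have "w = f (w - 1) 1" using mul[of "w - 1" 1] by (auto simp: trunc_def)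
    moreover have "w - 1 \<in> N" "(1::nat) \<in> {1..c + 3}" using w by auto
    ultimately show "w \<in> {f x y | x y. x \<in> N \<and> y \<in> {1..c + 3}}" by blast
  qed (use ran_3(1) in blast)
  finally show ?case .
next
  case (step k)
  show ?case
  proof (rule table_products_step[OF pt])
    fix x y assume xy: "x \<in> {k..c + 1}" "y \<in> {c + 2, c + 3}"
    have "f 2 (c + 2) \<ge> 3" "f 1 (c + 3) \<ge> 3" using ran_3[of 2 "c + 2"] ran_3[of "c + 3" 1] c by auto
    then show "f x y \<in> {Suc k..c + 1}"
      using xy step left_v[of x] left_z[of x] by (auto simp: trunc_def)
  qed (use step in auto)
qed

lemma in_nilpotent_semigroups: "table c f \<in> nilpotent_semigroups (c + 3) 2"
  using pt c products_3 by (intro table_in_nilpotent_semigroups) (auto simp: products_2)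

end

section \<open>Isomorphisms between semigroups with two generators\<close>

locale isoB = F: frB c f + G: frB c g for c f g +
  fixes \<phi>
  assumes iso: "iso_map \<phi> (table c f) (table c g)"
begin

lemma power: "3 \<le> k \<Longrightarrow> k \<le> c + 1 \<Longrightarrow> \<phi> k = k"
  using F.products_3 G.products_3 by (intro iso_map_fixes_power[OF iso F.pt]) auto

lemma inj: "x \<in> {1..c + 3} \<Longrightarrow> y \<in> {1..c + 3} \<Longrightarrow> \<phi> x = \<phi> y \<Longrightarrow> x = y"
  using iso_map_eq_iff[OF iso] by simp

lemma in_carr: "x \<in> {1..c + 3} \<Longrightarrow> \<phi> x \<in> {1..c + 3}"
  using iso_map_in[OF iso] by simp

lemma hom: "x \<in> {1..c + 3} \<Longrightarrow> y \<in> {1..c + 3} \<Longrightarrow> \<phi> (f x y) = g (\<phi> x) (\<phi> y)"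
  using iso_map_mul[OF iso] by simp

lemma image_N: "\<phi> ` F.N = F.N"
proof -
  have "is_semigroup (table c f)" using F.pt by (simp add: power_table_def)
  from iso_map_products[OF iso this, of 2] show ?thesis
    unfolding F.products_2 G.products_2 by (rule sym)
qed

lemma gens:
  assumes "x \<in> {1, c + 2}" shows "\<phi> x \<in> {1, c + 2}"
proof (rule ccontr)
  assume "\<phi> x \<notin> {1, c + 2}"
  then have "\<phi> x \<in> F.N" using in_carr[of x] assms by auto
  then obtain y where "y \<in> F.N" "\<phi> x = \<phi> y" using image_N by blast
  then show False using inj[of x y] assms by auto
qed

text \<open>\<phi> preserves S^2 and fixes everything from u^3 on, so it can only permute the second
  layer {u^2, z}.\<close>

lemma mids:
  assumes "x \<in> {2, c + 3}" shows "\<phi> x \<in> {2, c + 3}"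
proof -
  have "x \<in> F.N" using assms F.c by auto
  then have "\<phi> x \<in> F.N" using image_N by blast
  moreover have "\<phi> x \<notin> {3..c + 1}"
  proof
    assume *: "\<phi> x \<in> {3..c + 1}"
    then have "x = \<phi> x" using inj[of x "\<phi> x"] power[of "\<phi> x"] assms F.c by auto
    then show False using * assms by auto
  qed
  ultimately show ?thesis by auto
qed

text \<open>If v acts on u^2 as u does, then v has weight 1, and a product of two generators can
  only be u^2 or z.\<close>

lemma special_code:
  assumes "validB c (p, q, r, e)" "uuv (paramsB c (p, q, r, e)) = 3" "vuu (paramsB c (p, q, r, e)) = 3"
  shows "p \<in> {2, c + 3}" "q \<in> {2, c + 3}" "r \<in> {2, c + 3}" "e = 3"
proof -
  have "(if p = c + 3 then e = 3 else p = 2)" "(if q = c + 3 then e = 3 else q = 2)"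
    using assms F.c by (auto simp: paramsB_def Let_def trunc_def)
  then show "p \<in> {2, c + 3}" "q \<in> {2, c + 3}" "r \<in> {2, c + 3}" "e = 3"
    using assms(1) F.c by (auto simp: validB_def trunc_eq_iff Let_def split: if_splits)
qed

text \<open>If \<phi> fixes u and v, it is the identity and the codes agree. If it interchanges
  them, v has weight 1 and both codes are special; vv decides whether z is fixed or exchanged with
  u^2. The two listed pairs are the special codes that are changed by the interchange.\<close>

lemma codes:
  "codeB c f = codeB c g \<or> {codeB c f, codeB c g} = {(c + 3, 2, 2, 3), (2, c + 3, 2, 3)} \<or>
     {codeB c f, codeB c g} = {(c + 3, c + 3, c + 3, 3), (2, 2, c + 3, 3)}"
proof -
  have mem: "1 \<in> {1..c + 3}" "2 \<in> {1..c + 3}" "c + 2 \<in> {1..c + 3}" "c + 3 \<in> {1..c + 3}" "3 \<in> {1..c + 3}"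
    using F.c by auto
  have f11: "f 1 1 = 2" "g 1 1 = 2" "f 1 3 = 4" "f 3 1 = 4" "g 1 3 = 4" "g 3 1 = 4"
    using F.mul G.mul F.c by (simp_all add: trunc_def)
  have pow: "\<phi> 3 = 3" "\<phi> 4 = 4" using power F.c by simp_all
  have "\<phi> 1 \<noteq> \<phi> (c + 2)" "\<phi> 2 \<noteq> \<phi> (c + 3)"
    using inj[OF mem(1,3)] inj[OF mem(2,4)] F.c by auto
  then consider "\<phi> 1 = 1" "\<phi> (c + 2) = c + 2" | "\<phi> 1 = c + 2" "\<phi> (c + 2) = 1"
    using gens[of 1] gens[of "c + 2"] by auto
  then show ?thesis
  proof cases
    case 1
    have "\<phi> 2 = 2" using hom[OF mem(1,1)] f11 1 by simp
    then have "\<phi> (c + 3) = c + 3" using mids[of "c + 3"] \<open>\<phi> 2 \<noteq> \<phi> (c + 3)\<close> by auto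
    have id: "\<phi> x = x" if "x \<in> {1..c + 3}" for x
    proof -
      have "x = 1 \<or> x = 2 \<or> 3 \<le> x \<and> x \<le> c + 1 \<or> x = c + 2 \<or> x = c + 3" using that by auto
      then show ?thesis using 1 power \<open>\<phi> 2 = 2\<close> \<open>\<phi> (c + 3) = c + 3\<close> by auto
    qed
    have "f x y = g x y" if "x \<in> {1..c + 3}" "y \<in> {1..c + 3}" for x y
    proof -
      have "f x y \<in> {1..c + 3}" using F.ran_N[OF that] by auto
      then show ?thesis using hom[OF that] id that by simp
    qed
    then show ?thesis unfolding codeB_def using mem by simp
  next
    case 2
    \<comment> \<open>\<phi> fixes u^3 and u^4, so v inherits v u^3 = u^4 = u^3 v from u in both
      semigroups. This is weight 1.\<close>
    have "g (c + 2) 3 = 4" "g 3 (c + 2) = 4"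
      using hom[OF mem(1,5)] hom[OF mem(5,1)] f11 pow 2 by simp_all
    moreover have "f (c + 2) 3 = 4" "f 3 (c + 2) = 4"
    proof -
      have "\<phi> (f (c + 2) 3) = \<phi> 4" "\<phi> (f 3 (c + 2)) = \<phi> 4"
        using hom[OF mem(3,5)] hom[OF mem(5,3)] f11 pow 2 by simp_all
      moreover have "f (c + 2) 3 \<in> {1..c + 3}" "f 3 (c + 2) \<in> {1..c + 3}" "4 \<in> {1..c + 3}"
        using F.ran_N[OF mem(3,5)] F.ran_N[OF mem(5,3)] F.c by auto
      ultimately show "f (c + 2) 3 = 4" "f 3 (c + 2) = 4" using inj by blast+
    qed
    ultimately have "f 2 (c + 2) = 3" "f (c + 2) 2 = 3" "g 2 (c + 2) = 3" "g (c + 2) 2 = 3"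
      using F.left_v[of 3] G.left_v[of 3] F.right_v[of 3] G.right_v[of 3] F.c by (auto simp: trunc_def)
    then have spec: "uuv (paramsB c (codeB c f)) = 3" "vuu (paramsB c (codeB c f)) = 3"
        "uuv (paramsB c (codeB c g)) = 3" "vuu (paramsB c (codeB c g)) = 3"
      unfolding F.vals_eq[symmetric] G.vals_eq[symmetric] F.vals_def G.vals_def by simp_all
    obtain p q r e where f: "codeB c f = (p, q, r, e)" by (metis surj_pair)
    obtain p' q' r' e' where g: "codeB c g = (p', q', r', e')" by (metis surj_pair)
    have sf: "p \<in> {2, c + 3}" "q \<in> {2, c + 3}" "r \<in> {2, c + 3}" "e = 3"
      using special_code[of p q r e] F.code_valid spec unfolding f by simp_all
    have sg: "p' \<in> {2, c + 3}" "q' \<in> {2, c + 3}" "r' \<in> {2, c + 3}" "e' = 3"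
      using special_code[of p' q' r' e'] G.code_valid spec unfolding g by simp_all
    have rel: "\<phi> r = 2" "r' = \<phi> 2" "p' = \<phi> q" "q' = \<phi> p"
      using hom[OF mem(3,3)] hom[OF mem(1,1)] hom[OF mem(3,1)] hom[OF mem(1,3)] f g f11 2
      unfolding codeB_def by simp_all
    have z: "c + 3 \<in> {p, q, r}"
      using F.code_valid unfolding f by (auto simp: validB_def Let_def split: if_splits)
    have "\<phi> 2 = 2 \<and> \<phi> (c + 3) = c + 3 \<or> \<phi> 2 = c + 3 \<and> \<phi> (c + 3) = 2"
      using mids[of 2] mids[of "c + 3"] \<open>\<phi> 2 \<noteq> \<phi> (c + 3)\<close> by auto
    then show ?thesis
    proof (elim disjE conjE)
      assume \<phi>: "\<phi> 2 = 2" "\<phi> (c + 3) = c + 3"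
      have "\<phi> p = p" "\<phi> q = q" "\<phi> r = r" using sf(1-3) \<phi> by auto
      then have eq: "codeB c g = (q, p, 2, 3)" "codeB c f = (p, q, 2, 3)"
        using rel \<phi> sf(4) sg(4) unfolding f g by auto
      have "c + 3 \<in> {p, q}" using z \<open>\<phi> r = r\<close> rel(1) by auto
      then consider "p = c + 3" "q = c + 3" | "p = c + 3" "q = 2" | "p = 2" "q = c + 3" using sf(1,2) by auto
      then show ?thesis unfolding eq by cases (simp_all add: insert_commute)
    next
      assume \<phi>: "\<phi> 2 = c + 3" "\<phi> (c + 3) = 2"
      have "r = c + 3" using sf(3) rel(1) \<phi> by auto
      then have eq: "codeB c g = (\<phi> q, \<phi> p, c + 3, 3)" "codeB c f = (p, q, c + 3, 3)"
        using rel \<phi> sf(4) sg(4) unfolding f g by auto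
      consider "p = 2" "q = 2" | "p = c + 3" "q = c + 3" | "p = c + 3" "q = 2" | "p = 2" "q = c + 3"
        using sf(1,2) by auto
      then show ?thesis unfolding eq by cases (simp_all add: \<phi> insert_commute)
    qed
  qed
qed

end

text \<open>
  The removed codes describe the same semigroups as $(z, 2, 2, 3)$ and $(z, z, z, 3)$, with $u$ and $v$ interchanged.
\<close>

definition repsB :: "nat \<Rightarrow> quad set" where
  "repsB c = {\<kappa>. validB c \<kappa>} - {(2, c + 3, 2, 3), (2, 2, c + 3, 3)}"

lemma codeB_opB:
  assumes "validB c \<kappa>" shows "codeB c (opB c \<kappa>) = \<kappa>"
proof -
  obtain p q r e where \<kappa>: "\<kappa> = (p, q, r, e)" by (metis surj_pair)
  show ?thesis
    using assms unfolding \<kappa> codeB_def opB_def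
    by (auto simp: tabB_def paramsB_def validB_def Let_def trunc_def)
qed

text \<open>The weight in the special codes, where v weighs 1 and z weighs 2.\<close>

definition len :: "nat \<Rightarrow> nat \<Rightarrow> nat" where
  "len c x = (if x = c + 2 then 1 else if x = c + 3 then 2 else x)"

lemma tabB_len:
  assumes "c \<ge> 4" "x \<in> {1..c + 3}" "y \<in> {1..c + 3}" "x \<notin> {1, c + 2} \<or> y \<notin> {1, c + 2}"
  shows "tabB c \<lparr>uv = p, vu = q, vv = r, uuv = 3, vuu = 3, uz = 3, zu = 3, vz = 3, zv = 3, zz = 4\<rparr> x y =
    trunc c (len c x + len c y)"
proof -
  have split: "a = c + 2 \<or> a = c + 3 \<or> a = 1 \<or> 2 \<le> a \<and> a \<le> c + 1" if "a \<in> {1..c + 3}" for a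
    using that by auto
  show ?thesis
    using split[OF assms(2)] split[OF assms(3)]
  proof (elim disjE conjE)
  qed (use assms(1,4) in \<open>simp_all add: tabB_def len_def trunc_def\<close>)
qed

lemma len_range: "c \<ge> 4 \<Longrightarrow> x \<in> {1..c + 3} \<Longrightarrow> x \<notin> {1, c + 2} \<Longrightarrow> 2 \<le> len c x"
  "x \<in> {1..c + 3} \<Longrightarrow> 1 \<le> len c x"
  by (auto simp: len_def)

text \<open>Products other than those of two generators depend on \<open>len\<close> only, which
  \<tau> preserves. So the homomorphism law needs checking only for the four products of generators,
  which \<open>gen\<close> describes.\<close>

lemma iso_special:
  assumes c: "c \<ge> 4" and \<tau>: "bij_betw \<tau> {1..c + 3} {1..c + 3}" "\<And>k. 3 \<le> k \<Longrightarrow> k \<le> c + 1 \<Longrightarrow> \<tau> k = k"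
    "\<tau> 1 = c + 2" "\<tau> (c + 2) = 1" "\<tau> ` {2, c + 3} \<subseteq> {2, c + 3}"
    and par: "paramsB c \<kappa> = \<lparr>uv = p, vu = q, vv = r, uuv = 3, vuu = 3, uz = 3, zu = 3, vz = 3, zv = 3, zz = 4\<rparr>"
    "paramsB c \<kappa>' = \<lparr>uv = p', vu = q', vv = r', uuv = 3, vuu = 3, uz = 3, zu = 3, vz = 3, zv = 3, zz = 4\<rparr>"
    and gen: "\<tau> 2 = r'" "\<tau> p = q'" "\<tau> q = p'" "\<tau> r = 2"
  shows "isomorphic (table c (opB c \<kappa>)) (table c (opB c \<kappa>'))"
  unfolding isomorphic_iff
proof (intro exI)
  show "iso_map \<tau> (table c (opB c \<kappa>)) (table c (opB c \<kappa>'))"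
    unfolding iso_map_def carr_table mul_table
  proof (intro conjI ballI \<tau>(1))
    fix x y assume xy: "x \<in> {1..c + 3}" "y \<in> {1..c + 3}"
    have gen1: "tabB c P 1 1 = 2" "tabB c P 1 (c + 2) = uv P" "tabB c P (c + 2) 1 = vu P" "tabB c P (c + 2) (c + 2) = vv P" for P
      using c by (simp_all add: tabB_def trunc_def)
    show "\<tau> (opB c \<kappa> x y) = opB c \<kappa>' (\<tau> x) (\<tau> y)"
    proof (cases "x \<in> {1, c + 2} \<and> y \<in> {1, c + 2}")
      case True
      then show ?thesis unfolding opB_def par using gen \<tau>(3,4) by (elim conjE insertE emptyE) (simp_all only: gen1 valsB.simps)
    next
      case False
      have len: "len c (\<tau> a) = len c a \<and> (\<tau> a \<in> {1, c + 2} \<longleftrightarrow> a \<in> {1, c + 2})" if a: "a \<in> {1..c + 3}" for a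
      proof -
        have mid: "len c b = 2 \<and> b \<notin> {1, c + 2}" if "b \<in> {2, c + 3}" for b
          using that c by (auto simp: len_def)
        consider "a = 1" | "a = c + 2" | "a \<in> {2, c + 3}" | "3 \<le> a" "a \<le> c + 1"
          using a by fastforce
        then show ?thesis
        proof cases
          case 1 then show ?thesis using c \<tau>(3) by (simp add: len_def)
        next
          case 2 then show ?thesis using c \<tau>(4) by (simp add: len_def)
        next
          case 3
          then have "\<tau> a \<in> {2, c + 3}" using \<tau>(5) by blast
          then show ?thesis using mid[of a] mid[of "\<tau> a"] 3 by metis
        next
          case 4 then show ?thesis using \<tau>(2)[of a] by simp
        qed
      qed
      have \<tau>xy: "\<tau> x \<in> {1..c + 3}" "\<tau> y \<in> {1..c + 3}" using \<tau>(1) xy by (auto simp: bij_betw_def)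
      have "2 \<le> len c x \<or> 2 \<le> len c y"
        using False len_range(1)[OF c xy(1)] len_range(1)[OF c xy(2)] by blast
      then have "3 \<le> len c x + len c y" using len_range(2)[OF xy(1)] len_range(2)[OF xy(2)] by linarith
      then have "3 \<le> trunc c (len c x + len c y)" "trunc c (len c x + len c y) \<le> c + 1"
        using c by (auto simp: trunc_def)
      then have "\<tau> (trunc c (len c x + len c y)) = trunc c (len c x + len c y)" by (rule \<tau>(2))
      moreover have "opB c \<kappa> x y = trunc c (len c x + len c y)"
        unfolding opB_def par by (rule tabB_len[OF c xy]) (use False in blast)
      moreover have "opB c \<kappa>' (\<tau> x) (\<tau> y) = trunc c (len c (\<tau> x) + len c (\<tau> y))"
        unfolding opB_def par by (rule tabB_len[OF c \<tau>xy]) (use False len xy in blast)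
      ultimately show ?thesis using len xy by simp
    qed
  qed
qed

lemma iso_special_1:
  assumes "c \<ge> 4"
  shows "isomorphic (table c (opB c (2, c + 3, 2, 3))) (table c (opB c (c + 3, 2, 2, 3)))"
proof (rule iso_special[OF assms, of "id(1 := c + 2, c + 2 := 1)"])
  show "bij_betw (id(1 := c + 2, c + 2 := 1)) {1..c + 3} {1..c + 3}"
    by (rule bij_betw_byWitness[where f' = "id(1 := c + 2, c + 2 := 1)"]) auto
qed (use assms in \<open>auto simp: paramsB_def Let_def trunc_def\<close>)

text \<open>Here vv = z, so interchanging u and v must exchange u^2 and z as well.\<close>

lemma iso_special_2:
  assumes "c \<ge> 4"
  shows "isomorphic (table c (opB c (2, 2, c + 3, 3))) (table c (opB c (c + 3, c + 3, c + 3, 3)))"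
proof (rule iso_special[OF assms, of "id(1 := c + 2, c + 2 := 1, 2 := c + 3, c + 3 := 2)"])
  show "bij_betw (id(1 := c + 2, c + 2 := 1, 2 := c + 3, c + 3 := 2)) {1..c + 3} {1..c + 3}"
    using assms
    by (intro bij_betw_byWitness[where f' = "id(1 := c + 2, c + 2 := 1, 2 := c + 3, c + 3 := 2)"]) auto
qed (use assms in \<open>auto simp: paramsB_def Let_def trunc_def\<close>)

lemma repsB_exists:
  assumes "frameB c f" "c \<ge> 4"
  shows "\<exists>\<kappa>\<in>repsB c. isomorphic (table c f) (table c (opB c \<kappa>))"
proof -
  interpret frB c f by unfold_locales (use assms in auto)
  have special: "validB c (c + 3, 2, 2, 3)" "validB c (c + 3, c + 3, c + 3, 3)"
    using assms by (auto simp: validB_def Let_def trunc_def)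
  consider "codeB c f \<in> repsB c" | "codeB c f = (2, c + 3, 2, 3)" | "codeB c f = (2, 2, c + 3, 3)"
    using code_valid by (auto simp: repsB_def)
  then show ?thesis
  proof cases
    case 1
    then show ?thesis using isomorphic_opB by blast
  next
    case 2
    then have "isomorphic (table c f) (table c (opB c (c + 3, 2, 2, 3)))"
      using isomorphic_opB iso_special_1[OF c] isomorphic_trans by metis
    moreover have "(c + 3, 2, 2, 3) \<in> repsB c" using special by (simp add: repsB_def)
    ultimately show ?thesis by blast
  next
    case 3
    then have "isomorphic (table c f) (table c (opB c (c + 3, c + 3, c + 3, 3)))"
      using isomorphic_opB iso_special_2[OF c] isomorphic_trans by metis
    moreover have "(c + 3, c + 3, c + 3, 3) \<in> repsB c" using special by (simp add: repsB_def)
    ultimately show ?thesis by blast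
  qed
qed

lemma isomorphic_opB_cases:
  assumes "validB c \<kappa>" "validB c \<kappa>'" "c \<ge> 4" "isomorphic (table c (opB c \<kappa>)) (table c (opB c \<kappa>'))"
  shows "\<kappa> = \<kappa>' \<or> {\<kappa>, \<kappa>'} = {(c + 3, 2, 2, 3), (2, c + 3, 2, 3)} \<or>
     {\<kappa>, \<kappa>'} = {(c + 3, c + 3, c + 3, 3), (2, 2, c + 3, 3)}"
proof -
  obtain \<phi> where "iso_map \<phi> (table c (opB c \<kappa>)) (table c (opB c \<kappa>'))"
    using assms(4) by (auto simp: isomorphic_iff)
  then interpret isoB c "opB c \<kappa>" "opB c \<kappa>'" \<phi>
    by unfold_locales (use assms frameB_opB in auto)
  show ?thesis using codes unfolding codeB_opB[OF assms(1)] codeB_opB[OF assms(2)] .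
qed

lemma repsB_unique:
  assumes "\<kappa> \<in> repsB c" "\<kappa>' \<in> repsB c" "c \<ge> 4" "isomorphic (table c (opB c \<kappa>)) (table c (opB c \<kappa>'))"
  shows "\<kappa> = \<kappa>'"
  using isomorphic_opB_cases[OF _ _ assms(3,4)] assms(1,2) unfolding repsB_def by (auto simp: doubleton_eq_iff)


section \<open>Commutativity and self-duality in type B\<close>

fun commB :: "quad \<Rightarrow> bool" where
  "commB (p, q, r, e) \<longleftrightarrow> p = q"

text \<open>Exchanging uv and vu in a code reverses the whole multiplication, so uv = vu already
  makes it symmetric.\<close>

lemma is_commutative_opB:
  assumes "validB c \<kappa>"
  shows "is_commutative (table c (opB c \<kappa>)) \<longleftrightarrow> commB \<kappa>"
proof -
  obtain p q r e where \<kappa>: "\<kappa> = (p, q, r, e)" by (metis surj_pair)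
  have "opB c \<kappa> 1 (c + 2) = p" "opB c \<kappa> (c + 2) 1 = q"
    unfolding \<kappa> by (simp_all add: opB_def tabB_def paramsB_def Let_def)
  moreover have "opB c \<kappa> x y = opB c \<kappa> y x" if "p = q" for x y
    using opB_swap[of c p q r e x y] assms that unfolding \<kappa> by simp
  ultimately show ?thesis unfolding is_commutative_def \<kappa> by force
qed

text \<open>The exceptional code has the dual (2, c + 3, 2, 3), which the interchange of u and v
  turns back into it.\<close>

definition sdB :: "nat \<Rightarrow> quad \<Rightarrow> bool" where
  "sdB c \<kappa> \<longleftrightarrow> commB \<kappa> \<or> \<kappa> = (c + 3, 2, 2, 3)"

lemma self_dual_opB:
  assumes c: "c \<ge> 4" and rep: "\<kappa> \<in> repsB c"
  shows "isomorphic (table c (opB c \<kappa>)) (dual (table c (opB c \<kappa>))) \<longleftrightarrow> sdB c \<kappa>"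
proof -
  obtain p q r e where \<kappa>: "\<kappa> = (p, q, r, e)" by (metis surj_pair)
  have val: "validB c (p, q, r, e)" using rep unfolding \<kappa> by (simp add: repsB_def)
  have "opB c (q, p, r, e) = (\<lambda>x y. opB c (p, q, r, e) y x)"
    using opB_swap[OF val] by (intro ext) simp
  then have dual: "dual (table c (opB c \<kappa>)) = table c (opB c (q, p, r, e))"
    unfolding \<kappa> dual_table by simp
  show ?thesis
  proof
    assume "isomorphic (table c (opB c \<kappa>)) (dual (table c (opB c \<kappa>)))"
    then show "sdB c \<kappa>"
      using isomorphic_opB_cases[OF val validB_swap[OF val] c] rep
      unfolding dual unfolding \<kappa> by (auto simp: sdB_def repsB_def doubleton_eq_iff)
  next
    assume "sdB c \<kappa>"
    then consider "p = q" | "\<kappa> = (c + 3, 2, 2, 3)" unfolding \<kappa> by (auto simp: sdB_def)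
    then show "isomorphic (table c (opB c \<kappa>)) (dual (table c (opB c \<kappa>)))"
    proof cases
      case 1
      then show ?thesis unfolding dual unfolding \<kappa> by (simp add: isomorphic_refl)
    next
      case 2
      have "is_semigroup (table c (opB c (2, c + 3, 2, 3)))"
        using frameB_opB[OF c validB_swap[OF val]] 2 unfolding \<kappa> by (simp add: frameB_def power_table_def)
      then have "isomorphic (table c (opB c (c + 3, 2, 2, 3))) (table c (opB c (2, c + 3, 2, 3)))"
        using isomorphic_sym[OF iso_special_1[OF c]] by blast
      then show ?thesis using 2 unfolding dual unfolding \<kappa> by simp
    qed
  qed
qed

section \<open>Counting the semigroups with two generators\<close>

text \<open>For r a power, the law \<open>trunc c (r + 2) = trunc c (2 * e - 2)\<close> leaves r =
  2e - 4, or all of c - 1, c, c + 1 once 2e >= c + 3. The fourth case, only vu = z among uv and vu,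
  is the image of \<open>codesB2\<close> under \<open>swapB\<close>.\<close>

definition "codesB1 c = (\<lambda>(e, r). (c + 3, c + 3, r, e)) `
  ((\<lambda>e. (e, c + 3)) ` {3, c, c + 1} \<union> (SIGMA e : {3..c + 1}. if 2 * e \<le> c + 2 then {2 * e - 4} else {c - 1, c, c + 1}))"
definition "codesB2 c = (\<lambda>(q, r, e). (c + 3, q, r, e)) `
  ({(2, c + 3, 3), (c, c + 3, c + 1), (c + 1, c + 3, c + 1)} \<union>
   (\<lambda>(q, e, r). (q, r, e)) ` (SIGMA q : {2..c + 1}. band c (q + 1) \<times> band c (2 * q - 2)))"
definition "codesB4 c = (\<lambda>(p, q, e). (p, q, c + 3, e)) ` (SIGMA p : {2..c + 1}. band c p \<times> band c (3 * p - 3))"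

fun swapB :: "quad \<Rightarrow> quad" where
  "swapB (p, q, r, e) = (q, p, r, e)"

lemma validB_1_iff:
  assumes c: "c \<ge> 4"
  shows "validB c (c + 3, c + 3, r, e) \<longleftrightarrow> (c + 3, c + 3, r, e) \<in> codesB1 c"
proof -
  have "validB c (c + 3, c + 3, r, e) \<longleftrightarrow> e \<in> {3..c + 1} \<and> (r = c + 3 \<and> (e = 3 \<or> c \<le> e) \<or>
      r \<in> {2..c + 1} \<and> (r + 4 = 2 * e \<or> c \<le> r + 1 \<and> c + 3 \<le> 2 * e))"
    using c by (auto simp: validB_def trunc_eq_iff)
  also have "\<dots> \<longleftrightarrow> r = c + 3 \<and> e \<in> {3, c, c + 1} \<or>
      e \<in> {3..c + 1} \<and> r \<in> (if 2 * e \<le> c + 2 then {2 * e - 4} else {c - 1, c, c + 1})"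
    using c by auto
  also have "\<dots> \<longleftrightarrow> (c + 3, c + 3, r, e) \<in> codesB1 c"
    unfolding codesB1_def by (auto simp: image_iff)
  finally show ?thesis .
qed

lemma validB_2_iff:
  assumes c: "c \<ge> 4" and q: "q \<noteq> c + 3"
  shows "validB c (c + 3, q, r, e) \<longleftrightarrow> (c + 3, q, r, e) \<in> codesB2 c"
proof -
  have "validB c (c + 3, q, r, e) \<longleftrightarrow> (q, r, e) \<in> {(2, c + 3, 3), (c, c + 3, c + 1), (c + 1, c + 3, c + 1)} \<or>
      q \<in> {2..c + 1} \<and> e \<in> {3..c + 1} \<and> r \<in> {2..c + 1} \<and>
      trunc c (e + 1) = trunc c (q + 2) \<and> trunc c (r + 1) = trunc c (2 * q - 1)"
    using c q by (auto simp: validB_def Let_def)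
  also have "\<dots> \<longleftrightarrow> (q, r, e) \<in> {(2, c + 3, 3), (c, c + 3, c + 1), (c + 1, c + 3, c + 1)} \<or>
      q \<in> {2..c + 1} \<and> e \<in> band c (q + 1) \<and> r \<in> band c (2 * q - 2)"
  proof -
    have "e \<in> {3..c + 1} \<and> r \<in> {2..c + 1} \<and> trunc c (e + 1) = trunc c (q + 2) \<and> trunc c (r + 1) = trunc c (2 * q - 1)
      \<longleftrightarrow> e \<in> band c (q + 1) \<and> r \<in> band c (2 * q - 2)" if "q \<in> {2..c + 1}"
    proof -
      have k: "q + 1 \<ge> 2" "2 * q - 2 \<ge> 2" "c \<ge> 2" "2 * q - 2 + 1 = 2 * q - 1" "q + 1 + 1 = q + 2" using that c by auto
      have "trunc c (e + 1) = trunc c (q + 2) \<Longrightarrow> 3 \<le> e"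
        using that c by (auto simp: trunc_eq_iff)
      then show ?thesis unfolding mem_band_iff[OF k(1,3)] mem_band_iff[OF k(2,3)] k(4,5) by auto
    qed
    then show ?thesis by blast
  qed
  also have "\<dots> \<longleftrightarrow> (c + 3, q, r, e) \<in> codesB2 c"
    unfolding codesB2_def by (auto simp: image_iff)
  finally show ?thesis .
qed

lemma validB_4_iff:
  assumes c: "c \<ge> 4" and pq: "p \<noteq> c + 3" "q \<noteq> c + 3"
  shows "validB c (p, q, r, e) \<longleftrightarrow> (p, q, r, e) \<in> codesB4 c"
proof -
  have "validB c (p, q, r, e) \<longleftrightarrow> r = c + 3 \<and> p \<in> {2..c + 1} \<and> q \<in> {2..c + 1} \<and> e \<in> {3..c + 1} \<and>
      trunc c (p + 1) = trunc c (q + 1) \<and> trunc c (e + 1) = trunc c (3 * p - 2)"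
    using pq by (auto simp: validB_def Let_def)
  also have "\<dots> \<longleftrightarrow> r = c + 3 \<and> p \<in> {2..c + 1} \<and> q \<in> band c p \<and> e \<in> band c (3 * p - 3)"
  proof -
    have "q \<in> {2..c + 1} \<and> e \<in> {3..c + 1} \<and> trunc c (p + 1) = trunc c (q + 1) \<and> trunc c (e + 1) = trunc c (3 * p - 2)
      \<longleftrightarrow> q \<in> band c p \<and> e \<in> band c (3 * p - 3)" if "p \<in> {2..c + 1}"
    proof -
      have k: "p \<ge> 2" "3 * p - 3 \<ge> 2" "c \<ge> 2" "3 * p - 3 + 1 = 3 * p - 2" using that c by auto
      have "trunc c (e + 1) = trunc c (3 * p - 2) \<Longrightarrow> 3 \<le> e"
        using that c by (auto simp: trunc_eq_iff)
      then show ?thesis unfolding mem_band_iff[OF k(1,3)] mem_band_iff[OF k(2,3)] k(4) by auto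
    qed
    then show ?thesis by blast
  qed
  also have "\<dots> \<longleftrightarrow> (p, q, r, e) \<in> codesB4 c"
    unfolding codesB4_def by (auto simp: image_iff)
  finally show ?thesis .
qed

lemma codesB2_ne: "c \<ge> 4 \<Longrightarrow> (p, q, r, e) \<in> codesB2 c \<Longrightarrow> p = c + 3 \<and> q \<le> c + 1"
  by (auto simp: codesB2_def)

lemma repsB_eq:
  assumes c: "c \<ge> 4"
  shows "repsB c = codesB1 c \<union> codesB2 c \<union> (swapB ` codesB2 c - {(2, c + 3, 2, 3)}) \<union> (codesB4 c - {(2, 2, c + 3, 3)})"
proof -
  have "validB c (p, q, r, e) \<longleftrightarrow> (p, q, r, e) \<in> codesB1 c \<union> codesB2 c \<union> swapB ` codesB2 c \<union> codesB4 c" for p q r e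
  proof -
    have f1: "(p, q, r, e) \<in> codesB1 c \<Longrightarrow> p = c + 3 \<and> q = c + 3" by (auto simp: codesB1_def)
    have f2: "(p, q, r, e) \<in> codesB2 c \<Longrightarrow> p = c + 3 \<and> q \<noteq> c + 3" using codesB2_ne[OF c] by fastforce
    have f3: "(p, q, r, e) \<in> swapB ` codesB2 c \<longleftrightarrow> (q, p, r, e) \<in> codesB2 c" by (force simp: image_iff)
    have f3': "(q, p, r, e) \<in> codesB2 c \<Longrightarrow> q = c + 3 \<and> p \<noteq> c + 3" using codesB2_ne[OF c] by fastforce
    have f4: "(p, q, r, e) \<in> codesB4 c \<Longrightarrow> p \<noteq> c + 3 \<and> q \<noteq> c + 3" by (auto simp: codesB4_def band_def split: if_splits)
    have sw: "validB c (p, q, r, e) \<longleftrightarrow> validB c (q, p, r, e)" using validB_swap by blast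
    consider "p = c + 3" "q = c + 3" | "p = c + 3" "q \<noteq> c + 3" | "p \<noteq> c + 3" "q = c + 3" | "p \<noteq> c + 3" "q \<noteq> c + 3"
      by blast
    then show ?thesis
    proof cases
      case 1
      then show ?thesis using 1 validB_1_iff[OF c] f2 f3' f4 unfolding Un_iff f3 by blast
    next
      case 2
      then show ?thesis using 2 validB_2_iff[OF c] f1 f3' f4 unfolding Un_iff f3 by blast
    next
      case 3
      then show ?thesis using 3 validB_2_iff[OF c, of p] sw f1 f2 f4 unfolding Un_iff f3 by blast
    next
      case 4
      then show ?thesis using 4 validB_4_iff[OF c] f1 f2 f3' unfolding Un_iff f3 by blast
    qed
  qed
  then have "{\<kappa>. validB c \<kappa>} = codesB1 c \<union> codesB2 c \<union> swapB ` codesB2 c \<union> codesB4 c"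
    by (metis (no_types, lifting) Collect_eqI Collect_mem_eq surj_pair)
  moreover have "(2, c + 3, 2, 3) \<notin> codesB1 c \<union> codesB2 c \<union> codesB4 c" "(2, 2, c + 3, 3) \<notin> codesB1 c \<union> codesB2 c \<union> swapB ` codesB2 c"
    using c by (auto simp: codesB1_def codesB2_def codesB4_def)
  ultimately show ?thesis unfolding repsB_def by blast
qed

lemma card_codesB1:
  assumes c: "c \<ge> 4" and h: "h = c div 2"
  shows "finite (codesB1 c)" "card (codesB1 c) = 3 + (c - 1) + 2 * (c - h)"
proof -
  let ?A = "(\<lambda>e. (e, c + 3)) ` {3, c, c + 1}"
  let ?B = "SIGMA e : {3..c + 1}. if 2 * e \<le> c + 2 then {2 * e - 4} else {c - 1, c, c + 1}"
  have fin: "finite ?A" "finite ?B" by auto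
  then show "finite (codesB1 c)" unfolding codesB1_def by blast
  have three: "card {c - 1, c, c + 1} = 3" using c by (auto simp: card_insert_if)
  have "card (codesB1 c) = card (?A \<union> ?B)" unfolding codesB1_def by (rule card_image) (auto simp: inj_on_def)
  also have "\<dots> = card ?A + card ?B" by (rule card_Un_disjoint[OF fin]) auto
  also have "card ?A = 3" using c by (subst card_image) (auto simp: inj_on_def)
  also have "card ?B = (\<Sum>e\<in>{3..c + 1}. card (if 2 * e \<le> c + 2 then {2 * e - 4} else {c - 1, c, c + 1}))"
    by (rule card_SigmaI) auto
  also have "\<dots> = (\<Sum>e\<in>{3..c + 1}. 1 + (if c + 3 \<le> 2 * e then 2 else 0))"
    by (intro sum.cong refl) (simp only: three split: if_split, simp)
  also have "\<dots> = (\<Sum>e\<in>{3..c + 1}. 1) + (\<Sum>e\<in>{3..c + 1}. if c + 3 \<le> 2 * e then 2 else 0)" by (rule sum.distrib)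
  also have "(\<Sum>e\<in>{3..c + 1}. if c + 3 \<le> 2 * e then 2 else 0) = (\<Sum>e\<in>{e\<in>{3..c + 1}. c + 3 \<le> 2 * e}. 2)"
    by (rule sum.inter_filter[symmetric]) simp
  also have "{e\<in>{3..c + 1}. c + 3 \<le> 2 * e} = {h + 2..c + 1}" using c h by auto
  finally show "card (codesB1 c) = 3 + (c - 1) + 2 * (c - h)" by simp
qed

lemma card_codesB2:
  assumes c: "c \<ge> 4" and h: "h = c div 2"
  shows "finite (codesB2 c)" "card (codesB2 c) = 3 + (c + h + 7)"
proof -
  let ?A = "{(2, c + 3, 3), (c, c + 3, c + 1), (c + 1, c + 3, c + 1)} :: (nat \<times> nat \<times> nat) set"
  let ?S = "SIGMA q : {2..c + 1}. band c (q + 1) \<times> band c (2 * q - 2)"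
  let ?B = "(\<lambda>(q, e, r). (q, r, e)) ` ?S"
  have fin: "finite ?A" "finite ?B" by auto
  then show "finite (codesB2 c)" unfolding codesB2_def by blast
  have "card (codesB2 c) = card (?A \<union> ?B)" unfolding codesB2_def by (rule card_image) (auto simp: inj_on_def)
  also have "\<dots> = card ?A + card ?B"
    by (rule card_Un_disjoint[OF fin]) (auto simp: band_def split: if_splits)
  also have "card ?A = 3" using c by simp
  also have "card ?B = card ?S" by (rule card_image) (auto simp: inj_on_def)
  also have "\<dots> = (\<Sum>q\<in>{2..c + 1}. card (band c (q + 1) \<times> band c (2 * q - 2)))" by (rule card_SigmaI) auto
  \<comment> \<open>From q = c - 1 on both bands have two elements; for the second one this is 2(c -
    1) - 2 >= c, hence c >= 4.\<close>
  also have "\<dots> = (\<Sum>q\<in>{2..<c - 1} \<union> {c - 1..c + 1}. card (band c (q + 1) \<times> band c (2 * q - 2)))"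
    using c by (intro sum.cong) auto
  also have "\<dots> = (\<Sum>q\<in>{2..<c - 1}. card (band c (q + 1) \<times> band c (2 * q - 2))) +
      (\<Sum>q\<in>{c - 1..c + 1}. card (band c (q + 1) \<times> band c (2 * q - 2)))"
    by (rule sum.union_disjoint) auto
  also have "(\<Sum>q\<in>{c - 1..c + 1}. card (band c (q + 1) \<times> band c (2 * q - 2))) = (\<Sum>q\<in>{c - 1..c + 1}. 4)"
    by (intro sum.cong) (use c in \<open>auto simp: card_cartesian_product card_band\<close>)
  also have "\<dots> = 12" using c by simp
  also have "(\<Sum>q\<in>{2..<c - 1}. card (band c (q + 1) \<times> band c (2 * q - 2))) =
      (\<Sum>q\<in>{2..<c - 1}. 1 + (if c + 2 \<le> 2 * q then 1 else 0))"
    by (intro sum.cong) (auto simp: card_cartesian_product card_band)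
  also have "\<dots> = (\<Sum>q\<in>{2..<c - 1}. 1) + (\<Sum>q\<in>{2..<c - 1}. if c + 2 \<le> 2 * q then 1 else 0)" by (rule sum.distrib)
  also have "(\<Sum>q\<in>{2..<c - 1}. if c + 2 \<le> 2 * q then 1 else 0) = (\<Sum>q\<in>{q\<in>{2..<c - 1}. c + 2 \<le> 2 * q}. 1)"
    by (rule sum.inter_filter[symmetric]) simp
  also have "{q\<in>{2..<c - 1}. c + 2 \<le> 2 * q} = {c + 1 - h..<c - 1}" using c h by auto
  finally show "card (codesB2 c) = 3 + (c + h + 7)" using c h by simp
qed

text \<open>The origin of the ceiling term: v^3 has weight 3(p - 1) and gets a second value once 3p
  - 3 >= c, that is for p from (c + 5) div 3 = (n + 2) div 3 on, where n = c + 3.\<close>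

lemma sum_card_band_cubes:
  assumes c: "c \<ge> 4"
  shows "(\<Sum>p\<in>{2..c + 1}. card (band c (3 * p - 3))) + (c + 5) div 3 = 2 * c + 2"
proof -
  have "(\<Sum>p\<in>{2..c + 1}. card (band c (3 * p - 3))) = (\<Sum>p\<in>{2..c + 1}. 1 + (if c + 3 \<le> 3 * p then 1 else 0))"
    by (intro sum.cong) (auto simp: card_band)
  also have "\<dots> = (\<Sum>p\<in>{2..c + 1}. 1) + (\<Sum>p\<in>{2..c + 1}. if c + 3 \<le> 3 * p then 1 else 0)" by (rule sum.distrib)
  also have "(\<Sum>p\<in>{2..c + 1}. if c + 3 \<le> 3 * p then 1 else 0) = (\<Sum>p\<in>{p\<in>{2..c + 1}. c + 3 \<le> 3 * p}. 1)"
    by (rule sum.inter_filter[symmetric]) simp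
  also have "{p\<in>{2..c + 1}. c + 3 \<le> 3 * p} = {(c + 5) div 3..c + 1}" using c by auto
  finally show ?thesis using c by simp
qed

lemma card_codesB4:
  assumes c: "c \<ge> 4"
  shows "finite (codesB4 c)" "card (codesB4 c) + (c + 5) div 3 = 2 * c + 6"
proof -
  let ?S = "SIGMA p : {2..c + 1}. band c p \<times> band c (3 * p - 3)"
  show "finite (codesB4 c)" unfolding codesB4_def by (intro finite_imageI finite_SigmaI) auto
  have "card (codesB4 c) = card ?S" unfolding codesB4_def by (rule card_image) (auto simp: inj_on_def)
  also have "\<dots> = (\<Sum>p\<in>{2..c + 1}. card (band c p \<times> band c (3 * p - 3)))" by (rule card_SigmaI) auto
  \<comment> \<open>For p in {c, c + 1} the product vu has two values; since v^3 has two there as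
    well, the doubling adds 2.\<close>
  also have "\<dots> = (\<Sum>p\<in>{2..c + 1}. card (band c (3 * p - 3)) + (if p \<in> {c, c + 1} then 2 else 0))"
    by (intro sum.cong) (use c in \<open>auto simp: card_cartesian_product card_band\<close>)
  also have "\<dots> = (\<Sum>p\<in>{2..c + 1}. card (band c (3 * p - 3))) + (\<Sum>p\<in>{2..c + 1}. if p \<in> {c, c + 1} then 2 else 0)"
    by (rule sum.distrib)
  also have "(\<Sum>p\<in>{2..c + 1}. if p \<in> {c, c + 1} then 2 else 0) = (\<Sum>p\<in>{p\<in>{2..c + 1}. p \<in> {c, c + 1}}. 2)"
    by (rule sum.inter_filter[symmetric]) simp
  also have "{p\<in>{2..c + 1}. p \<in> {c, c + 1}} = {c, c + 1}" using c by auto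
  finally show "card (codesB4 c) + (c + 5) div 3 = 2 * c + 6" using sum_card_band_cubes[OF c] by simp
qed

lemma card_codesB4_comm:
  assumes c: "c \<ge> 4"
  shows "card {\<kappa>\<in>codesB4 c. commB \<kappa>} + (c + 5) div 3 = 2 * c + 2"
proof -
  have "{\<kappa>\<in>codesB4 c. commB \<kappa>} = (\<lambda>(p, e). (p, p, c + 3, e)) ` (SIGMA p : {2..c + 1}. band c (3 * p - 3))"
  proof -
    have "p \<in> band c p" if "p \<in> {2..c + 1}" for p using that by (auto simp: band_def)
    then show ?thesis unfolding codesB4_def by (auto simp: image_iff)
  qed
  also have "card \<dots> = card (SIGMA p : {2..c + 1}. band c (3 * p - 3))" by (rule card_image) (auto simp: inj_on_def)
  also have "\<dots> = (\<Sum>p\<in>{2..c + 1}. card (band c (3 * p - 3)))" by (rule card_SigmaI) auto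
  finally show ?thesis using sum_card_band_cubes[OF c] by simp
qed

lemma repsB_parts:
  assumes c: "c \<ge> 4"
  shows "finite (repsB c)"
    and "card {\<kappa>\<in>repsB c. Pr \<kappa>} = card {\<kappa>\<in>codesB1 c. Pr \<kappa>} + card {\<kappa>\<in>codesB2 c. Pr \<kappa>} +
      card {\<kappa>\<in>swapB ` codesB2 c - {(2, c + 3, 2, 3)}. Pr \<kappa>} + card {\<kappa>\<in>codesB4 c - {(2, 2, c + 3, 3)}. Pr \<kappa>}"
proof -
  let ?A = "codesB1 c" and ?B = "codesB2 c" and ?C = "swapB ` codesB2 c - {(2, c + 3, 2, 3)}"
    and ?D = "codesB4 c - {(2, 2, c + 3, 3)}"
  have fin: "finite ?A" "finite ?B" "finite ?C" "finite ?D"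
    using card_codesB1(1)[OF c refl] card_codesB2(1)[OF c refl] card_codesB4(1)[OF c] by auto
  then show "finite (repsB c)" unfolding repsB_eq[OF c] by simp
  have A: "fst \<kappa> = c + 3 \<and> fst (snd \<kappa>) = c + 3" if "\<kappa> \<in> ?A" for \<kappa> using that by (auto simp: codesB1_def)
  have B: "fst \<kappa> = c + 3 \<and> fst (snd \<kappa>) \<noteq> c + 3" if "\<kappa> \<in> ?B" for \<kappa> using that codesB2_ne[OF c] by (cases \<kappa>) fastforce
  have C: "fst \<kappa> \<noteq> c + 3 \<and> fst (snd \<kappa>) = c + 3" if "\<kappa> \<in> ?C" for \<kappa>
  proof -
    obtain x where "x \<in> codesB2 c" "\<kappa> = swapB x" using \<open>\<kappa> \<in> ?C\<close> by blast
    then show ?thesis using B[of x] by (cases x) simp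
  qed
  have D: "fst \<kappa> \<noteq> c + 3 \<and> fst (snd \<kappa>) \<noteq> c + 3" if "\<kappa> \<in> ?D" for \<kappa>
    using that by (auto simp: codesB4_def band_def split: if_splits)
  have "{\<kappa>\<in>repsB c. Pr \<kappa>} = {\<kappa>\<in>?A. Pr \<kappa>} \<union> {\<kappa>\<in>?B. Pr \<kappa>} \<union> {\<kappa>\<in>?C. Pr \<kappa>} \<union> {\<kappa>\<in>?D. Pr \<kappa>}"
    unfolding repsB_eq[OF c] by blast
  then have "card {\<kappa>\<in>repsB c. Pr \<kappa>} = card ({\<kappa>\<in>?A. Pr \<kappa>} \<union> {\<kappa>\<in>?B. Pr \<kappa>} \<union> {\<kappa>\<in>?C. Pr \<kappa>} \<union> {\<kappa>\<in>?D. Pr \<kappa>})"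
    by (rule arg_cong)
  also have "\<dots> = card ({\<kappa>\<in>?A. Pr \<kappa>} \<union> {\<kappa>\<in>?B. Pr \<kappa>} \<union> {\<kappa>\<in>?C. Pr \<kappa>}) + card {\<kappa>\<in>?D. Pr \<kappa>}"
    using fin A B C D by (intro card_Un_disjoint finite_UnI finite_Collect_conjI disjI1) (simp_all only: Collect_mem_eq, blast)
  also have "card ({\<kappa>\<in>?A. Pr \<kappa>} \<union> {\<kappa>\<in>?B. Pr \<kappa>} \<union> {\<kappa>\<in>?C. Pr \<kappa>}) = card ({\<kappa>\<in>?A. Pr \<kappa>} \<union> {\<kappa>\<in>?B. Pr \<kappa>}) + card {\<kappa>\<in>?C. Pr \<kappa>}"
    using fin A B C by (intro card_Un_disjoint finite_UnI finite_Collect_conjI disjI1) (simp_all only: Collect_mem_eq, blast)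
  also have "card ({\<kappa>\<in>?A. Pr \<kappa>} \<union> {\<kappa>\<in>?B. Pr \<kappa>}) = card {\<kappa>\<in>?A. Pr \<kappa>} + card {\<kappa>\<in>?B. Pr \<kappa>}"
    using fin A B by (intro card_Un_disjoint finite_Collect_conjI disjI1) (simp_all only: Collect_mem_eq, blast)
  finally show "card {\<kappa>\<in>repsB c. Pr \<kappa>} = card {\<kappa>\<in>codesB1 c. Pr \<kappa>} + card {\<kappa>\<in>codesB2 c. Pr \<kappa>} +
      card {\<kappa>\<in>swapB ` codesB2 c - {(2, c + 3, 2, 3)}. Pr \<kappa>} + card {\<kappa>\<in>codesB4 c - {(2, 2, c + 3, 3)}. Pr \<kappa>}" .
qed

lemma special_mem:
  assumes c: "c \<ge> 4"
  shows "(c + 3, 2, 2, 3) \<in> codesB2 c" "(2, c + 3, 2, 3) \<in> swapB ` codesB2 c" "(2, 2, c + 3, 3) \<in> codesB4 c"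
proof -
  have "(2, 3, 2) \<in> (SIGMA q : {2..c + 1}. band c (q + 1) \<times> band c (2 * q - 2))"
    using c by (auto simp: band_def)
  then have "(\<lambda>(q, e, r). (q, r, e)) (2, 3, 2) \<in> (\<lambda>(q, e, r). (q, r, e)) ` (SIGMA q : {2..c + 1}. band c (q + 1) \<times> band c (2 * q - 2))"
    by (rule imageI)
  then show 1: "(c + 3, 2, 2, 3) \<in> codesB2 c" unfolding codesB2_def by (force simp: image_iff)
  show "(2, c + 3, 2, 3) \<in> swapB ` codesB2 c" using imageI[OF 1, of swapB] by simp
  show "(2, 2, c + 3, 3) \<in> codesB4 c" using c unfolding codesB4_def by (force simp: image_iff band_def)
qed

text \<open>The total is free of h: \<open>codesB1\<close> contributes -2h and each of the two
  copies of \<open>codesB2\<close> contributes h.\<close>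

lemma card_repsB:
  assumes c: "c \<ge> 4" and h: "h = c div 2"
  shows "card (repsB c) + (c + 5) div 3 = 7 * c + 26"
proof -
  have "inj_on swapB (codesB2 c)" by (rule inj_onI) (auto elim!: swapB.elims)
  then have sw: "card (swapB ` codesB2 c) = card (codesB2 c)" by (rule card_image)
  have "card (repsB c) = card (codesB1 c) + card (codesB2 c) + card (swapB ` codesB2 c - {(2, c + 3, 2, 3)}) + card (codesB4 c - {(2, 2, c + 3, 3)})"
    using repsB_parts(2)[OF c, of "\<lambda>_. True"] by (simp only: simp_thms Collect_mem_eq)
  moreover have "card (swapB ` codesB2 c - {(2, c + 3, 2, 3)}) = card (swapB ` codesB2 c) - 1"
    "card (codesB4 c - {(2, 2, c + 3, 3)}) = card (codesB4 c) - 1"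
    using special_mem[OF c] by (simp_all add: card_Diff_singleton)
  moreover have "card (codesB4 c) > 0" using special_mem(3)[OF c] card_codesB4(1)[OF c] by (auto simp: card_gt_0_iff)
  moreover have "h \<le> c" using h by simp
  ultimately show ?thesis
    using card_codesB1(2)[OF c h] card_codesB2(2)[OF c h] card_codesB4(2)[OF c] sw c by simp
qed

lemma card_repsB_comm:
  assumes c: "c \<ge> 4" and h: "h = c div 2"
  shows "card {\<kappa>\<in>repsB c. commB \<kappa>} + 2 * h + (c + 5) div 3 = 5 * c + 3"
proof -
  have "{\<kappa>\<in>codesB1 c. commB \<kappa>} = codesB1 c" by (auto simp: codesB1_def)
  moreover have "{\<kappa>\<in>codesB2 c. commB \<kappa>} = {}" using codesB2_ne[OF c] by fastforce
  moreover have "{\<kappa>\<in>swapB ` codesB2 c - {(2, c + 3, 2, 3)}. commB \<kappa>} = {}" using codesB2_ne[OF c] by fastforce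
  moreover have "{\<kappa>\<in>codesB4 c - {(2, 2, c + 3, 3)}. commB \<kappa>} = {\<kappa>\<in>codesB4 c. commB \<kappa>} - {(2, 2, c + 3, 3)}" by auto
  moreover have "card ({\<kappa>\<in>codesB4 c. commB \<kappa>} - {(2, 2, c + 3, 3)}) = card {\<kappa>\<in>codesB4 c. commB \<kappa>} - 1"
    using special_mem[OF c] by (simp add: card_Diff_singleton)
  ultimately have "card {\<kappa>\<in>repsB c. commB \<kappa>} = card (codesB1 c) + (card {\<kappa>\<in>codesB4 c. commB \<kappa>} - 1)"
    by (simp only: repsB_parts(2)[OF c, of commB] card.empty add_0_right)
  moreover have "h \<le> c" "(c + 5) div 3 < 2 * c + 2" using h c by auto
  ultimately show ?thesis using card_codesB1(2)[OF c h] card_codesB4_comm[OF c] c by simp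
qed

lemma card_repsB_sd:
  assumes c: "c \<ge> 4"
  shows "card {\<kappa>\<in>repsB c. sdB c \<kappa>} = card {\<kappa>\<in>repsB c. commB \<kappa>} + 1"
proof -
  have "(c + 3, 2, 2, 3) \<in> repsB c" using special_mem(1)[OF c] unfolding repsB_eq[OF c] by blast
  then have "{\<kappa>\<in>repsB c. sdB c \<kappa>} = insert (c + 3, 2, 2, 3) {\<kappa>\<in>repsB c. commB \<kappa>}" by (auto simp: sdB_def)
  moreover have "finite {\<kappa>\<in>repsB c. commB \<kappa>}" using repsB_parts(1)[OF c] by simp
  ultimately show ?thesis by simp
qed

section \<open>The number of nilpotent semigroups of coclass 2\<close>

text \<open>S^2 has c elements in type A and c + 1 in type B.\<close>

lemma frameA_not_isomorphic_frameB:
  assumes "frameA c f" "frameB c g" "c \<ge> 4"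
  shows "\<not> isomorphic (table c f) (table c g)" "\<not> isomorphic (table c g) (table c f)"
proof -
  interpret G: frB c g by unfold_locales (use assms in auto)
  have sg: "is_semigroup (table c f)" "is_semigroup (table c g)"
    using assms(1) G.pt by (auto simp: frameA_def power_table_def)
  have "card (products (table c f) 2) = c" using frameA_products[OF assms(1,3), of 2] assms(3) by simp
  moreover have "card (products (table c g) 2) = c + 1" unfolding G.products_2 using assms(3) by simp
  ultimately have ne: "card (products (table c f) 2) \<noteq> card (products (table c g) 2)" by simp
  show "\<not> isomorphic (table c f) (table c g)"
    using iso_map_card_products[OF _ sg(1)] ne unfolding isomorphic_iff by metis
  show "\<not> isomorphic (table c g) (table c f)"
    using iso_map_card_products[OF _ sg(2)] ne unfolding isomorphic_iff by metis
qed

lemma is_commutative_isomorphic: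
  assumes "isomorphic S T" "is_commutative S" shows "is_commutative T"
proof -
  obtain \<phi> where \<phi>: "iso_map \<phi> S T" using assms by (auto simp: isomorphic_iff)
  show ?thesis
    unfolding is_commutative_def iso_map_surj[OF \<phi>, symmetric]
    using assms(2) iso_map_mul[OF \<phi>] by (auto simp: is_commutative_def) metis
qed

definition reps :: "nat \<Rightarrow> (quad \<times> quad + quad) set" where
  "reps c = repsA c <+> repsB c"

definition model :: "nat \<Rightarrow> quad \<times> quad + quad \<Rightarrow> nat magma" where
  "model c i = (case i of Inl \<kappa> \<Rightarrow> table c (opA c \<kappa>) | Inr \<kappa> \<Rightarrow> table c (opB c \<kappa>))"

lemma model_in_nilpotent_semigroups:
  assumes "c \<ge> 4" "i \<in> reps c" shows "model c i \<in> nilpotent_semigroups (c + 3) 2"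
proof (cases i)
  case (Inl \<kappa>)
  then have "frameA c (opA c \<kappa>)" using assms frameA_opA by (auto simp: reps_def repsA_def)
  then show ?thesis using Inl assms(1) frameA_in_nilpotent_semigroups by (simp add: model_def)
next
  case (Inr \<kappa>)
  then have "frameB c (opB c \<kappa>)" using assms frameB_opB by (auto simp: reps_def repsB_def)
  then interpret frB c "opB c \<kappa>" by unfold_locales (use assms in auto)
  show ?thesis using in_nilpotent_semigroups Inr by (simp add: model_def)
qed

lemma model_exists:
  assumes "c \<ge> 4" "S \<in> nilpotent_semigroups (c + 3) 2"
  shows "\<exists>i\<in>reps c. isomorphic S (model c i)"
proof -
  obtain f where f: "isomorphic S (table c f)" "frameA c f \<or> frameB c f"
    using nilpotent_semigroups_frame assms by blast
  from f(2) show ?thesis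
  proof
    assume "frameA c f"
    then obtain \<kappa> where \<kappa>: "\<kappa> \<in> repsA c" "isomorphic (table c f) (table c (opA c \<kappa>))"
      using repsA_exists assms(1) by blast
    then have "isomorphic S (model c (Inl \<kappa>))" using isomorphic_trans[OF f(1)] by (simp add: model_def)
    moreover have "Inl \<kappa> \<in> reps c" using \<kappa> by (auto simp: reps_def)
    ultimately show ?thesis by blast
  next
    assume "frameB c f"
    then obtain \<kappa> where \<kappa>: "\<kappa> \<in> repsB c" "isomorphic (table c f) (table c (opB c \<kappa>))"
      using repsB_exists assms(1) by blast
    then have "isomorphic S (model c (Inr \<kappa>))" using isomorphic_trans[OF f(1)] by (simp add: model_def)
    moreover have "Inr \<kappa> \<in> reps c" using \<kappa> by (auto simp: reps_def)
    ultimately show ?thesis by blast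
  qed
qed

lemma model_unique:
  assumes "c \<ge> 4" "i \<in> reps c" "j \<in> reps c" "isomorphic (model c i) (model c j)"
  shows "i = j"
proof -
  have A: "frameA c (opA c \<kappa>)" if "\<kappa> \<in> repsA c" for \<kappa>
    using that assms(1) frameA_opA by (simp add: repsA_def)
  have B: "frameB c (opB c \<kappa>)" if "\<kappa> \<in> repsB c" for \<kappa>
    using that assms(1) frameB_opB by (simp add: repsB_def)
  show ?thesis
    using assms repsA_unique repsB_unique frameA_not_isomorphic_frameB[OF A B assms(1)]
    by (cases i; cases j) (auto simp: reps_def model_def)
qed

lemma finite_reps: "c \<ge> 4 \<Longrightarrow> finite (reps c)"
  by (simp add: reps_def finite_repsA repsB_parts(1))

lemma card_reps_filter:
  assumes "c \<ge> 4"
  shows "card {i\<in>reps c. Pr i} = card {\<kappa>\<in>repsA c. Pr (Inl \<kappa>)} + card {\<kappa>\<in>repsB c. Pr (Inr \<kappa>)}"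
proof -
  have "{i\<in>reps c. Pr i} = {\<kappa>\<in>repsA c. Pr (Inl \<kappa>)} <+> {\<kappa>\<in>repsB c. Pr (Inr \<kappa>)}"
    by (auto simp: reps_def)
  then show ?thesis using assms finite_repsA repsB_parts(1) by (simp add: card_Plus)
qed

lemma card_reps_comm:
  assumes "c \<ge> 4"
  shows "card {i\<in>reps c. is_commutative (model c i)} =
    card {\<kappa>\<in>repsA c. commA \<kappa>} + card {\<kappa>\<in>repsB c. commB \<kappa>}"
proof -
  have "{\<kappa>\<in>repsA c. is_commutative (table c (opA c \<kappa>))} = {\<kappa>\<in>repsA c. commA \<kappa>}"
    using is_commutative_opA[OF assms] by (auto simp: repsA_def)
  moreover have "{\<kappa>\<in>repsB c. is_commutative (table c (opB c \<kappa>))} = {\<kappa>\<in>repsB c. commB \<kappa>}"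
    using is_commutative_opB by (auto simp: repsB_def)
  ultimately show ?thesis
    using card_reps_filter[OF assms, of "\<lambda>i. is_commutative (model c i)"] by (simp add: model_def)
qed

lemma card_reps_sd:
  assumes "c \<ge> 4"
  shows "card {i\<in>reps c. isomorphic (model c i) (dual (model c i))} =
    card {\<kappa>\<in>repsA c. sdA \<kappa>} + card {\<kappa>\<in>repsB c. sdB c \<kappa>}"
proof -
  have "{\<kappa>\<in>repsA c. isomorphic (table c (opA c \<kappa>)) (dual (table c (opA c \<kappa>)))} = {\<kappa>\<in>repsA c. sdA \<kappa>}"
    using self_dual_opA[OF assms] by auto
  moreover have "{\<kappa>\<in>repsB c. isomorphic (table c (opB c \<kappa>)) (dual (table c (opB c \<kappa>)))} = {\<kappa>\<in>repsB c. sdB c \<kappa>}"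
    using self_dual_opB[OF assms] by auto
  ultimately show ?thesis
    using card_reps_filter[OF assms, of "\<lambda>i. isomorphic (model c i) (dual (model c i))"] by (simp add: model_def)
qed

lemma ceiling_third: "\<lceil>real n / 3\<rceil> = int ((n + 2) div 3)"
proof (rule ceiling_unique)
  have "3 * ((n + 2) div 3) \<le> n + 2" "n \<le> 3 * ((n + 2) div 3)" by auto
  then have "real (3 * ((n + 2) div 3)) \<le> real (n + 2)" "real n \<le> real (3 * ((n + 2) div 3))"
    by (simp_all only: of_nat_le_iff)
  then show "real_of_int (int ((n + 2) div 3)) - 1 < real n / 3" "real n / 3 \<le> real_of_int (int ((n + 2) div 3))"
    by simp_all
qed

theorem corollary5p4:
  fixes n :: nat
  assumes "n \<ge> 7"
  shows
    "real (number_up_to (\<lambda>S T. isomorphic S T \<or> anti_isomorphic S T) (nilpotent_semigroups n 2)) =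
       (if even n then (21 * real n ^ 2 + 66 * real n - 104) / 8 - of_int \<lceil>real n / 3\<rceil>
        else (21 * real n ^ 2 + 80 * real n - 93) / 8 - of_int \<lceil>real n / 3\<rceil>) \<and>
     real (number_up_to isomorphic (nilpotent_semigroups n 2)) =
       (if even n then (27 * real n ^ 2 + 150 * real n - 240) / 8 - of_int \<lceil>real n / 3\<rceil>
        else (27 * real n ^ 2 + 168 * real n - 203) / 8 - of_int \<lceil>real n / 3\<rceil>) \<and>
     real (number_up_to isomorphic {S \<in> nilpotent_semigroups n 2. is_commutative S}) =
       (if even n then (15 * real n ^ 2 - 26 * real n - 40) / 8 - of_int \<lceil>real n / 3\<rceil>
        else (15 * real n ^ 2 - 16 * real n - 63) / 8 - of_int \<lceil>real n / 3\<rceil>)"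
proof -
  define c where "c = n - 3"
  have n: "n = c + 3" and c: "c \<ge> 4" using assms by (auto simp: c_def)
  define h where "h = c div 2"
  define k where "k = (c + 5) div 3"
  let ?X = "nilpotent_semigroups n 2"
  have in_X: "\<And>i. i \<in> reps c \<Longrightarrow> model c i \<in> ?X"
    and ex: "\<And>S. S \<in> ?X \<Longrightarrow> \<exists>i\<in>reps c. isomorphic S (model c i)"
    using model_in_nilpotent_semigroups[OF c] model_exists[OF c] unfolding n by blast+
  note un = model_unique[OF c]
  have sg: "is_semigroup S" if "S \<in> ?X" for S
    using that by (simp add: nilpotent_semigroups_def nilpotent_def)
  have iso: "number_up_to isomorphic ?X = card (reps c)"
    by (rule number_up_to_reps[OF equiv_isomorphic[OF order_refl] in_X ex un])
  have anti: "2 * number_up_to (\<lambda>S T. isomorphic S T \<or> anti_isomorphic S T) ?X =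
      card (reps c) + card {i\<in>reps c. isomorphic (model c i) (dual (model c i))}"
    by (rule number_up_to_anti[OF finite_reps[OF c] in_X ex un])
  have comm: "number_up_to isomorphic {S \<in> ?X. is_commutative S} = card {i\<in>reps c. is_commutative (model c i)}"
  proof (rule number_up_to_reps)
    show "equiv {S \<in> ?X. is_commutative S}
        {(S, T). S \<in> {S \<in> ?X. is_commutative S} \<and> T \<in> {S \<in> ?X. is_commutative S} \<and> isomorphic S T}"
      by (rule equiv_isomorphic[of _ n 2]) blast
    show "\<exists>i\<in>{i \<in> reps c. is_commutative (model c i)}. isomorphic S (model c i)"
      if "S \<in> {S \<in> ?X. is_commutative S}" for S
      using that ex[of S] is_commutative_isomorphic by blast
  qed (use in_X un in auto)
  have card_iso: "card (reps c) = card (repsA c) + card (repsB c)"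
    using card_reps_filter[OF c, of "\<lambda>_. True"] by simp
  note A = card_repsA[OF c h_def] card_repsA_comm[OF c h_def] card_repsA_sd[OF c h_def]
  note B = card_repsB[OF c h_def, folded k_def] card_repsB_comm[OF c h_def, folded k_def] card_repsB_sd[OF c]
  define a where "a = real (card (repsA c))"
  define a' where "a' = real (card {\<kappa>\<in>repsA c. commA \<kappa>})"
  define b where "b = real (card (repsB c))"
  define b' where "b' = real (card {\<kappa>\<in>repsB c. commB \<kappa>})"
  have a: "2 * a = 4 * (2 * real h + 6)^2 + 2 * (4 * (real c - 2 - real h) * (2 * real h + 6) -
      3 * (real h - 1) * (real h - 2)) + (real c - 2 - real h)^2 + (16 + 4 * (real h - 1) + (real c - 2 - real h)) +
      2 * (real c + real h + 17)"
    using arg_cong[OF A(1), of real_of_int] by (simp add: a_def)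
  have a': "2 * a' = 8 * (real h + 1)^2 + 8 * (real h + 1) * (real c - 2 - real h) -
      2 * (real h - 1) * (real h - 2) + (real c - 2 - real h)^2 + (4 * (real h + 1) + (real c - 2 - real h)) +
      2 * (real c + real h + 3)"
    using arg_cong[OF A(2), of real_of_int] by (simp add: a'_def)
  have b: "b + real k = 7 * real c + 26"
    using arg_cong[OF B(1), of real] by (simp add: b_def)
  have b': "b' + 2 * real h + real k = 5 * real c + 3"
    using arg_cong[OF B(2), of real] by (simp add: b'_def)
  \<comment> \<open>Self-dual but non-commutative are 2h + 12 classes of type A and one of type
    B.\<close>
  have sd: "real (card {i\<in>reps c. isomorphic (model c i) (dual (model c i))}) = a' + b' + 2 * real h + 13"
    unfolding card_reps_sd[OF c] A(3) B(3) a'_def b'_def by simp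
  have counts:
    "2 * real (number_up_to (\<lambda>S T. isomorphic S T \<or> anti_isomorphic S T) ?X) = a + b + a' + b' + 2 * real h + 13"
    "real (number_up_to isomorphic ?X) = a + b"
    "real (number_up_to isomorphic {S \<in> ?X. is_commutative S}) = a' + b'"
    using arg_cong[OF anti, of real] sd unfolding iso comm card_iso card_reps_comm[OF c] a_def a'_def b_def b'_def
    by simp_all
  have ceil: "real_of_int \<lceil>real n / 3\<rceil> = real k"
    unfolding ceiling_third k_def n by simp
  show ?thesis
  \<comment> \<open>The parity of n decides between c = 2h + 1 and c = 2h; the claims then become
    polynomial identities in h with a linear term k.\<close>
  proof (cases "even n")
    case True
    then have "c = 2 * h + 1" unfolding h_def n by presburger
    then have rc: "real c = 2 * real h + 1" "real n = 2 * real h + 4" unfolding n by simp_all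
    show ?thesis
      using True counts a a' b b' unfolding ceil unfolding rc by (auto simp: power2_eq_square field_simps)
  next
    case False
    then have "c = 2 * h" unfolding h_def n by presburger
    then have rc: "real c = 2 * real h" "real n = 2 * real h + 3" unfolding n by simp_all
    show ?thesis
      using False counts a a' b b' unfolding ceil unfolding rc by (auto simp: power2_eq_square field_simps)
  qed
qed

end
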